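(* Let $k$ be an algebraically closed field of characteristic zero and let $I \subset k[x_0,\dots,x_n]$ be a homogeneous ideal. The $m$th Hilbert point $[I]_m$ is generically stable with respect to the natural $\mathrm{SL}_{n+1}(k)$-action, for any $m \ge \mathrm{reg}(I)$, where $\mathrm{reg}(I)$ is the Castelnuovo–Mumford regularity of $I$.
   Context: Write $S = k[x_0,\dots,x_n]$, let $S_m$ and $I_m$ denote the degree $m$ pieces of $S$ and $I$, and let $\ell = \dim_k I_m$. The $m$th Hilbert point $[I]_m$ is the point of $\mathbb P(\bigwedge^\ell S_m)$ represented by the vector $v = f_1\wedge\cdots\wedge f_\ell$, where $f_1,\dots,f_\ell$ is a $k$-basis of $I_m$. The group $G=\mathrm{SL}_{n+1}(k)$ acts naturally on $S$ by linear substitution of the variables, $g.x_i = \sum_{j=0}^n g_{ji}x_j$ for $g=(g_{ij})$, hence on $\bigwedge^\ell S_m$. Fix a maximal torus $R$ of $G$ with character group $X(R)$. For $u \in \bigwedge^\ell S_m$ with $R$-weight decomposition $u = \sum_\chi u_\chi$, put $\Xi_u(R) = \{\chi\in X(R) \mid u_\chi\neq 0\}$. There is a nonempty (dense) Zariski open $U\subset G$ such that $\Xi_{g.v}(R)$ is the same set for all $g \in U$; the primary generic state polytope $\mathcal{GP}_v(R)$ is the convex hull in $X(R)_{\mathbb R} = X(R)\otimes_{\mathbb Z}\mathbb R$ of $\Xi_{g.v}(R)$ for any $g\in U$. The Hilbert point $[I]_m$ is generically stable if the interior of $\mathcal{GP}_v(R)$ contains the origin (the trivial character).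
   Formalization: For n ≥ 1 it is additionally assumed that I ≠ 0 and I_m ≠ S_m; otherwise v spans a trivial representation, the generic state polytope is {0}, its interior in X(R)_ℝ is empty, and the claim fails (e.g. I = S, m = 0). *)

theory Defs
  imports
    "HOL-Analysis.Analysis"
    "HOL-Computational_Algebra.Polynomial"
    "HOL-Library.Poly_Mapping"
begin

section \<open>Polynomials\<close>

text \<open>The ring $k[x_i \mid i \in \iota]$ is the type \<open>('i, 'k) pol\<close> of finitely supported functions
  on monomials, with the convolution product of \<^theory>\<open>HOL-Library.Poly_Mapping\<close>. For
  $S = k[x_0,\dots,x_n]$ the index type is a finite type \<open>'n\<close> with $n + 1$ elements.\<close>

type_synonym 'i mon = "'i \<Rightarrow>\<^sub>0 nat"
type_synonym ('i, 'k) pol = "('i \<Rightarrow>\<^sub>0 nat) \<Rightarrow>\<^sub>0 'k"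

definition mdeg :: "'i mon \<Rightarrow> nat" where
  "mdeg t = (\<Sum>i\<in>Poly_Mapping.keys t. Poly_Mapping.lookup t i)"

definition const :: "'k::zero \<Rightarrow> ('i, 'k) pol" where
  "const c = Poly_Mapping.single 0 c"

definition var :: "'i \<Rightarrow> ('i, 'k::zero_neq_one) pol" where
  "var i = Poly_Mapping.single (Poly_Mapping.single i 1) 1"

text \<open>Substitute \<open>y i\<close> for the variable \<open>i\<close>, mapping coefficients by the ring homomorphism \<open>h\<close>.\<close>

definition insertion ::
  "('k::zero \<Rightarrow> 'r) \<Rightarrow> ('i \<Rightarrow> 'r) \<Rightarrow> ('i, 'k) pol \<Rightarrow> 'r::comm_semiring_1" where
  "insertion h y p = (\<Sum>t\<in>Poly_Mapping.keys p.
     h (Poly_Mapping.lookup p t) *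
     (\<Prod>i\<in>Poly_Mapping.keys t. y i ^ Poly_Mapping.lookup t i))"

abbreviation eval :: "('i \<Rightarrow> 'k) \<Rightarrow> ('i, 'k) pol \<Rightarrow> 'k::comm_semiring_1" where
  "eval \<equiv> insertion (\<lambda>c. c)"

text \<open>Scalar multiplication on any space of finitely supported functions, used for \<open>S\<close> and for
  tensors alike.\<close>

definition pm_scale :: "'k::semiring_0 \<Rightarrow> ('b \<Rightarrow>\<^sub>0 'k) \<Rightarrow> ('b \<Rightarrow>\<^sub>0 'k)" where
  "pm_scale c u = Poly_Mapping.map (\<lambda>x. c * x) u"

lemma lookup_pm_scale [simp]:
  "Poly_Mapping.lookup (pm_scale c u) b = c * Poly_Mapping.lookup u b"
  unfolding pm_scale_def by transfer (auto simp: when_def)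

global_interpretation pm: vector_space "pm_scale :: 'k::field \<Rightarrow> ('b \<Rightarrow>\<^sub>0 'k) \<Rightarrow> _"
  by unfold_locales (auto intro!: poly_mapping_eqI simp: lookup_add algebra_simps)


section \<open>Homogeneous ideals and graded pieces\<close>

text \<open>The degree is an integer because of the twists in graded free modules; in negative degree the
  piece is \<open>{0}\<close>.\<close>

definition homog :: "int \<Rightarrow> ('n, 'k::zero) pol set" where
  "homog e = {p. \<forall>t\<in>Poly_Mapping.keys p. int (mdeg t) = e}"

definition hom_component :: "int \<Rightarrow> ('n, 'k::comm_monoid_add) pol \<Rightarrow> ('n, 'k) pol" where
  "hom_component e p =
     (\<Sum>t\<in>{t \<in> Poly_Mapping.keys p. int (mdeg t) = e}.
        Poly_Mapping.single t (Poly_Mapping.lookup p t))"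

definition is_ideal :: "'r::comm_ring_1 set \<Rightarrow> bool" where
  "is_ideal I \<longleftrightarrow>
     0 \<in> I \<and> (\<forall>p\<in>I. \<forall>q\<in>I. p + q \<in> I) \<and> (\<forall>a. \<forall>p\<in>I. a * p \<in> I)"

definition homogeneous_ideal :: "('n, 'k::comm_ring_1) pol set \<Rightarrow> bool" where
  "homogeneous_ideal I \<longleftrightarrow> is_ideal I \<and> (\<forall>p\<in>I. \<forall>e. hom_component e p \<in> I)"

definition piece :: "('n, 'k::zero) pol set \<Rightarrow> nat \<Rightarrow> ('n, 'k) pol set" where
  "piece I m = I \<inter> homog (int m)"


section \<open>Castelnuovo--Mumford regularity\<close>

text \<open>Elements of the free module of rank \<open>r\<close> are functions vanishing from index \<open>r\<close> on.\<close>

definition free_mod :: "nat \<Rightarrow> (nat \<Rightarrow> 'r::zero) set" where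
  "free_mod r = {c. \<forall>j\<ge>r. c j = 0}"

definition mat_app ::
  "nat \<Rightarrow> nat \<Rightarrow> (nat \<Rightarrow> nat \<Rightarrow> 'r::comm_ring_1) \<Rightarrow> (nat \<Rightarrow> 'r) \<Rightarrow> (nat \<Rightarrow> 'r)" where
  "mat_app r s A c = (\<lambda>l. if l < r then \<Sum>j<s. A l j * c j else 0)"

text \<open>A minimal graded free resolution
  $\cdots \to F_1 \to F_0 \to I \to 0$ with $F_i = \bigoplus_{j < b_i} S(-d_{i,j})$: the augmentation
  is given by the generators \<open>f j\<close>, and \<open>A i\<close> is the matrix of $F_{i+1} \to F_i$. All maps are
  homogeneous of degree 0, and minimality says that the image of $F_{i+1}$ lies in
  $(x_0,\dots,x_n) F_i$. Finite length is not imposed; it follows from Hilbert's syzygy theorem.\<close>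

definition min_free_resolution ::
  "('n, 'k::comm_ring_1) pol set \<Rightarrow> (nat \<Rightarrow> nat) \<Rightarrow> (nat \<Rightarrow> nat \<Rightarrow> int) \<Rightarrow>
   (nat \<Rightarrow> ('n, 'k) pol) \<Rightarrow> (nat \<Rightarrow> nat \<Rightarrow> nat \<Rightarrow> ('n, 'k) pol) \<Rightarrow> bool" where
  "min_free_resolution I b d f A \<longleftrightarrow>
     (\<forall>j<b 0. f j \<in> homog (d 0 j)) \<and>
     (\<forall>i. \<forall>l<b i. \<forall>j<b (Suc i).
        A i l j \<in> homog (d (Suc i) j - d i l) \<and> Poly_Mapping.lookup (A i l j) 0 = 0) \<and>
     (\<lambda>c. \<Sum>j<b 0. c j * f j) ` free_mod (b 0) = I \<and>
     {c \<in> free_mod (b 0). (\<Sum>j<b 0. c j * f j) = 0} =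
       mat_app (b 0) (b 1) (A 0) ` free_mod (b 1) \<and>
     (\<forall>i. {c \<in> free_mod (b (Suc i)). mat_app (b i) (b (Suc i)) (A i) c = (\<lambda>_. 0)} =
       mat_app (b (Suc i)) (b (Suc (Suc i))) (A (Suc i)) ` free_mod (b (Suc (Suc i))))"

definition regular_in :: "('n, 'k::comm_ring_1) pol set \<Rightarrow> int \<Rightarrow> bool" where
  "regular_in I r \<longleftrightarrow>
     (\<exists>b d f A. min_free_resolution I b d f A \<and> (\<forall>i. \<forall>j<b i. d i j \<le> r + int i))"

text \<open>The least \<open>r\<close> such that \<open>I\<close> is \<open>r\<close>-regular; equivalently the maximum of all $d_{i,j} - i$,
  since the minimal graded free resolution is unique up to isomorphism.
  The zero ideal has regularity $-\infty$.\<close>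

definition cm_regularity :: "('n, 'k::comm_ring_1) pol set \<Rightarrow> ereal" where
  "cm_regularity I = Inf {ereal (real_of_int r) | r. regular_in I r}"


section \<open>Exterior powers and the action of the special linear group\<close>

definition SL :: "('k::comm_ring_1 ^ 'n ^ 'n) set" where
  "SL = {g. det g = 1}"

definition subst_act :: "'k::comm_ring_1 ^ 'n ^ 'n \<Rightarrow> ('n, 'k) pol \<Rightarrow> ('n, 'k) pol" where
  "subst_act g = insertion const (\<lambda>i. \<Sum>j\<in>UNIV. const (g $ j $ i) * var j)"

text \<open>The tensor algebra of \<open>S\<close> is the vector space with basis the words in the monomials of \<open>S\<close>,
  a word $[t_1,\dots,t_\ell]$ standing for $t_1 \otimes \cdots \otimes t_\ell$. The list argument of
  \<open>tensor\<close> is $f_1,\dots,f_\ell$, and \<open>tensor\<close> expands $f_1 \otimes \cdots \otimes f_\ell$.\<close>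

type_synonym ('n, 'k) tens = "'n mon list \<Rightarrow>\<^sub>0 'k"

definition tensor :: "('n, 'k::comm_ring_1) pol list \<Rightarrow> ('n, 'k) tens" where
  "tensor fs = (\<Sum>w\<in>listset (map Poly_Mapping.keys fs).
     Poly_Mapping.single w (\<Prod>i<length fs. Poly_Mapping.lookup (fs ! i) (w ! i)))"

text \<open>Exterior powers are realised inside the tensor algebra through the injective equivariant map
  $f_1 \wedge \cdots \wedge f_\ell \mapsto
    \sum_\sigma \mathrm{sgn}(\sigma)\, f_{\sigma(1)} \otimes \cdots \otimes f_{\sigma(\ell)}$.\<close>

definition wedge :: "('n, 'k::comm_ring_1) pol list \<Rightarrow> ('n, 'k) tens" where
  "wedge fs = (\<Sum>\<sigma> | \<sigma> permutes {..<length fs}.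
     pm_scale (of_int (sign \<sigma>)) (tensor (map (\<lambda>i. fs ! \<sigma> i) [0..<length fs])))"

definition ext_power :: "nat \<Rightarrow> ('n, 'k::field) pol set \<Rightarrow> ('n, 'k) tens set" where
  "ext_power l V = pm.span {wedge fs | fs. length fs = l \<and> set fs \<subseteq> V}"

text \<open>The diagonal action on tensors; it sends \<open>wedge fs\<close> to \<open>wedge (map (subst_act g) fs)\<close>.\<close>

definition tens_act :: "'k::comm_ring_1 ^ 'n ^ 'n \<Rightarrow> ('n, 'k) tens \<Rightarrow> ('n, 'k) tens" where
  "tens_act g u = (\<Sum>w\<in>Poly_Mapping.keys u.
     pm_scale (Poly_Mapping.lookup u w)
       (tensor (map (\<lambda>t. subst_act g (Poly_Mapping.single t 1)) w)))"

text \<open>The vectors $v = f_1 \wedge \cdots \wedge f_\ell$, for all \<open>k\<close>-bases of $I_m$, that represent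
  the Hilbert point $[I]_m$.\<close>

definition represents_hilbert_point ::
  "('n, 'k::field) pol set \<Rightarrow> nat \<Rightarrow> ('n, 'k) tens \<Rightarrow> bool" where
  "represents_hilbert_point I m v \<longleftrightarrow>
     (\<exists>fs. distinct fs \<and> pm.independent (set fs) \<and> pm.span (set fs) = piece I m \<and> v = wedge fs)"


section \<open>Maximal tori and their characters\<close>

abbreviation coords :: "'k ^ 'n ^ 'n \<Rightarrow> 'n \<times> 'n \<Rightarrow> 'k" where
  "coords g \<equiv> \<lambda>(i, j). g $ i $ j"

definition SL_closed :: "('k::comm_ring_1 ^ 'n ^ 'n) set \<Rightarrow> bool" where
  "SL_closed Z \<longleftrightarrow> (\<exists>P. Z = {g \<in> SL. \<forall>p\<in>P. eval (coords g) p = 0})"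

definition SL_open :: "('k::comm_ring_1 ^ 'n ^ 'n) set \<Rightarrow> bool" where
  "SL_open U \<longleftrightarrow> U \<subseteq> SL \<and> SL_closed (SL - U)"

text \<open>The group $(k^*)^r$ under pointwise multiplication; coordinates from \<open>r\<close> on are set to 1.\<close>

definition Gm :: "nat \<Rightarrow> (nat \<Rightarrow> 'k::field) set" where
  "Gm r = {s. (\<forall>i<r. s i \<noteq> 0) \<and> (\<forall>i\<ge>r. s i = 1)}"

text \<open>The regular functions on $(k^*)^r$ are the Laurent polynomials.\<close>

definition Gm_regular :: "nat \<Rightarrow> ((nat \<Rightarrow> 'k::field) \<Rightarrow> 'k) \<Rightarrow> bool" where
  "Gm_regular r \<phi> \<longleftrightarrow> (\<exists>p N. \<forall>s\<in>Gm r. \<phi> s = eval s p / (\<Prod>i<r. s i) ^ N)"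

text \<open>A torus is a closed subgroup isomorphic, as an algebraic group, to some $(k^*)^r$. The regular
  functions on a closed subset of $\mathrm{SL}_{n+1}$ are the polynomials in the matrix entries.\<close>

definition torus :: "('k::field ^ 'n ^ 'n) set \<Rightarrow> bool" where
  "torus R \<longleftrightarrow> SL_closed R \<and>
     (\<exists>r \<phi>. bij_betw \<phi> (Gm r) R \<and>
        (\<forall>s\<in>Gm r. \<forall>s'\<in>Gm r. \<phi> (\<lambda>i. s i * s' i) = \<phi> s ** \<phi> s') \<and>
        (\<forall>a c. Gm_regular r (\<lambda>s. \<phi> s $ a $ c)) \<and>
        (\<forall>i<r. \<exists>q. \<forall>s\<in>Gm r. s i = eval (coords (\<phi> s)) q))"

definition maximal_torus :: "('k::field ^ 'n ^ 'n) set \<Rightarrow> bool" where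
  "maximal_torus R \<longleftrightarrow> torus R \<and> (\<forall>T. torus T \<and> R \<subseteq> T \<longrightarrow> T = R)"

text \<open>The character group $X(R)$, under pointwise multiplication. Characters are extended by 0 outside
  \<open>R\<close>, so that distinct elements are distinct characters.\<close>

definition characters :: "('k::field ^ 'n ^ 'n) set \<Rightarrow> ('k ^ 'n ^ 'n \<Rightarrow> 'k) set" where
  "characters R = {\<xi>.
     (\<exists>p. \<forall>g\<in>R. \<xi> g = eval (coords g) p) \<and>
     (\<forall>g\<in>R. \<xi> g \<noteq> 0) \<and>
     (\<forall>g\<in>R. \<forall>h\<in>R. \<xi> (g ** h) = \<xi> g * \<xi> h) \<and>
     (\<forall>g. g \<notin> R \<longrightarrow> \<xi> g = 0)}"

definition Z_independent ::
  "('k::field ^ 'n ^ 'n) set \<Rightarrow> ('k ^ 'n ^ 'n \<Rightarrow> 'k) set \<Rightarrow> bool" where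
  "Z_independent R B \<longleftrightarrow> finite B \<and>
     (\<forall>a. (\<forall>g\<in>R. (\<Prod>\<xi>\<in>B. \<xi> g powi a \<xi>) = 1) \<longrightarrow> (\<forall>\<xi>\<in>B. a \<xi> = 0))"

text \<open>A realisation of $X(R)_{\mathbb R} = X(R) \otimes_{\mathbb Z} \mathbb R$ inside a Euclidean
  space: \<open>\<iota>\<close> is a group homomorphism from $X(R)$ whose linear extension to
  $X(R) \otimes \mathbb R$ is injective, which holds iff \<open>\<iota>\<close> carries $\mathbb Z$-independent
  families to $\mathbb R$-independent ones. The space $X(R)_{\mathbb R}$ is then the span of the
  image.\<close>

definition real_characters ::
  "('k::field ^ 'n ^ 'n) set \<Rightarrow> (('k ^ 'n ^ 'n \<Rightarrow> 'k) \<Rightarrow> 'v::euclidean_space) \<Rightarrow> bool" where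
  "real_characters R \<iota> \<longleftrightarrow>
     (\<forall>\<xi>\<in>characters R. \<forall>\<psi>\<in>characters R. \<iota> (\<lambda>g. \<xi> g * \<psi> g) = \<iota> \<xi> + \<iota> \<psi>) \<and>
     (\<forall>B \<subseteq> characters R. Z_independent R B \<longrightarrow> inj_on \<iota> B \<and> independent (\<iota> ` B))"


section \<open>Generic state polytopes\<close>

definition weight_space ::
  "('k::field ^ 'n ^ 'n) set \<Rightarrow> nat \<Rightarrow> nat \<Rightarrow> ('k ^ 'n ^ 'n \<Rightarrow> 'k) \<Rightarrow> ('n, 'k) tens set" where
  "weight_space R l m \<xi> =
     {u \<in> ext_power l (piece UNIV m). \<forall>g\<in>R. tens_act g u = pm_scale (\<xi> g) u}"

definition weight_decomposition ::
  "('k::field ^ 'n ^ 'n) set \<Rightarrow> nat \<Rightarrow> nat \<Rightarrow> ('n, 'k) tens \<Rightarrow>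
   (('k ^ 'n ^ 'n \<Rightarrow> 'k) \<Rightarrow> ('n, 'k) tens) \<Rightarrow> bool" where
  "weight_decomposition R l m u c \<longleftrightarrow>
     (\<forall>\<xi>\<in>characters R. c \<xi> \<in> weight_space R l m \<xi>) \<and>
     (\<forall>\<xi>. \<xi> \<notin> characters R \<longrightarrow> c \<xi> = 0) \<and>
     finite {\<xi>. c \<xi> \<noteq> 0} \<and> u = (\<Sum>\<xi> | c \<xi> \<noteq> 0. c \<xi>)"

definition state ::
  "('k::field ^ 'n ^ 'n) set \<Rightarrow> nat \<Rightarrow> nat \<Rightarrow> ('n, 'k) tens \<Rightarrow> ('k ^ 'n ^ 'n \<Rightarrow> 'k) set" where
  "state R l m u = {\<xi> \<in> characters R. (THE c. weight_decomposition R l m u c) \<xi> \<noteq> 0}"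

text \<open>The common value of $\Xi_{g.v}(R)$ for \<open>g\<close> in a nonempty Zariski open subset of the group; it is
  unique because $\mathrm{SL}_{n+1}$ is irreducible.\<close>

definition generic_state ::
  "('k::field ^ 'n ^ 'n) set \<Rightarrow> nat \<Rightarrow> nat \<Rightarrow> ('n, 'k) tens \<Rightarrow> ('k ^ 'n ^ 'n \<Rightarrow> 'k) set" where
  "generic_state R l m v =
     (THE \<Xi>. \<exists>U. SL_open U \<and> U \<noteq> {} \<and> (\<forall>g\<in>U. state R l m (tens_act g v) = \<Xi>))"

definition generic_state_polytope ::
  "('k::field ^ 'n ^ 'n) set \<Rightarrow> (('k ^ 'n ^ 'n \<Rightarrow> 'k) \<Rightarrow> 'v::euclidean_space) \<Rightarrow>
   nat \<Rightarrow> nat \<Rightarrow> ('n, 'k) tens \<Rightarrow> 'v set" where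
  "generic_state_polytope R \<iota> l m v = convex hull (\<iota> ` generic_state R l m v)"

text \<open>The interior is taken in $X(R)_{\mathbb R}$, not in the ambient Euclidean space.\<close>

definition hilbert_point_generically_stable ::
  "('k::field ^ 'n ^ 'n) set \<Rightarrow> (('k ^ 'n ^ 'n \<Rightarrow> 'k) \<Rightarrow> 'v::euclidean_space) \<Rightarrow>
   ('n, 'k) pol set \<Rightarrow> nat \<Rightarrow> bool" where
  "hilbert_point_generically_stable R \<iota> I m \<longleftrightarrow>
     (\<forall>v. represents_hilbert_point I m v \<longrightarrow>
        0 \<in> top_of_set (span (\<iota> ` characters R)) interior_of
              generic_state_polytope R \<iota> (pm.dim (piece I m)) m v)"

end

theory Submission
  imports Defs
begin

text \<open>Let \<open>V\<close> be the piece of \<open>I\<close> of degree \<open>m\<close> and \<open>v\<close> the wedge of a basis of \<open>V\<close>. With a single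
  variable the character space is zero and the polytope is its only point, so let there be at least
  two variables. The bound on the regularity gives \<open>I\<close> a nonzero generator of degree at most \<open>m\<close>,
  whose multiples make \<open>V\<close> nonzero (\<open>piece_nonzero\<close>), and by hypothesis \<open>V\<close> is not the space of all forms of degree \<open>m\<close>. The generic
  state polytope is symmetric under the Weyl group, which fixes only the origin; stability therefore
  comes down to the irreducibility of the space of forms of degree \<open>m\<close> as a representation.

  A maximal torus is diagonal in a suitable basis (\<open>maximal_torus_eq_diag_torus\<close>): the entries of its
  parametrisation by \<open>Gm r\<close> are linear combinations of characters, and the independence of characters
  turns the coefficients into common eigenvectors. In that basis the words of monomials are weight
  vectors, and the characters of the torus are the monomials in the diagonal entries
  (\<open>characters_eq\<close>). Because the special linear group is irreducible (\<open>SL_irreducible\<close>), a word that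
  occurs in some translate of \<open>v\<close> occurs in all translates by elements of a nonempty open set; the
  generic state consists of the weights of these words (\<open>generic_state_wedge\<close>).

  Signed transposition matrices permute the words, so the set \<open>A\<close> of exponent vectors of their weights
  is stable under all permutations of the coordinates. The sum of \<open>A\<close> is then a multiple of the sum of
  the coordinate characters, which is zero. So the origin is the barycentre of the weights, lies in
  the relative interior of their hull, and is an interior point as soon as \<open>A\<close> contains a vector that
  is not constant (\<open>zero_in_interior_symmetric_hull\<close>).

  Suppose that all vectors in \<open>A\<close> are constant. Having the same degree, they are equal, so every
  translate of \<open>v\<close> has a single weight, and this forces every translate of \<open>V\<close> to be spanned by
  monomials (\<open>monomial_span_if_single_weight\<close>). Comparing \<open>V\<close> with its translate under the
  substitution of \<open>x\<^sub>i + x\<^sub>j\<close> for \<open>x\<^sub>i\<close> shows that \<open>V\<close> contains, with a monomial, every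
  other monomial of degree \<open>m\<close> (\<open>all_forms_if_single_weight\<close>), contrary to the assumptions on \<open>V\<close>.\<close>

abbreviation "lookup \<equiv> Poly_Mapping.lookup"
abbreviation "single \<equiv> Poly_Mapping.single"
abbreviation "keys \<equiv> Poly_Mapping.keys"

section \<open>Evaluation of polynomials\<close>

definition monomial_value :: "('i \<Rightarrow> 'r) \<Rightarrow> 'i mon \<Rightarrow> 'r::comm_semiring_1" where
  "monomial_value y t = (\<Prod>i\<in>keys t. y i ^ lookup t i)"

lemma monomial_value_superset:
  assumes "finite A" "keys t \<subseteq> A"
  shows "monomial_value y t = (\<Prod>i\<in>A. y i ^ lookup t i)"
  unfolding monomial_value_def using assms
  by (intro prod.mono_neutral_left) (auto simp: in_keys_iff)

lemma monomial_value_0 [simp]: "monomial_value y 0 = 1"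
  by (simp add: monomial_value_def)

lemma monomial_value_single [simp]: "monomial_value y (single i k) = y i ^ k"
  by (simp add: monomial_value_def)

lemma monomial_value_add: "monomial_value y (s + t) = monomial_value y s * monomial_value y t"
proof -
  have "keys (s + t) \<subseteq> keys s \<union> keys t"
    by (rule Poly_Mapping.keys_add)
  then show ?thesis
    by (subst (1 2 3) monomial_value_superset[of "keys s \<union> keys t"])
       (auto simp: lookup_add power_add prod.distrib)
qed

lemma monomial_value_times: "monomial_value (\<lambda>i. y i * z i) t = monomial_value y t * monomial_value z t"
  by (simp add: monomial_value_def power_mult_distrib prod.distrib)

lemma monomial_value_one [simp]: "monomial_value (\<lambda>i. 1) t = 1"
  by (simp add: monomial_value_def)

lemma monomial_value_nonzero:
  fixes y :: "'i \<Rightarrow> 'k::idom"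
  shows "(\<And>i. y i \<noteq> 0) \<Longrightarrow> monomial_value y t \<noteq> 0"
  by (simp add: monomial_value_def)

lemma monomial_value_sum_list: "monomial_value y (sum_list w) = prod_list (map (monomial_value y) w)"
  by (induction w) (auto simp: monomial_value_add)

lemma poly_mapping_sum_single:
  fixes p :: "'a \<Rightarrow>\<^sub>0 'b::comm_monoid_add"
  assumes "finite A" "keys p \<subseteq> A"
  shows "(\<Sum>t\<in>A. single t (lookup p t)) = p"
proof (rule poly_mapping_eqI)
  fix k
  have "lookup (\<Sum>t\<in>A. single t (lookup p t)) k = (\<Sum>t\<in>A. if t = k then lookup p t else 0)"
    unfolding lookup_sum by (intro sum.cong) (auto simp: lookup_single when_def)
  also have "\<dots> = lookup p k"
    using assms by (auto simp: in_keys_iff)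
  finally show "lookup (\<Sum>t\<in>A. single t (lookup p t)) k = lookup p k" .
qed

text \<open>Evaluation at a point and linear substitution are both insertions along a homomorphism of the
  coefficients: the identity and the embedding of the constants.\<close>

locale coefficient_hom =
  fixes h :: "'k::comm_semiring_1 \<Rightarrow> 'r::comm_semiring_1"
  assumes h_zero: "h 0 = 0" and h_one: "h 1 = 1"
    and h_add: "h (a + b) = h a + h b" and h_mult: "h (a * b) = h a * h b"
begin

lemma insertion_superset:
  assumes "finite A" "keys p \<subseteq> A"
  shows "insertion h y p = (\<Sum>t\<in>A. h (lookup p t) * monomial_value y t)"
  unfolding insertion_def monomial_value_def[symmetric] using assms
  by (intro sum.mono_neutral_left) (auto simp: in_keys_iff h_zero)

lemma insertion_single [simp]: "insertion h y (single t c) = h c * monomial_value y t"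
  by (subst insertion_superset[of "{t}"]) (auto simp: h_zero)

lemma insertion_0 [simp]: "insertion h y 0 = 0"
  by (simp add: insertion_def)

lemma insertion_add: "insertion h y (p + q) = insertion h y p + insertion h y q"
proof -
  have "keys (p + q) \<subseteq> keys p \<union> keys q"
    by (rule Poly_Mapping.keys_add)
  then show ?thesis
    by (subst (1 2 3) insertion_superset[of "keys p \<union> keys q"])
       (auto simp: lookup_add h_add algebra_simps sum.distrib)
qed

lemma insertion_sum: "insertion h y (sum P A) = (\<Sum>a\<in>A. insertion h y (P a))"
  by (induction A rule: infinite_finite_induct) (auto simp: insertion_add)

lemma insertion_mult: "insertion h y (p * q) = insertion h y p * insertion h y q"
proof -
  have "p * q = (\<Sum>s\<in>keys p. single s (lookup p s)) * (\<Sum>t\<in>keys q. single t (lookup q t))"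
    by (simp add: poly_mapping_sum_single)
  also have "\<dots> = (\<Sum>s\<in>keys p. \<Sum>t\<in>keys q. single (s + t) (lookup p s * lookup q t))"
    by (simp add: sum_product mult_single)
  finally have "insertion h y (p * q) =
      (\<Sum>s\<in>keys p. \<Sum>t\<in>keys q. (h (lookup p s) * monomial_value y s) * (h (lookup q t) * monomial_value y t))"
    by (simp add: insertion_sum h_mult monomial_value_add mult.assoc mult.left_commute)
  also have "\<dots> = insertion h y p * insertion h y q"
    by (simp add: insertion_superset[of "keys p"] insertion_superset[of "keys q"] sum_product)
  finally show ?thesis .
qed

lemma insertion_1 [simp]: "insertion h y 1 = 1"
  using insertion_single[of y 0 1] by (simp add: h_one)

lemma insertion_prod: "insertion h y (prod P A) = (\<Prod>a\<in>A. insertion h y (P a))"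
  by (induction A rule: infinite_finite_induct) (auto simp: insertion_mult)

lemma insertion_power: "insertion h y (p ^ n) = insertion h y p ^ n"
  by (induction n) (auto simp: insertion_mult)

lemma insertion_monomial_value: "insertion h y (monomial_value P t) = monomial_value (\<lambda>i. insertion h y (P i)) t"
  by (simp add: monomial_value_def insertion_prod insertion_power)

end

interpretation eval: coefficient_hom "\<lambda>c::'k::comm_semiring_1. c"
  by unfold_locales (rule refl)+

interpretation const: coefficient_hom
  "const :: 'k::comm_semiring_1 \<Rightarrow> ('i, 'k) pol"
  by unfold_locales (simp_all add: const_def single_add mult_single)

(* Not the corresponding rules for the identity, which read 0 = 0 and 1 = 1 and loop. *)
declare const.h_zero [simp] const.h_one [simp]

lemma const_mult_eq_scale: "const c * p = pm_scale c p"
  unfolding const_def pm_scale_def by (rule mult_map_scale_conv_mult[symmetric])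


section \<open>Functions given by polynomials\<close>

text \<open>The map \<open>C\<close> gives the coordinates of a point; it is \<open>coords\<close> for matrices and the identity for
  points of \<open>Gm r\<close> and for vectors of diagonal entries.\<close>

definition polynomial_in :: "('x \<Rightarrow> 'i \<Rightarrow> 'k) \<Rightarrow> ('x \<Rightarrow> 'k::comm_semiring_1) \<Rightarrow> bool" where
  "polynomial_in C f \<longleftrightarrow> (\<exists>p. \<forall>x. f x = eval (C x) p)"

lemma polynomial_in_coordinate: "polynomial_in C (\<lambda>x. C x i)"
  unfolding polynomial_in_def
  by (rule exI[of _ "single (single i 1) 1"]) simp

lemma polynomial_in_const: "polynomial_in C (\<lambda>x. c)"
  unfolding polynomial_in_def by (rule exI[of _ "single 0 c"]) simp

lemma polynomial_in_add:
  "polynomial_in C f \<Longrightarrow> polynomial_in C g \<Longrightarrow> polynomial_in C (\<lambda>x. f x + g x)"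
  unfolding polynomial_in_def by (metis eval.insertion_add)

lemma polynomial_in_mult:
  "polynomial_in C f \<Longrightarrow> polynomial_in C g \<Longrightarrow> polynomial_in C (\<lambda>x. f x * g x)"
  unfolding polynomial_in_def by (metis eval.insertion_mult)

lemma polynomial_in_sum:
  "(\<And>a. a \<in> A \<Longrightarrow> polynomial_in C (f a)) \<Longrightarrow> polynomial_in C (\<lambda>x. \<Sum>a\<in>A. f a x)"
  by (induction A rule: infinite_finite_induct)
     (auto intro: polynomial_in_const polynomial_in_add)

lemma polynomial_in_prod:
  "(\<And>a. a \<in> A \<Longrightarrow> polynomial_in C (f a)) \<Longrightarrow> polynomial_in C (\<lambda>x. \<Prod>a\<in>A. f a x)"
  by (induction A rule: infinite_finite_induct)
     (auto intro: polynomial_in_const polynomial_in_mult)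

lemma polynomial_in_power: "polynomial_in C f \<Longrightarrow> polynomial_in C (\<lambda>x. f x ^ n)"
  by (induction n) (auto intro: polynomial_in_const polynomial_in_mult)

lemma polynomial_in_monomial_value:
  "(\<And>i. polynomial_in C (f i)) \<Longrightarrow> polynomial_in C (\<lambda>x. monomial_value (\<lambda>i. f i x) t)"
  unfolding monomial_value_def by (intro polynomial_in_prod polynomial_in_power)

lemma polynomial_in_entry: "polynomial_in coords (\<lambda>g. g $ i $ j)"
  using polynomial_in_coordinate[of coords "(i, j)"] by simp

lemma polynomial_in_matrix_mult:
  assumes "\<And>a c. polynomial_in C (\<lambda>x. F x $ a $ c)" "\<And>a c. polynomial_in C (\<lambda>x. G x $ a $ c)"
  shows "polynomial_in C (\<lambda>x. (F x ** G x) $ a $ c)"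
  unfolding matrix_matrix_mult_def using assms
  by (auto intro!: polynomial_in_sum polynomial_in_mult)


section \<open>Linear substitutions\<close>

lemma subst_act_add: "subst_act g (p + q) = subst_act g p + subst_act g q"
  and subst_act_mult: "subst_act g (p * q) = subst_act g p * subst_act g q"
  and subst_act_sum: "subst_act g (sum P A) = (\<Sum>a\<in>A. subst_act g (P a))"
  by (simp_all add: subst_act_def const.insertion_add const.insertion_mult const.insertion_sum)

lemma subst_act_single:
  "subst_act g (single t c) = const c * monomial_value (\<lambda>i. \<Sum>j\<in>UNIV. const (g $ j $ i) * var j) t"
  by (simp add: subst_act_def)

lemma subst_act_const [simp]: "subst_act g (const c) = const c"
  by (simp add: const_def subst_act_single)

lemma subst_act_var: "subst_act g (var i) = (\<Sum>j\<in>UNIV. const (g $ j $ i) * var j)"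
  by (simp add: var_def subst_act_single)

lemma subst_act_scale: "subst_act g (pm_scale c p) = pm_scale c (subst_act g p)"
  by (simp add: const_mult_eq_scale[symmetric] subst_act_mult)

lemma subst_act_expand: "subst_act g p = (\<Sum>t\<in>keys p. subst_act g (single t (lookup p t)))"
  using subst_act_sum[of g "\<lambda>t. single t (lookup p t)" "keys p"]
  by (simp add: poly_mapping_sum_single)

text \<open>Both sides are ring homomorphisms that fix the constants, and on a variable they agree by the
  definition of the matrix product.\<close>

lemma subst_act_compose:
  fixes p :: "('n::finite, 'k::comm_ring_1) pol"
  shows "subst_act g (subst_act h p) = subst_act (g ** h) p"
proof -
  have var: "subst_act g (subst_act h (var i)) = subst_act (g ** h) (var i)" for i
  proof -
    have "subst_act g (subst_act h (var i)) =
        (\<Sum>j\<in>UNIV. \<Sum>l\<in>UNIV. const (h $ j $ i) * (const (g $ l $ j) * var l))"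
      by (simp add: subst_act_var subst_act_sum subst_act_mult sum_distrib_left)
    also have "\<dots> = (\<Sum>l\<in>UNIV. \<Sum>j\<in>UNIV. const (g $ l $ j * h $ j $ i) * var l)"
      by (subst sum.swap) (simp add: const.h_mult mult_ac)
    also have "\<dots> = subst_act (g ** h) (var i)"
    proof -
      have c: "const (sum f A) = (\<Sum>a\<in>A. const (f a))" for f :: "'n \<Rightarrow> 'k" and A
        by (induction A rule: infinite_finite_induct) (auto simp: const.h_add)
      show ?thesis
        by (simp add: subst_act_var matrix_matrix_mult_def c sum_distrib_right)
    qed
    finally show ?thesis .
  qed
  have "subst_act g (subst_act h (single t c)) = subst_act (g ** h) (single t c)" for t c
  proof -
    have *: "subst_act k (single t c) = const c * monomial_value (\<lambda>i. subst_act k (var i)) t"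
      for k :: "'k ^ 'n ^ 'n"
      by (simp add: subst_act_single subst_act_var)
    have "subst_act g (subst_act h (single t c)) =
        const c * monomial_value (\<lambda>i. subst_act g (subst_act h (var i))) t"
      by (simp add: * subst_act_mult) (simp add: subst_act_def const.insertion_monomial_value)
    then show ?thesis
      by (simp add: * var)
  qed
  then show ?thesis
    by (simp only: subst_act_expand[of h p] subst_act_expand[of "g ** h" p] subst_act_sum)
qed

lemma monomial_value_var: "monomial_value var t = single t (1::'k::comm_semiring_1)"
proof -
  have "monomial_value var t = (\<Prod>i\<in>keys t. single (single i (lookup t i)) (1::'k))"
  proof -
    have "var i ^ n = single (single i n) (1::'k)" for i :: 'a and n
      by (induction n) (auto simp: var_def mult_single single_add[symmetric])
    then show ?thesis by (simp add: monomial_value_def)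
  qed
  also have "\<dots> = single (\<Sum>i\<in>keys t. single i (lookup t i)) 1"
    by (induction rule: finite_induct[OF finite_keys[of t]]) (auto simp: mult_single)
  finally show ?thesis
    using poly_mapping_sum_single[of "keys t" t] by simp
qed

lemma subst_act_mat_1 [simp]: "subst_act (mat 1) p = p"
proof -
  have v: "(\<Sum>j\<in>UNIV. const ((mat 1 :: 'b^'a^'a) $ j $ i) * var j) = var i" for i
  proof -
    have "(\<Sum>j\<in>UNIV. const ((mat 1 :: 'b^'a^'a) $ j $ i) * var j) =
        (\<Sum>j\<in>UNIV. if j = i then var i else 0)"
      by (intro sum.cong) (auto simp: mat_def)
    then show ?thesis by simp
  qed
  have "subst_act (mat 1) (single t c) = single t (c::'b)" for t :: "'a mon" and c
    by (simp only: subst_act_single v monomial_value_var) (simp add: const_def mult_single)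
  then show ?thesis
    by (simp add: subst_act_expand[of _ p] poly_mapping_sum_single)
qed

lemma pm_scale_single [simp]: "pm_scale c (single t d) = single t (c * d)"
  by (rule poly_mapping_eqI) (simp add: lookup_single when_def)

lemma monomial_value_UNIV: "monomial_value y t = (\<Prod>i\<in>UNIV. y i ^ lookup t i)"
  for y :: "'n::finite \<Rightarrow> 'r::comm_semiring_1"
  by (rule monomial_value_superset) auto

text \<open>These matrices scale and permute the variables. The instances used are the diagonal matrices and
  the signed transpositions, which represent generators of the Weyl group; in both \<open>\<pi>\<close> is an involution.\<close>

definition monomial_matrix :: "('n \<Rightarrow> 'n) \<Rightarrow> ('n \<Rightarrow> 'k) \<Rightarrow> 'k::zero ^ 'n ^ 'n" where
  "monomial_matrix \<pi> c = (\<chi> j i. if j = \<pi> i then c i else 0)"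

lemma subst_act_monomial_matrix:
  fixes c :: "'n::finite \<Rightarrow> 'k::comm_ring_1"
  assumes inv: "\<And>i. \<pi> (\<pi> i) = i"
  shows "subst_act (monomial_matrix \<pi> c) (single t 1) =
    single (Poly_Mapping.map_key \<pi> t) (monomial_value c t)"
proof -
  have inj: "inj \<pi>" by (metis inv injI)
  have v: "(\<Sum>j\<in>UNIV. const (monomial_matrix \<pi> c $ j $ i) * var j) = const (c i) * var (\<pi> i)" for i
  proof -
    have "(\<Sum>j\<in>UNIV. const (monomial_matrix \<pi> c $ j $ i) * var j) =
        (\<Sum>j\<in>UNIV. if j = \<pi> i then const (c i) * var (\<pi> i) else (0 :: ('n, 'k) pol))"
      by (intro sum.cong) (auto simp: monomial_matrix_def)
    then show ?thesis by simp
  qed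
  have "monomial_value (\<lambda>i. var (\<pi> i)) t = (\<Prod>i\<in>UNIV. var i ^ lookup t (\<pi> i) :: ('n, 'k) pol)"
    unfolding monomial_value_UNIV
    by (rule prod.reindex_bij_witness[where i = \<pi> and j = \<pi>]) (auto simp: inv)
  also have "\<dots> = monomial_value var (Poly_Mapping.map_key \<pi> t)"
    by (simp add: monomial_value_UNIV map_key.rep_eq inj)
  finally have r: "monomial_value (\<lambda>i. var (\<pi> i)) t = single (Poly_Mapping.map_key \<pi> t) (1 :: 'k)"
    by (simp add: monomial_value_var)
  have "monomial_value (\<lambda>i. const (c i)) t = (const (monomial_value c t) :: ('n, 'k) pol)"
  proof -
    have pw: "(const a :: ('n, 'k) pol) ^ n = const (a ^ n)" for a n
      by (induction n) (auto simp: const.h_mult)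
    have pr: "(\<Prod>i\<in>A. const (f i) :: ('n, 'k) pol) = const (prod f A)" for f and A :: "'n set"
      by (induction A rule: infinite_finite_induct) (auto simp: const.h_mult)
    show ?thesis by (simp add: monomial_value_def pw pr)
  qed
  then show ?thesis
    by (simp add: subst_act_single v monomial_value_times r) (simp add: const_def mult_single)
qed


section \<open>Degrees\<close>

lemma mdeg_UNIV: "mdeg t = (\<Sum>i\<in>UNIV. lookup t i)" for t :: "'n::finite mon"
  unfolding mdeg_def by (rule sum.mono_neutral_left) (auto simp: in_keys_iff)

lemma mdeg_0 [simp]: "mdeg 0 = 0"
  by (simp add: mdeg_def)

lemma mdeg_single [simp]: "mdeg (single i k) = k"
  by (simp add: mdeg_def)

lemma mdeg_add: "mdeg (s + t) = mdeg s + mdeg t" for t :: "'n::finite mon"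
  by (simp add: mdeg_UNIV lookup_add sum.distrib)

lemma mdeg_sum_list: "mdeg (sum_list w) = sum_list (map mdeg w)" for w :: "'n::finite mon list"
  by (induction w) (auto simp: mdeg_add)

lemma finite_monomials_of_degree: "finite {t :: 'n::finite mon. mdeg t = m}"
proof (rule finite_imageD)
  have "lookup ` {t :: 'n mon. mdeg t = m} \<subseteq> (UNIV \<rightarrow>\<^sub>E {..m})"
    by (auto simp: mdeg_UNIV intro: member_le_sum)
  then show "finite (lookup ` {t :: 'n mon. mdeg t = m})"
    by (rule finite_subset) (auto intro: finite_PiE)
qed (auto simp: inj_on_def intro: poly_mapping_eqI)

lemma homog_single [simp]: "single t c \<in> homog e \<longleftrightarrow> c = 0 \<or> int (mdeg t) = e"
  by (auto simp: homog_def)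

lemma homog_0 [simp]: "0 \<in> homog e"
  by (simp add: homog_def)

lemma homog_add: "p \<in> homog e \<Longrightarrow> q \<in> homog e \<Longrightarrow> p + q \<in> homog e"
  using Poly_Mapping.keys_add[of p q] by (auto simp: homog_def)

lemma homog_sum: "(\<And>a. a \<in> A \<Longrightarrow> P a \<in> homog e) \<Longrightarrow> sum P A \<in> homog e"
  by (induction A rule: infinite_finite_induct) (auto intro: homog_add)

lemma homog_mult:
  fixes p q :: "('n::finite, 'k::comm_semiring_1) pol"
  assumes "p \<in> homog d" "q \<in> homog e"
  shows "p * q \<in> homog (d + e)"
  using keys_mult[of p q] assms by (fastforce simp: homog_def mdeg_add)

lemma homog_monomial_value:
  fixes P :: "'i \<Rightarrow> ('n::finite, 'k::comm_semiring_1) pol"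
  assumes "\<And>i. P i \<in> homog 1"
  shows "monomial_value P t \<in> homog (int (mdeg t))"
proof -
  have one: "1 \<in> homog 0" by (simp add: single_one[symmetric] del: single_one)
  have pw: "P i ^ n \<in> homog (int n)" for i n
    by (induction n) (use one homog_mult[OF assms] in auto)
  have "finite A \<Longrightarrow> (\<Prod>i\<in>A. P i ^ f i) \<in> homog (int (\<Sum>i\<in>A. f i))" for A f
    by (induction A rule: finite_induct) (use one homog_mult[OF pw] in auto)
  then show ?thesis by (simp add: monomial_value_def mdeg_def)
qed

lemma homog_scale: "p \<in> homog e \<Longrightarrow> pm_scale c p \<in> homog e"
  by (auto simp: homog_def in_keys_iff)

lemma homog_subst_act:
  fixes p :: "('n::finite, 'k::comm_ring_1) pol"
  assumes "p \<in> homog e"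
  shows "subst_act g p \<in> homog e"
proof -
  have "subst_act g (single t c) \<in> homog (int (mdeg t))" for t c
    unfolding subst_act_single const_mult_eq_scale
    by (intro homog_scale homog_monomial_value homog_sum) (auto simp: var_def const_def mult_single)
  moreover have "int (mdeg t) = e" if "t \<in> keys p" for t
    using assms that by (auto simp: homog_def)
  ultimately have "(\<Sum>t\<in>keys p. subst_act g (single t (lookup p t))) \<in> homog e"
    by (intro homog_sum) metis
  then show ?thesis
    by (simp only: subst_act_expand[symmetric])
qed

lemma linear_subst_act: "Vector_Spaces.linear pm_scale pm_scale (subst_act g)"
  by unfold_locales (auto simp: subst_act_add subst_act_scale)


section \<open>Tensors\<close>

lemma finite_listset: "(\<And>A. A \<in> set As \<Longrightarrow> finite A) \<Longrightarrow> finite (listset As)"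
  by (induction As) (auto simp: set_Cons_def intro!: finite_image_set2)

lemma in_listset: "w \<in> listset As \<longleftrightarrow> length w = length As \<and> (\<forall>i<length As. w ! i \<in> As ! i)"
proof (induction As arbitrary: w)
  case (Cons A As)
  then show ?case
    by (cases w) (auto simp: set_Cons_def nth_Cons split: nat.splits)
qed auto

text \<open>The distributive law over words, which is behind the multilinearity of \<open>tensor\<close>.\<close>

lemma sum_listset:
  fixes F :: "nat \<Rightarrow> 'a \<Rightarrow> 'b::comm_semiring_1"
  assumes "\<And>A. A \<in> set As \<Longrightarrow> finite A"
  shows "(\<Sum>w\<in>listset As. \<Prod>i<length As. F i (w ! i)) = (\<Prod>i<length As. \<Sum>t\<in>As ! i. F i t)"
  using assms
proof (induction As arbitrary: F)
  case (Cons A As)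
  have inj: "inj_on (\<lambda>(a, w). a # w) (A \<times> listset As)"
    by (auto simp: inj_on_def)
  have im: "listset (A # As) = (\<lambda>(a, w). a # w) ` (A \<times> listset As)"
    by (auto simp: set_Cons_def)
  have "(\<Sum>w\<in>listset (A # As). \<Prod>i<length (A # As). F i (w ! i)) =
      (\<Sum>(a, w)\<in>A \<times> listset As. F 0 a * (\<Prod>i<length As. F (Suc i) (w ! i)))"
    unfolding im by (subst sum.reindex[OF inj])
      (auto intro!: sum.cong simp: prod.lessThan_Suc_shift simp del: prod.lessThan_Suc)
  also have "\<dots> = (\<Sum>a\<in>A. F 0 a) * (\<Sum>w\<in>listset As. \<Prod>i<length As. F (Suc i) (w ! i))"
    by (simp add: sum.cartesian_product[symmetric] sum_product)
  also have "\<dots> = (\<Prod>i<length (A # As). \<Sum>t\<in>(A # As) ! i. F i t)"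
    by (subst Cons.IH) (use Cons.prems in \<open>auto simp: prod.lessThan_Suc_shift simp del: prod.lessThan_Suc\<close>)
  finally show ?case .
qed auto

lemma lookup_tensor:
  "lookup (tensor fs) w =
    (if length w = length fs then \<Prod>i<length fs. lookup (fs ! i) (w ! i) else 0)"
proof -
  let ?L = "listset (map keys fs)" and ?c = "\<lambda>w. \<Prod>i<length fs. lookup (fs ! i) (w ! i)"
  have fin: "finite ?L" by (rule finite_listset) auto
  have "lookup (tensor fs) w = (\<Sum>v\<in>?L. if v = w then ?c w else 0)"
    unfolding tensor_def lookup_sum by (intro sum.cong) (auto simp: lookup_single when_def)
  also have "\<dots> = (if w \<in> ?L then ?c w else 0)"
    using fin by auto
  also have "\<dots> = (if length w = length fs then ?c w else 0)"
    by (auto simp: in_listset in_keys_iff intro!: prod_zero)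
  finally show ?thesis .
qed

lemma tens_act_superset:
  assumes "finite A" "keys u \<subseteq> A"
  shows "tens_act g u = (\<Sum>w\<in>A. pm_scale (lookup u w)
    (tensor (map (\<lambda>t. subst_act g (single t 1)) w)))"
  unfolding tens_act_def
proof (intro sum.mono_neutral_left ballI)
  show "pm_scale (lookup u w) (tensor (map (\<lambda>t. subst_act g (single t 1)) w)) = 0"
    if "w \<in> A - keys u" for w
    using that by (intro poly_mapping_eqI) (auto simp: in_keys_iff)
qed (use assms in auto)

lemma linear_tens_act:
  "Vector_Spaces.linear pm_scale pm_scale (tens_act g :: ('n::finite, 'k::field) tens \<Rightarrow> _)"
proof unfold_locales
  fix u v :: "('n, 'k) tens" and c :: 'k
  have "keys (u + v) \<subseteq> keys u \<union> keys v" by (rule Poly_Mapping.keys_add)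
  then show "tens_act g (u + v) = tens_act g u + tens_act g v"
    by (subst (1 2 3) tens_act_superset[of "keys u \<union> keys v"])
       (auto simp: lookup_add pm.scale_left_distrib sum.distrib)
  have "keys (pm_scale c u) \<subseteq> keys u" by (auto simp: in_keys_iff)
  then show "tens_act g (pm_scale c u) = pm_scale c (tens_act g u)"
    by (subst (1 2) tens_act_superset[of "keys u"]) (auto simp: pm.scale_sum_right)
qed

lemma tens_act_single:
  "tens_act g (single w c) = pm_scale c (tensor (map (\<lambda>t. subst_act g (single t 1)) w))"
  by (subst tens_act_superset[of "{w}"]) auto

lemma tens_act_tensor:
  fixes fs :: "('n::finite, 'k::field) pol list"
  shows "tens_act g (tensor fs) = tensor (map (subst_act g) fs)"
proof (rule poly_mapping_eqI)
  fix v
  interpret Vector_Spaces.linear pm_scale pm_scale "tens_act g :: ('n::finite, 'k::field) tens \<Rightarrow> _"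
    by (rule linear_tens_act)
  let ?L = "listset (map keys fs)"
  have "lookup (tens_act g (tensor fs)) v = (\<Sum>w\<in>?L. (\<Prod>i<length fs. lookup (fs ! i) (w ! i)) *
      lookup (tensor (map (\<lambda>t. subst_act g (single t 1)) w)) v)"
    unfolding tensor_def[of fs] by (simp add: sum tens_act_single lookup_sum)
  also have "\<dots> = lookup (tensor (map (subst_act g) fs)) v"
  proof (cases "length v = length fs")
    case False
    then show ?thesis by (auto simp: lookup_tensor in_listset intro!: sum.neutral)
  next
    case True
    have "(\<Sum>w\<in>?L. (\<Prod>i<length fs. lookup (fs ! i) (w ! i)) *
        lookup (tensor (map (\<lambda>t. subst_act g (single t 1)) w)) v) =
      (\<Sum>w\<in>?L. \<Prod>i<length (map keys fs).
        lookup (fs ! i) (w ! i) * lookup (subst_act g (single (w ! i) 1)) (v ! i))"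
      by (intro sum.cong) (auto simp: lookup_tensor in_listset True prod.distrib)
    also have "\<dots> = (\<Prod>i<length fs. \<Sum>t\<in>keys (fs ! i).
        lookup (fs ! i) t * lookup (subst_act g (single t 1)) (v ! i))"
      by (subst sum_listset[of _ "\<lambda>i t. lookup (fs ! i) t * lookup (subst_act g (single t 1)) (v ! i)"]) auto
    also have "\<dots> = (\<Prod>i<length fs. lookup (subst_act g (fs ! i)) (v ! i))"
    proof (rule prod.cong[OF refl])
      fix i
      let ?f = "fs ! i"
      have "subst_act g ?f = (\<Sum>t\<in>keys ?f. pm_scale (lookup ?f t) (subst_act g (single t 1)))"
      proof -
        show ?thesis
          by (subst subst_act_expand) (simp add: subst_act_scale[symmetric])
      qed
      then show "(\<Sum>t\<in>keys ?f. lookup ?f t * lookup (subst_act g (single t 1)) (v ! i)) =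
          lookup (subst_act g ?f) (v ! i)"
        by (simp add: lookup_sum)
    qed
    finally show ?thesis by (simp add: lookup_tensor True)
  qed
  finally show "lookup (tens_act g (tensor fs)) v = lookup (tensor (map (subst_act g) fs)) v" .
qed

lemma tensor_basis: "tensor (map (\<lambda>t. single t 1) w) = single w (1::'k::comm_ring_1)"
proof (rule poly_mapping_eqI)
  fix v
  have "(\<Prod>i<length w. lookup (single (w ! i) 1) (v ! i)) = (if v = w then 1 else (0::'k))"
    if len: "length v = length w"
  proof (cases "v = w")
    case False
    then obtain i where "i < length w" "w ! i \<noteq> v ! i"
      using len nth_equalityI by metis
    then show ?thesis using False
      by (auto simp: lookup_single when_def intro!: prod_zero)
  qed simp
  then show "lookup (tensor (map (\<lambda>t. single t 1) w)) v = lookup (single w (1::'k)) v"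
    by (auto simp: lookup_tensor lookup_single when_def)
qed

lemma pm_sum_basis: "(\<Sum>w\<in>keys u. pm_scale (lookup u w) (single w 1)) = u"
  for u :: "'b \<Rightarrow>\<^sub>0 'k::comm_semiring_1"
  by (simp add: poly_mapping_sum_single)

lemma tens_act_compose:
  fixes u :: "('n::finite, 'k::field) tens"
  shows "tens_act g (tens_act h u) = tens_act (g ** h) u"
proof -
  interpret g: Vector_Spaces.linear pm_scale pm_scale "tens_act g :: ('n::finite, 'k::field) tens \<Rightarrow> _"
    by (rule linear_tens_act)
  have "tens_act g (tens_act h u) = (\<Sum>w\<in>keys u. pm_scale (lookup u w)
      (tens_act g (tensor (map (\<lambda>t. subst_act h (single t 1)) w))))"
    unfolding tens_act_def[of h] by (simp add: g.sum g.scale)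
  then show ?thesis
    by (simp add: tens_act_tensor o_def subst_act_compose tens_act_def[of "g ** h"])
qed

lemma tens_act_mat_1 [simp]: "tens_act (mat 1) u = u" for u :: "('n::finite, 'k::field) tens"
  using pm_sum_basis[of u] by (simp add: tens_act_def tensor_basis)

text \<open>Monomial matrices permute the words up to a factor that depends only on the total exponent of the
  word. For diagonal matrices this says that words are weight vectors.\<close>

lemma lookup_tens_act_monomial_matrix:
  fixes c :: "'n::finite \<Rightarrow> 'k::field"
  assumes inv: "\<And>i. \<pi> (\<pi> i) = i"
  shows "lookup (tens_act (monomial_matrix \<pi> c) u) (map (Poly_Mapping.map_key \<pi>) w) =
    monomial_value c (sum_list w) * lookup u w"
proof -
  let ?r = "Poly_Mapping.map_key \<pi> :: 'n mon \<Rightarrow> _"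
  have "inj \<pi>" by (metis inv injI)
  then have rr: "?r (?r t) = t" for t
    by (intro poly_mapping_eqI) (simp add: map_key.rep_eq inv)
  then have inj: "inj ?r" by (metis injI)
  have t: "tensor (map (\<lambda>t. subst_act (monomial_matrix \<pi> c) (single t 1)) w) =
      single (map ?r w) (monomial_value c (sum_list w))" for w
  proof (rule poly_mapping_eqI)
    fix v
    have "lookup (tensor (map (\<lambda>t. subst_act (monomial_matrix \<pi> c) (single t 1)) w)) v =
        (if length v = length w
         then (\<Prod>i<length w. monomial_value c (w ! i)) * (\<Prod>i<length w. lookup (single (?r (w ! i)) 1) (v ! i))
         else 0)"
      by (auto simp: lookup_tensor subst_act_monomial_matrix[OF inv] prod.distrib[symmetric]
          lookup_single when_def intro!: prod.cong)
    also have "\<dots> = (\<Prod>i<length w. monomial_value c (w ! i)) *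
        lookup (tensor (map (\<lambda>t. single t 1) (map ?r w))) v"
      unfolding lookup_tensor by simp
    also have "\<dots> = lookup (single (map ?r w) (monomial_value c (sum_list w))) v"
      unfolding tensor_basis
      by (simp add: lookup_single when_def monomial_value_sum_list prod.list_conv_set_nth atLeast0LessThan)
    finally show "lookup (tensor (map (\<lambda>t. subst_act (monomial_matrix \<pi> c) (single t 1)) w)) v =
      lookup (single (map ?r w) (monomial_value c (sum_list w))) v" .
  qed
  have "lookup (tens_act (monomial_matrix \<pi> c) u) (map ?r w) =
      (\<Sum>v\<in>keys u. if v = w then lookup u w * monomial_value c (sum_list w) else 0)"
    unfolding tens_act_def lookup_sum using inj
    by (intro sum.cong) (auto simp: t lookup_single when_def map_injective inj_map_eq_map)
  then show ?thesis by (simp add: in_keys_iff)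
qed

section \<open>Wedge products\<close>

lemma wedge_permute_list:
  "wedge fs = (\<Sum>\<sigma> | \<sigma> permutes {..<length fs}.
     pm_scale (of_int (sign \<sigma>)) (tensor (permute_list \<sigma> fs)))"
  by (simp add: wedge_def permute_list_def)

text \<open>The coefficients of a wedge are the maximal minors of the coefficient matrix of \<open>fs\<close>.\<close>

lemma lookup_wedge:
  "lookup (wedge fs) w = (if length w = length fs
     then \<Sum>\<sigma> | \<sigma> permutes {..<length fs}.
       of_int (sign \<sigma>) * (\<Prod>i<length fs. lookup (fs ! \<sigma> i) (w ! i))
     else 0)"
  unfolding wedge_def by (auto simp: lookup_sum lookup_tensor intro!: sum.cong)

lemma tens_act_wedge:
  fixes fs :: "('n::finite, 'k::field) pol list"
  shows "tens_act g (wedge fs) = wedge (map (subst_act g) fs)"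
proof -
  interpret Vector_Spaces.linear pm_scale pm_scale "tens_act g :: ('n::finite, 'k::field) tens \<Rightarrow> _"
    by (rule linear_tens_act)
  show ?thesis
    unfolding wedge_permute_list
    by (auto simp: sum scale tens_act_tensor permute_list_map intro!: sum.cong)
qed

lemma wedge_words:
  fixes fs :: "('n::finite, 'k::field) pol list"
  assumes "set fs \<subseteq> homog (int m)" "w \<in> keys (wedge fs)"
  shows "length w = length fs" "\<And>t. t \<in> set w \<Longrightarrow> mdeg t = m"
proof -
  show len: "length w = length fs"
    using assms(2) by (auto simp: in_keys_iff lookup_wedge split: if_splits)
  obtain \<sigma> where \<sigma>: "\<sigma> permutes {..<length fs}"
    and nz: "(\<Prod>i<length fs. lookup (fs ! \<sigma> i) (w ! i)) \<noteq> 0"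
  proof -
    have "(\<Sum>\<sigma> | \<sigma> permutes {..<length fs}.
       of_int (sign \<sigma>) * (\<Prod>i<length fs. lookup (fs ! \<sigma> i) (w ! i))) \<noteq> 0"
      using assms(2) len by (simp add: in_keys_iff lookup_wedge)
    then show thesis
      by (rule sum.not_neutral_contains_not_neutral) (auto intro: that)
  qed
  fix t assume "t \<in> set w"
  then obtain i where i: "i < length fs" "t = w ! i"
    by (metis in_set_conv_nth len)
  have "t \<in> keys (fs ! \<sigma> i)"
    using nz i by (auto simp: in_keys_iff)
  moreover have "fs ! \<sigma> i \<in> set fs"
    using permutes_in_image[OF \<sigma>, of i] i by auto
  ultimately show "mdeg t = m"
    using assms(1) by (auto simp: homog_def)
qed

definition alternating :: "('n, 'k::comm_ring_1) tens \<Rightarrow> bool" where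
  "alternating u \<longleftrightarrow> (\<forall>w \<sigma>. \<sigma> permutes {..<length w} \<longrightarrow>
     lookup u (permute_list \<sigma> w) = of_int (sign \<sigma>) * lookup u w)"

lemma alternating_wedge: "alternating (wedge fs)"
  unfolding alternating_def
proof (intro allI impI)
  fix w :: "'a mon list" and \<tau>
  assume \<tau>: "\<tau> permutes {..<length w}"
  show "lookup (wedge fs) (permute_list \<tau> w) = of_int (sign \<tau>) * lookup (wedge fs) w"
  proof (cases "length w = length fs")
    case True
    let ?P = "{\<sigma>. \<sigma> permutes {..<length fs}}"
    let ?t = "\<lambda>\<sigma>. \<Prod>i<length fs. lookup (fs ! \<sigma> i) (w ! i)"
    have \<tau>': "\<tau> permutes {..<length fs}" using \<tau> True by simp
    have "lookup (wedge fs) (permute_list \<tau> w) =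
        (\<Sum>\<sigma>\<in>?P. of_int (sign \<sigma>) * (\<Prod>i<length fs. lookup (fs ! \<sigma> i) (w ! \<tau> i)))"
      using True \<tau> by (auto simp: lookup_wedge permute_list_nth intro!: sum.cong prod.cong)
    also have "\<dots> = (\<Sum>\<sigma>\<in>?P. of_int (sign (\<sigma> \<circ> \<tau>)) *
        (\<Prod>i<length fs. lookup (fs ! (\<sigma> \<circ> \<tau>) i) (w ! \<tau> i)))"
      by (intro sum.reindex_bij_witness[where i = "\<lambda>\<sigma>. \<sigma> \<circ> \<tau>" and j = "\<lambda>\<sigma>. \<sigma> \<circ> inv \<tau>"])
         (auto simp: permutes_compose permutes_inv \<tau>' o_assoc[symmetric] permutes_inv_o[OF \<tau>'] permutes_inverses[OF \<tau>'])
    also have "\<dots> = (\<Sum>\<sigma>\<in>?P. of_int (sign \<tau>) * (of_int (sign \<sigma>) * ?t \<sigma>))"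
    proof (rule sum.cong[OF refl])
      fix \<sigma> assume "\<sigma> \<in> ?P"
      then have "sign (\<sigma> \<circ> \<tau>) = sign \<sigma> * sign \<tau>"
        using \<tau>' by (intro sign_compose) (auto simp: permutation_permutes)
      moreover have "(\<Prod>i<length fs. lookup (fs ! (\<sigma> \<circ> \<tau>) i) (w ! \<tau> i)) = ?t \<sigma>"
        using prod.permute[OF \<tau>', of "\<lambda>i. lookup (fs ! \<sigma> i) (w ! i)"] by (simp add: o_def)
      ultimately show "of_int (sign (\<sigma> \<circ> \<tau>)) * (\<Prod>i<length fs. lookup (fs ! (\<sigma> \<circ> \<tau>) i) (w ! \<tau> i)) =
          of_int (sign \<tau>) * (of_int (sign \<sigma>) * ?t \<sigma>)"
        by simp
    qed
    also have "\<dots> = of_int (sign \<tau>) * lookup (wedge fs) w"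
      using True by (simp add: lookup_wedge sum_distrib_left)
    finally show ?thesis .
  qed (auto simp: lookup_wedge)
qed

text \<open>Exchanging two equal letters fixes the word and changes the sign of its coefficient.\<close>

lemma alternating_distinct:
  fixes u :: "('n, 'k::{idom, ring_char_0}) tens"
  assumes "alternating u" "w \<in> keys u"
  shows "distinct w"
proof (rule ccontr)
  assume "\<not> distinct w"
  then obtain i j where ij: "i < length w" "j < length w" "i \<noteq> j" "w ! i = w ! j"
    by (auto simp: distinct_conv_nth)
  let ?\<sigma> = "Transposition.transpose i j"
  have \<sigma>: "?\<sigma> permutes {..<length w}"
    using ij by (intro permutes_swap_id) auto
  have "permute_list ?\<sigma> w = w"
    using ij by (intro nth_equalityI) (auto simp: permute_list_nth[OF \<sigma>] Transposition.transpose_def)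
  then have "lookup u w = - lookup u w"
    using assms(1) \<sigma> ij unfolding alternating_def by (metis mult_minus1 of_int_1 of_int_minus sign_swap_id)
  then have "2 * lookup u w = 0"
    by (metis mult_2 neg_eq_iff_add_eq_0)
  then show False
    using assms(2) by (simp add: in_keys_iff)
qed

text \<open>Antisymmetrising an alternating tensor word by word multiplies it by \<open>fact l\<close>; dividing by
  this, possible in characteristic zero, writes it as a combination of wedges of monomials.\<close>

lemma alternating_imp_ext_power:
  fixes u :: "('n::finite, 'k::field_char_0) tens"
  assumes alt: "alternating u"
    and words: "\<And>w. w \<in> keys u \<Longrightarrow> length w = l \<and> (\<forall>t\<in>set w. mdeg t = m)"
  shows "u \<in> ext_power l (piece UNIV m)"
proof -
  let ?P = "{\<sigma>. \<sigma> permutes {..<l}}"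
  let ?wd = "\<lambda>w. wedge (map (\<lambda>t. single t (1::'k)) w)"
  have len: "length w = l" if "w \<in> keys u" for w
    using words[OF that] by simp
  have "(\<Sum>w\<in>keys u. pm_scale (lookup u w) (?wd w)) =
      (\<Sum>w\<in>keys u. \<Sum>\<sigma>\<in>?P. single (permute_list \<sigma> w) (lookup u (permute_list \<sigma> w)))"
  proof (rule sum.cong[OF refl])
    fix w assume w: "w \<in> keys u"
    have "pm_scale (lookup u w) (?wd w) = (\<Sum>\<sigma>\<in>?P.
        pm_scale (lookup u w) (pm_scale (of_int (sign \<sigma>)) (tensor (permute_list \<sigma> (map (\<lambda>t. single t (1::'k)) w)))))"
      using len[OF w] by (simp add: wedge_permute_list pm.scale_sum_right)
    also have "\<dots> = (\<Sum>\<sigma>\<in>?P. single (permute_list \<sigma> w) (lookup u (permute_list \<sigma> w)))"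
      using alt len[OF w]
      by (auto intro!: sum.cong simp: permute_list_map tensor_basis alternating_def mult.commute)
    finally show "pm_scale (lookup u w) (?wd w) =
        (\<Sum>\<sigma>\<in>?P. single (permute_list \<sigma> w) (lookup u (permute_list \<sigma> w)))" .
  qed
  also have "\<dots> = (\<Sum>\<sigma>\<in>?P. \<Sum>w\<in>keys u. single (permute_list \<sigma> w) (lookup u (permute_list \<sigma> w)))"
    by (rule sum.swap)
  also have "\<dots> = (\<Sum>\<sigma>\<in>?P. u)"
  proof (rule sum.cong[OF refl])
    fix \<sigma> assume "\<sigma> \<in> ?P"
    then have \<sigma>: "\<sigma> permutes {..<l}" and \<sigma>': "inv \<sigma> permutes {..<l}"
      by (auto intro: permutes_inv)
    have keys: "permute_list \<tau> w \<in> keys u" if "w \<in> keys u" "\<tau> permutes {..<l}" for \<tau> w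
      using alt that len[OF that(1)] by (auto simp: alternating_def in_keys_iff sign_def)
    have inv: "permute_list (inv \<tau>) (permute_list \<tau> w) = w" "permute_list \<tau> (permute_list (inv \<tau>) w) = w"
      if "w \<in> keys u" "\<tau> permutes {..<l}" for \<tau> w
      using len[OF that(1)] that(2)
      by (simp_all add: permute_list_compose[symmetric] permutes_inv permutes_inv_o)
    have "(\<Sum>w\<in>keys u. single (permute_list \<sigma> w) (lookup u (permute_list \<sigma> w))) =
        (\<Sum>w\<in>keys u. single w (lookup u w))"
      by (rule sum.reindex_bij_witness[where i = "permute_list (inv \<sigma>)" and j = "permute_list \<sigma>"])
         (auto simp: keys inv \<sigma> \<sigma>')
    then show "(\<Sum>w\<in>keys u. single (permute_list \<sigma> w) (lookup u (permute_list \<sigma> w))) = u"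
      by (simp add: poly_mapping_sum_single)
  qed
  also have "\<dots> = pm_scale (fact l) u"
  proof (rule poly_mapping_eqI)
    fix w
    have "card ?P = fact l" by (rule card_permutations) auto
    then show "lookup (\<Sum>\<sigma>\<in>?P. u) w = lookup (pm_scale (fact l) u) w"
      by (simp add: lookup_sum)
  qed
  finally have eq: "u = pm_scale (inverse (fact l)) (\<Sum>w\<in>keys u. pm_scale (lookup u w) (?wd w))"
    by simp
  have "(\<Sum>w\<in>keys u. pm_scale (lookup u w) (?wd w)) \<in> ext_power l (piece UNIV m)"
    unfolding ext_power_def
  proof (intro pm.span_sum pm.span_scale pm.span_base CollectI exI conjI)
    fix w assume "w \<in> keys u"
    then show "length (map (\<lambda>t. single t (1::'k)) w) = l"
      "set (map (\<lambda>t. single t (1::'k)) w) \<subseteq> piece UNIV m"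
      using words by (auto simp: piece_def)
  qed (rule refl)
  then show ?thesis
    by (subst eq) (auto simp: ext_power_def intro: pm.span_scale)
qed

lemma tens_act_ext_power:
  fixes u :: "('n::finite, 'k::field) tens"
  assumes "u \<in> ext_power l (piece UNIV m)"
  shows "tens_act g u \<in> ext_power l (piece UNIV m)"
proof -
  interpret Vector_Spaces.linear pm_scale pm_scale "tens_act g :: ('n::finite, 'k::field) tens \<Rightarrow> _"
    by (rule linear_tens_act)
  let ?W = "{wedge fs | fs :: ('n, 'k) pol list. length fs = l \<and> set fs \<subseteq> piece UNIV m}"
  have "tens_act g ` ?W \<subseteq> ?W"
  proof clarify
    fix fs :: "('n, 'k) pol list"
    assume "set fs \<subseteq> piece UNIV m"
    then show "\<exists>gs. tens_act g (wedge fs) = wedge gs \<and> length gs = length fs \<and> set gs \<subseteq> piece UNIV m"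
      by (intro exI[of _ "map (subst_act g) fs"])
         (auto simp: tens_act_wedge piece_def intro!: homog_subst_act)
  qed
  then have "pm.span (tens_act g ` ?W) \<subseteq> pm.span ?W"
    by (rule pm.span_mono)
  then show ?thesis
    using assms unfolding ext_power_def span_image by blast
qed

text \<open>Varying one letter of a word reads off a vector of the span: this is the cofactor expansion of
  the minors of the coefficient matrix along one column.\<close>

lemma wedge_contraction:
  fixes fs :: "('n, 'k::field) pol list"
  assumes "length w = length fs" "i < length fs"
  shows "\<exists>F\<in>pm.span (set fs). \<forall>t. lookup F t = lookup (wedge fs) (w[i := t])"
proof -
  let ?P = "{\<sigma>. \<sigma> permutes {..<length fs}}"
  let ?c = "\<lambda>\<sigma>. of_int (sign \<sigma>) * (\<Prod>k\<in>{..<length fs} - {i}. lookup (fs ! \<sigma> k) (w ! k))"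
  let ?F = "\<Sum>\<sigma>\<in>?P. pm_scale (?c \<sigma>) (fs ! \<sigma> i)"
  have "?F \<in> pm.span (set fs)"
  proof (intro pm.span_sum pm.span_scale pm.span_base)
    fix \<sigma> assume "\<sigma> \<in> ?P"
    then show "fs ! \<sigma> i \<in> set fs"
      using permutes_in_image[of \<sigma> "{..<length fs}" i] assms(2) by auto
  qed
  moreover have "lookup ?F t = lookup (wedge fs) (w[i := t])" for t
  proof -
    have "(\<Prod>k<length fs. lookup (fs ! \<sigma> k) (w[i := t] ! k)) =
        lookup (fs ! \<sigma> i) t * (\<Prod>k\<in>{..<length fs} - {i}. lookup (fs ! \<sigma> k) (w ! k))" for \<sigma>
      using assms by (subst prod.remove[of _ i]) (auto intro!: prod.cong)
    then show ?thesis
      using assms(1) by (auto simp: lookup_sum lookup_wedge mult_ac intro!: sum.cong)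
  qed
  ultimately show ?thesis by blast
qed

text \<open>The wedge of a basis is nonzero because it pairs to 1 with the wedge of the dual basis.\<close>

lemma wedge_nonzero:
  fixes fs :: "('n, 'k::field) pol list"
  assumes "distinct fs" "pm.independent (set fs)"
  shows "wedge fs \<noteq> 0"
proof
  assume zero: "wedge fs = 0"
  define B where "B = pm.extend_basis (set fs)"
  have B: "pm.independent B" "pm.span B = UNIV" "set fs \<subseteq> B"
    using assms(2) by (auto simp: B_def pm.independent_extend_basis pm.span_extend_basis
        pm.extend_basis_superset)
  define \<phi> where "\<phi> i p = pm.representation B p (fs ! i)" for i p
  define T where "T = (\<Union>f\<in>set fs. keys f)"
  have T: "finite T" by (auto simp: T_def)
  let ?P = "{\<sigma>. \<sigma> permutes {..<length fs}}"
  let ?Ts = "replicate (length fs) T"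
  have expand: "\<phi> i f = (\<Sum>t\<in>T. lookup f t * \<phi> i (single t 1))" if "f \<in> set fs" for f i
  proof -
    have "keys f \<subseteq> T" using that by (auto simp: T_def)
    then have "f = (\<Sum>t\<in>T. pm_scale (lookup f t) (single t 1))"
      using T by (simp add: poly_mapping_sum_single)
    then have "\<phi> i f = \<phi> i (\<Sum>t\<in>T. pm_scale (lookup f t) (single t 1))"
      by (rule arg_cong)
    also have "\<dots> = (\<Sum>t\<in>T. lookup f t * \<phi> i (single t 1))"
      using B unfolding \<phi>_def
      by (simp add: pm.representation_sum pm.representation_scale del: pm_scale_single)
    finally show ?thesis .
  qed
  have dual: "\<phi> i (fs ! j) = (if i = j then 1 else 0)" if "i < length fs" "j < length fs" for i j
    using that B assms(1) unfolding \<phi>_def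
    by (subst pm.representation_basis) (auto simp: nth_eq_iff_index_eq)
  have "0 = (\<Sum>w\<in>listset ?Ts. lookup (wedge fs) w * (\<Prod>i<length fs. \<phi> i (single (w ! i) 1)))"
    by (simp add: zero)
  also have "\<dots> = (\<Sum>w\<in>listset ?Ts. \<Sum>\<sigma>\<in>?P. of_int (sign \<sigma>) *
      (\<Prod>i<length ?Ts. lookup (fs ! \<sigma> i) (w ! i) * \<phi> i (single (w ! i) 1)))"
    by (rule sum.cong[OF refl])
       (auto simp: in_listset lookup_wedge sum_distrib_right prod.distrib mult.assoc)
  also have "\<dots> = (\<Sum>\<sigma>\<in>?P. of_int (sign \<sigma>) * (\<Sum>w\<in>listset ?Ts.
      (\<Prod>i<length ?Ts. lookup (fs ! \<sigma> i) (w ! i) * \<phi> i (single (w ! i) 1))))"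
    by (subst sum.swap) (simp add: sum_distrib_left)
  also have "\<dots> = (\<Sum>\<sigma>\<in>?P. of_int (sign \<sigma>) * (\<Prod>i<length fs. \<phi> i (fs ! \<sigma> i)))"
  proof (rule sum.cong[OF refl])
    fix \<sigma> assume "\<sigma> \<in> ?P"
    then have "fs ! \<sigma> i \<in> set fs" if "i < length fs" for i
      using permutes_in_image[of \<sigma> "{..<length fs}" i] that by auto
    then have "(\<Sum>w\<in>listset ?Ts. \<Prod>i<length ?Ts. lookup (fs ! \<sigma> i) (w ! i) * \<phi> i (single (w ! i) 1)) =
        (\<Prod>i<length fs. \<phi> i (fs ! \<sigma> i))"
      by (subst sum_listset[of _ "\<lambda>i t. lookup (fs ! \<sigma> i) t * \<phi> i (single t 1)"])
         (auto simp: T expand intro!: prod.cong)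
    then show "of_int (sign \<sigma>) * (\<Sum>w\<in>listset ?Ts. \<Prod>i<length ?Ts.
          lookup (fs ! \<sigma> i) (w ! i) * \<phi> i (single (w ! i) 1)) =
        of_int (sign \<sigma>) * (\<Prod>i<length fs. \<phi> i (fs ! \<sigma> i))"
      by simp
  qed
  also have "\<dots> = (\<Sum>\<sigma>\<in>?P. if \<sigma> = id then 1 else 0)"
  proof (rule sum.cong[OF refl])
    fix \<sigma> assume "\<sigma> \<in> ?P"
    then have \<sigma>: "\<sigma> permutes {..<length fs}" by simp
    show "of_int (sign \<sigma>) * (\<Prod>i<length fs. \<phi> i (fs ! \<sigma> i)) = (if \<sigma> = id then 1 else 0)"
    proof (cases "\<sigma> = id")
      case False
      then obtain i where i: "\<sigma> i \<noteq> i" by (auto simp: fun_eq_iff)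
      then have "i < length fs" using \<sigma> by (metis lessThan_iff permutes_not_in)
      moreover from this have "\<sigma> i < length fs" using permutes_in_image[OF \<sigma>, of i] by simp
      ultimately have "\<phi> i (fs ! \<sigma> i) = 0" using i by (simp add: dual)
      then show ?thesis using \<open>i < length fs\<close> False by (auto intro!: prod_zero)
    qed (simp add: dual)
  qed
  also have "\<dots> = 1"
    by (simp add: finite_permutations permutes_id)
  finally show False by simp
qed

section \<open>Polynomial dependence of the action on the group element\<close>

text \<open>Families of finitely supported functions with polynomial coefficients and a common finite support.
  Building them from monomials makes products and sums of families accessible by induction.\<close>

inductive polynomial_family ::
  "('x \<Rightarrow> 'i \<Rightarrow> 'k::comm_semiring_1) \<Rightarrow> ('x \<Rightarrow> 'a \<Rightarrow>\<^sub>0 'k) \<Rightarrow> bool" for C where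
  single: "polynomial_in C c \<Longrightarrow> polynomial_family C (\<lambda>x. single t (c x))"
| add: "polynomial_family C F \<Longrightarrow> polynomial_family C G \<Longrightarrow> polynomial_family C (\<lambda>x. F x + G x)"

lemma polynomial_family_lookup:
  "polynomial_family C F \<Longrightarrow> polynomial_in C (\<lambda>x. lookup (F x) t)"
proof (induction rule: polynomial_family.induct)
  case (single c s)
  then show ?case by (cases "s = t") (auto simp: lookup_single intro: polynomial_in_const)
qed (auto simp: lookup_add intro: polynomial_in_add)

lemma polynomial_family_mult:
  assumes "polynomial_family C F" "polynomial_family C G"
  shows "polynomial_family C (\<lambda>x. F x * G x)"
  using assms(1)
proof (induction rule: polynomial_family.induct)
  case (single c s)
  from assms(2) show ?case
  proof (induction rule: polynomial_family.induct)
    case (single d t)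
    then show ?case using \<open>polynomial_in C c\<close>
      by (simp add: mult_single) (intro polynomial_family.single polynomial_in_mult)
  qed (simp add: distrib_left polynomial_family.add)
qed (simp add: distrib_right polynomial_family.add)

lemma polynomial_family_const: "polynomial_family C (\<lambda>x. p)"
proof -
  have "polynomial_family C (\<lambda>x. \<Sum>t\<in>A. single t (lookup p t))" if "finite A" for A
    using that
  proof (induction A rule: finite_induct)
    case empty
    show ?case using polynomial_family.single[OF polynomial_in_const, of C _ 0] by simp
  next
    case (insert t A)
    then show ?case
      by (simp add: polynomial_family.add polynomial_family.single polynomial_in_const)
  qed
  from this[of "keys p"] show ?thesis by (simp add: poly_mapping_sum_single)
qed

lemma polynomial_family_sum:
  "(\<And>a. a \<in> A \<Longrightarrow> polynomial_family C (F a)) \<Longrightarrow> polynomial_family C (\<lambda>x. \<Sum>a\<in>A. F a x)"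
  by (induction A rule: infinite_finite_induct)
     (auto intro: polynomial_family_const polynomial_family.add)

lemma polynomial_family_prod:
  "(\<And>a. a \<in> A \<Longrightarrow> polynomial_family C (F a)) \<Longrightarrow> polynomial_family C (\<lambda>x. \<Prod>a\<in>A. F a x)"
  by (induction A rule: infinite_finite_induct)
     (auto intro: polynomial_family_const polynomial_family_mult)

lemma polynomial_family_power:
  "polynomial_family C F \<Longrightarrow> polynomial_family C (\<lambda>x. F x ^ n)"
  by (induction n) (auto intro: polynomial_family_const polynomial_family_mult)

lemma polynomial_in_tens_act:
  fixes v :: "('n::finite, 'k::field) tens"
  assumes "\<And>a c. polynomial_in C (\<lambda>x. G x $ a $ c)"
  shows "polynomial_in C (\<lambda>x. lookup (tens_act (G x) v) w)"
proof -
  have "polynomial_family C (\<lambda>x. subst_act (G x) (single t 1))" for t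
    unfolding subst_act_single monomial_value_def
    by (intro polynomial_family_mult polynomial_family_const polynomial_family_prod
        polynomial_family_power polynomial_family_sum)
       (simp add: const_def polynomial_family.single assms)
  then have entry: "polynomial_in C (\<lambda>x. lookup (subst_act (G x) (single t 1)) s)" for s t
    by (rule polynomial_family_lookup)
  have "polynomial_in C (\<lambda>x. lookup (tensor (map (\<lambda>t. subst_act (G x) (single t 1)) u)) w)" for u
    by (cases "length w = length u")
       (auto simp: lookup_tensor intro!: polynomial_in_prod polynomial_in_const entry)
  then show ?thesis
    unfolding tens_act_def lookup_sum lookup_pm_scale
    by (intro polynomial_in_sum polynomial_in_mult polynomial_in_const)
qed


section \<open>The special linear group is irreducible\<close>

text \<open>Regular functions on the part of the affine line where \<open>D\<close> does not vanish.\<close>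

definition rational_along :: "'k poly \<Rightarrow> ('k \<Rightarrow> 'k::field) \<Rightarrow> bool" where
  "rational_along D f \<longleftrightarrow> (\<exists>P M. \<forall>x. poly D x \<noteq> 0 \<longrightarrow> f x * poly D x ^ M = poly P x)"

lemma rational_along_const: "rational_along D (\<lambda>x. c)"
  unfolding rational_along_def by (rule exI[of _ "[:c:]"], rule exI[of _ 0]) simp

lemma rational_along_add:
  assumes "rational_along D f" "rational_along D g"
  shows "rational_along D (\<lambda>x. f x + g x)"
proof -
  obtain P M where P: "\<And>x. poly D x \<noteq> 0 \<Longrightarrow> f x * poly D x ^ M = poly P x"
    using assms(1) unfolding rational_along_def by blast
  obtain Q N where Q: "\<And>x. poly D x \<noteq> 0 \<Longrightarrow> g x * poly D x ^ N = poly Q x"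
    using assms(2) unfolding rational_along_def by blast
  have "(f x + g x) * poly D x ^ (M + N) = poly (P * D ^ N + Q * D ^ M) x" if "poly D x \<noteq> 0" for x
    using P[OF that, symmetric] Q[OF that, symmetric] by (simp add: algebra_simps power_add poly_power)
  then show ?thesis unfolding rational_along_def by blast
qed

lemma rational_along_mult:
  assumes "rational_along D f" "rational_along D g"
  shows "rational_along D (\<lambda>x. f x * g x)"
proof -
  obtain P M where P: "\<And>x. poly D x \<noteq> 0 \<Longrightarrow> f x * poly D x ^ M = poly P x"
    using assms(1) unfolding rational_along_def by blast
  obtain Q N where Q: "\<And>x. poly D x \<noteq> 0 \<Longrightarrow> g x * poly D x ^ N = poly Q x"
    using assms(2) unfolding rational_along_def by blast
  have "(f x * g x) * poly D x ^ (M + N) = poly (P * Q) x" if "poly D x \<noteq> 0" for x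
    using P[OF that, symmetric] Q[OF that, symmetric] by (simp add: algebra_simps power_add)
  then show ?thesis unfolding rational_along_def by blast
qed

lemma rational_along_sum:
  "(\<And>a. a \<in> A \<Longrightarrow> rational_along D (f a)) \<Longrightarrow> rational_along D (\<lambda>x. \<Sum>a\<in>A. f a x)"
  by (induction A rule: infinite_finite_induct)
     (auto intro: rational_along_const rational_along_add)

lemma rational_along_prod:
  "(\<And>a. a \<in> A \<Longrightarrow> rational_along D (f a)) \<Longrightarrow> rational_along D (\<lambda>x. \<Prod>a\<in>A. f a x)"
  by (induction A rule: infinite_finite_induct)
     (auto intro: rational_along_const rational_along_mult)

lemma rational_along_power: "rational_along D f \<Longrightarrow> rational_along D (\<lambda>x. f x ^ n)"
  by (induction n) (auto intro: rational_along_const rational_along_mult)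

lemma rational_along_compose:
  assumes "polynomial_in C p" "\<And>i. rational_along D (\<lambda>x. C (\<gamma> x) i)"
  shows "rational_along D (\<lambda>x. p (\<gamma> x))"
proof -
  obtain q where q: "\<And>x. p x = eval (C x) q"
    using assms(1) by (auto simp: polynomial_in_def)
  show ?thesis
    unfolding q insertion_def
    by (intro rational_along_sum rational_along_mult rational_along_const rational_along_prod
        rational_along_power assms(2))
qed

text \<open>Any two points of the group lie on a rational curve in it: join them by a line in the space of
  matrices and divide one row by the determinant. A polynomial function that does not vanish at one
  of the two points vanishes at only finitely many points of the curve.\<close>

lemma SL_irreducible:
  fixes g\<^sub>1 g\<^sub>2 :: "'k::field_char_0 ^ 'n ^ 'n"
  assumes p: "polynomial_in coords p" and q: "polynomial_in coords q"
    and g1: "g\<^sub>1 \<in> SL" "p g\<^sub>1 \<noteq> 0" and g2: "g\<^sub>2 \<in> SL" "q g\<^sub>2 \<noteq> 0"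
  shows "\<exists>g\<in>SL. p g \<noteq> 0 \<and> q g \<noteq> 0"
proof -
  obtain k :: 'n where True by blast
  define L where "L i j = [:g\<^sub>1 $ i $ j, g\<^sub>2 $ i $ j - g\<^sub>1 $ i $ j:]" for i j
  define \<gamma> where "\<gamma> x = (\<chi> i j. poly (L i j) x)" for x
  define D where "D = (\<Sum>\<pi> | \<pi> permutes (UNIV :: 'n set). of_int (sign \<pi>) * (\<Prod>i\<in>UNIV. L i (\<pi> i)))"
  have D: "poly D x = det (\<gamma> x)" for x
    by (simp add: D_def det_def \<gamma>_def poly_sum poly_prod)
  define \<delta> where "\<delta> x = (\<chi> i. if i = k then inverse (poly D x) *s (\<gamma> x $ i) else \<gamma> x $ i)" for x
  have SL: "\<delta> x \<in> SL" if "poly D x \<noteq> 0" for x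
  proof -
    have "det (\<delta> x) = inverse (poly D x) * det (\<chi> i. if i = k then \<gamma> x $ i else \<gamma> x $ i)"
      unfolding \<delta>_def by (rule det_row_mul)
    also have "(\<chi> i. if i = k then \<gamma> x $ i else \<gamma> x $ i) = \<gamma> x"
      by (simp add: vec_eq_iff)
    finally show ?thesis using that by (simp add: SL_def D)
  qed
  have ends: "\<gamma> 0 = g\<^sub>1" "\<gamma> 1 = g\<^sub>2"
    by (simp_all add: \<gamma>_def L_def vec_eq_iff)
  then have D01: "poly D 0 = 1" "poly D 1 = 1"
    using g1 g2 by (simp_all add: D SL_def)
  then have ends': "\<delta> 0 = g\<^sub>1" "\<delta> 1 = g\<^sub>2"
    using ends by (simp_all add: \<delta>_def vec_eq_iff)
  have entry: "rational_along D (\<lambda>x. \<delta> x $ i $ j)" for i j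
  proof (cases "i = k")
    case True
    then show ?thesis unfolding rational_along_def
      by (intro exI[of _ "L i j"] exI[of _ 1]) (simp add: \<delta>_def \<gamma>_def)
  next
    case False
    then show ?thesis unfolding rational_along_def
      by (intro exI[of _ "L i j"] exI[of _ 0]) (simp add: \<delta>_def \<gamma>_def)
  qed
  then have coords: "rational_along D (\<lambda>x. coords (\<delta> x) ij)" for ij
    by (cases ij) auto
  obtain P M where P: "\<And>x. poly D x \<noteq> 0 \<Longrightarrow> p (\<delta> x) * poly D x ^ M = poly P x"
    using rational_along_compose[OF p coords] unfolding rational_along_def by blast
  obtain Q N where Q: "\<And>x. poly D x \<noteq> 0 \<Longrightarrow> q (\<delta> x) * poly D x ^ N = poly Q x"
    using rational_along_compose[OF q coords] unfolding rational_along_def by blast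
  have "poly P 0 \<noteq> 0" "poly Q 1 \<noteq> 0"
    using P[of 0] Q[of 1] D01 ends' g1 g2 by auto
  then have "P * Q * D \<noteq> 0"
    using D01 by auto
  then have "finite {x. poly (P * Q * D) x = 0}"
    by (rule poly_roots_finite)
  then obtain x where "poly (P * Q * D) x \<noteq> 0"
    using ex_new_if_finite[OF infinite_UNIV_char_0] by blast
  then have x: "poly P x \<noteq> 0" "poly Q x \<noteq> 0" "poly D x \<noteq> 0"
    by auto
  then have "p (\<delta> x) \<noteq> 0" "q (\<delta> x) \<noteq> 0"
    using P[of x] Q[of x] by auto
  then show ?thesis
    using SL[OF x(3)] by blast
qed

lemma SL_irreducible_prod:
  fixes p :: "'a \<Rightarrow> 'k::field_char_0 ^ 'n ^ 'n \<Rightarrow> 'k"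
  assumes "finite A" "\<And>a. a \<in> A \<Longrightarrow> polynomial_in coords (p a)"
    and "\<And>a. a \<in> A \<Longrightarrow> \<exists>g\<in>SL. p a g \<noteq> 0"
  shows "\<exists>g\<in>SL. \<forall>a\<in>A. p a g \<noteq> 0"
  using assms
proof (induction A rule: finite_induct)
  case empty
  have "mat 1 \<in> (SL :: ('k ^ 'n ^ 'n) set)" by (simp add: SL_def)
  then show ?case by blast
next
  case (insert a A)
  then obtain g\<^sub>1 where g1: "g\<^sub>1 \<in> SL" "(\<Prod>a\<in>A. p a g\<^sub>1) \<noteq> 0" by auto
  obtain g\<^sub>2 where g2: "g\<^sub>2 \<in> SL" "p a g\<^sub>2 \<noteq> 0" using insert.prems by auto
  have "\<exists>g\<in>SL. (\<Prod>a\<in>A. p a g) \<noteq> 0 \<and> p a g \<noteq> 0"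
    by (rule SL_irreducible[where p = "\<lambda>g. \<Prod>a\<in>A. p a g" and q = "p a", OF _ _ g1 g2]) (use insert.prems in \<open>auto intro: polynomial_in_prod\<close>)
  then show ?case using insert.hyps by auto
qed

section \<open>Independence of characters\<close>

text \<open>Functions are required to vanish off \<open>S\<close> so that equality as characters of \<open>S\<close> is equality of
  functions.\<close>

definition multiplicative_on ::
  "'a set \<Rightarrow> ('a \<Rightarrow> 'a \<Rightarrow> 'a) \<Rightarrow> ('a \<Rightarrow> 'k::field) \<Rightarrow> bool" where
  "multiplicative_on S m \<xi> \<longleftrightarrow> (\<forall>s\<in>S. \<forall>t\<in>S. \<xi> (m s t) = \<xi> s * \<xi> t) \<and>
     (\<exists>s\<in>S. \<xi> s \<noteq> 0) \<and> (\<forall>s. s \<notin> S \<longrightarrow> \<xi> s = 0)"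

text \<open>Dedekind's argument: translating a relation by \<open>t\<close> and subtracting \<open>\<psi> t\<close> times the relation removes
  \<open>\<psi>\<close> from it and multiplies the coefficient of \<open>\<xi>\<close> by \<open>\<xi> t - \<psi> t\<close>.\<close>

lemma multiplicative_independent:
  assumes "finite X" "\<And>\<xi>. \<xi> \<in> X \<Longrightarrow> multiplicative_on S m \<xi>"
    and closed: "\<And>s t. s \<in> S \<Longrightarrow> t \<in> S \<Longrightarrow> m s t \<in> S"
    and "\<And>s. s \<in> S \<Longrightarrow> (\<Sum>\<xi>\<in>X. c \<xi> * \<xi> s) = 0"
    and "\<xi> \<in> X"
  shows "c \<xi> = 0"
  using assms(1,2,4,5)
proof (induction X arbitrary: c \<xi> rule: finite_induct)
  case (insert \<psi> X)
  have mult: "\<xi> (m s t) = \<xi> s * \<xi> t" if "\<xi> \<in> insert \<psi> X" "s \<in> S" "t \<in> S" for \<xi> s t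
    using insert.prems(1)[OF that(1)] that(2,3) by (auto simp: multiplicative_on_def)
  have X: "c \<xi> = 0" if \<xi>: "\<xi> \<in> X" for \<xi>
  proof -
    have "c \<xi> * (\<xi> t - \<psi> t) = 0" if t: "t \<in> S" for t
    proof (rule insert.IH[of "\<lambda>\<xi>. c \<xi> * (\<xi> t - \<psi> t)"])
      fix s assume s: "s \<in> S"
      have "(\<Sum>\<xi>\<in>X. c \<xi> * (\<xi> t - \<psi> t) * \<xi> s) =
          (\<Sum>\<xi>\<in>insert \<psi> X. c \<xi> * (\<xi> t - \<psi> t) * \<xi> s)"
        using insert.hyps by simp
      also have "\<dots> = (\<Sum>\<xi>\<in>insert \<psi> X. c \<xi> * \<xi> (m t s)) - \<psi> t * (\<Sum>\<xi>\<in>insert \<psi> X. c \<xi> * \<xi> s)"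
        unfolding sum_distrib_left sum_subtractf[symmetric]
        by (intro sum.cong refl) (simp add: mult s t algebra_simps)
      finally show "(\<Sum>\<xi>\<in>X. c \<xi> * (\<xi> t - \<psi> t) * \<xi> s) = 0"
        using insert.prems(2) s t closed by simp
    qed (use insert.prems \<xi> in auto)
    moreover obtain t where "t \<in> S" "\<xi> t \<noteq> \<psi> t"
    proof -
      have "\<xi> \<noteq> \<psi>" using \<xi> insert.hyps by auto
      then obtain t where "\<xi> t \<noteq> \<psi> t" by auto
      then show thesis
        using that insert.prems(1)[of \<xi>] insert.prems(1)[of \<psi>] \<xi>
        unfolding multiplicative_on_def by (metis insertCI)
    qed
    ultimately show ?thesis by auto
  qed
  obtain s where "s \<in> S" "\<psi> s \<noteq> 0"
    using insert.prems(1)[of \<psi>] by (auto simp: multiplicative_on_def)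
  moreover have "(\<Sum>\<xi>\<in>insert \<psi> X. c \<xi> * \<xi> s) = c \<psi> * \<psi> s"
    using insert.hyps X by simp
  ultimately have "c \<psi> = 0"
    using insert.prems(2)[of s] by simp
  then show ?case
    using insert.prems(3) X by auto
qed simp

definition multiplicative_combination ::
  "'a set \<Rightarrow> ('a \<Rightarrow> 'a \<Rightarrow> 'a) \<Rightarrow> ('a \<Rightarrow> 'k::field) set \<Rightarrow> ('a \<Rightarrow> 'k) \<Rightarrow> bool" where
  "multiplicative_combination S m X f \<longleftrightarrow> finite X \<and> (\<forall>\<xi>\<in>X. multiplicative_on S m \<xi>) \<and>
     (\<exists>c. \<forall>s\<in>S. f s = (\<Sum>\<xi>\<in>X. c \<xi> * \<xi> s))"

lemma multiplicative_combination_mono: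
  assumes "multiplicative_combination S m X f" "X \<subseteq> Y" "finite Y"
    and "\<And>\<xi>. \<xi> \<in> Y \<Longrightarrow> multiplicative_on S m \<xi>"
  shows "multiplicative_combination S m Y f"
proof -
  obtain c where c: "\<And>s. s \<in> S \<Longrightarrow> f s = (\<Sum>\<xi>\<in>X. c \<xi> * \<xi> s)"
    using assms(1) unfolding multiplicative_combination_def by blast
  have "(\<Sum>\<xi>\<in>X. c \<xi> * \<xi> s) = (\<Sum>\<xi>\<in>Y. (if \<xi> \<in> X then c \<xi> else 0) * \<xi> s)" for s
    using assms(2,3) by (intro sum.mono_neutral_cong_left) auto
  then have "\<forall>s\<in>S. f s = (\<Sum>\<xi>\<in>Y. (if \<xi> \<in> X then c \<xi> else 0) * \<xi> s)"
    using c by simp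
  then show ?thesis
    using assms(3,4) unfolding multiplicative_combination_def
    by (intro conjI exI[of _ "\<lambda>\<xi>. if \<xi> \<in> X then c \<xi> else 0"]) auto
qed

text \<open>Different indices may give the same character, whose coefficients then add up.\<close>

lemma multiplicative_combination_sum:
  assumes "finite A" "\<And>a. a \<in> A \<Longrightarrow> multiplicative_on S m (\<xi> a)"
  shows "multiplicative_combination S m (\<xi> ` A) (\<lambda>s. \<Sum>a\<in>A. c a * \<xi> a s)"
proof -
  have "(\<Sum>a\<in>A. c a * \<xi> a s) = (\<Sum>\<psi>\<in>\<xi> ` A. (\<Sum>a\<in>{a \<in> A. \<xi> a = \<psi>}. c a) * \<psi> s)" for s
    by (subst sum.image_gen[OF assms(1), of _ \<xi>]) (auto simp: sum_distrib_right intro!: sum.cong)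
  then show ?thesis
    using assms unfolding multiplicative_combination_def
    by (intro conjI exI[of _ "\<lambda>\<psi>. \<Sum>a\<in>{a \<in> A. \<xi> a = \<psi>}. c a"]) auto
qed


section \<open>Tori are diagonalisable\<close>

abbreviation "Gm_mult \<equiv> (\<lambda>s t i :: nat. s i * t i :: 'k::field)"

lemma Gm_mult_closed: "s \<in> Gm r \<Longrightarrow> t \<in> Gm r \<Longrightarrow> Gm_mult s t \<in> Gm r"
  by (auto simp: Gm_def)

lemma Gm_one: "(\<lambda>_. 1) \<in> Gm r"
  by (auto simp: Gm_def)

text \<open>Laurent monomials are characters of \<open>Gm r\<close>.\<close>

lemma Gm_regular_combination:
  fixes f :: "(nat \<Rightarrow> 'k::field) \<Rightarrow> 'k"
  assumes "Gm_regular r f"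
  shows "\<exists>X. multiplicative_combination (Gm r) Gm_mult X f"
proof -
  obtain p N where f: "\<And>s. s \<in> Gm r \<Longrightarrow> f s = eval s p / (\<Prod>i<r. s i) ^ N"
    using assms unfolding Gm_regular_def by blast
  define \<xi> where "\<xi> t s = (if s \<in> Gm r then monomial_value s t / (\<Prod>i<r. s i) ^ N else 0)" for t and s :: "nat \<Rightarrow> 'k"
  have "multiplicative_on (Gm r) Gm_mult (\<xi> t)" for t
  proof -
    have "\<xi> t (\<lambda>_. 1) \<noteq> 0"
      by (simp add: \<xi>_def Gm_one)
    moreover have "\<xi> t (Gm_mult s s') = \<xi> t s * \<xi> t s'" if "s \<in> Gm r" "s' \<in> Gm r" for s s'
      using that Gm_mult_closed[OF that]
      by (simp add: \<xi>_def monomial_value_times prod.distrib power_mult_distrib)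
    ultimately show ?thesis
      unfolding multiplicative_on_def using Gm_one[of r]
      by (intro conjI ballI bexI[of _ "\<lambda>_. 1"] allI impI) (auto simp: \<xi>_def)
  qed
  then have "multiplicative_combination (Gm r) Gm_mult (\<xi> ` keys p)
      (\<lambda>s. \<Sum>t\<in>keys p. lookup p t * \<xi> t s)"
    by (intro multiplicative_combination_sum) auto
  moreover have "f s = (\<Sum>t\<in>keys p. lookup p t * \<xi> t s)" if "s \<in> Gm r" for s
    using that by (simp add: f \<xi>_def insertion_def monomial_value_def sum_divide_distrib)
  ultimately have "multiplicative_combination (Gm r) Gm_mult (\<xi> ` keys p) f"
    by (auto simp: multiplicative_combination_def)
  then show ?thesis by blast
qed

lemma matrix_entry_mult: "(A ** B) $ i $ j = (\<Sum>l\<in>UNIV. A $ i $ l * B $ l $ j)"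
  by (simp add: matrix_matrix_mult_def)

abbreviation "diag_matrix \<equiv> monomial_matrix (\<lambda>i. i)"

lemma det_diag_matrix: "det (diag_matrix c) = prod c UNIV"
  by (subst det_diagonal) (auto simp: monomial_matrix_def)

text \<open>Each entry of the parametrisation \<open>\<phi>\<close> is a linear combination of characters, so that
  \<open>\<phi> s\<close> is the sum of the matrices \<open>M \<xi>\<close>, each multiplied by \<open>\<xi> s\<close>. The columns of these matrices are common
  eigenvectors, and they span because the matrices, weighted by the values at the neutral element,
  add up to the identity.\<close>

lemma torus_diagonalisable:
  fixes R :: "('k::field_char_0 ^ 'n ^ 'n) set"
  assumes "torus R"
  shows "\<exists>H K. H ** K = mat 1 \<and> K ** H = mat 1 \<and> det H = 1 \<and> det K = 1 \<and>
    (\<forall>g\<in>R. \<forall>i j. i \<noteq> j \<longrightarrow> (K ** g ** H) $ i $ j = 0)"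
proof -
  from assms obtain r \<phi> where bij: "bij_betw \<phi> (Gm r) R"
    and hom: "\<And>s s'. s \<in> Gm r \<Longrightarrow> s' \<in> Gm r \<Longrightarrow> \<phi> (Gm_mult s s') = \<phi> s ** \<phi> s'"
    and reg: "\<And>a c. Gm_regular r (\<lambda>s. \<phi> s $ a $ c)"
    and SL: "R \<subseteq> SL"
    unfolding torus_def SL_closed_def by blast
  obtain Y where Y: "\<And>a c. multiplicative_combination (Gm r) Gm_mult (Y a c) (\<lambda>s. \<phi> s $ a $ c)"
    using Gm_regular_combination[OF reg] by metis
  define X where "X = (\<Union>a. \<Union>c. Y a c)"
  have X: "finite X" "\<And>\<xi>. \<xi> \<in> X \<Longrightarrow> multiplicative_on (Gm r) Gm_mult \<xi>"
    using Y unfolding X_def multiplicative_combination_def by auto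
  have "multiplicative_combination (Gm r) Gm_mult X (\<lambda>s. \<phi> s $ a $ c)" for a c
    by (rule multiplicative_combination_mono[OF Y _ X(1)]) (use X(2) in \<open>auto simp: X_def\<close>)
  then have "\<exists>M. \<forall>s\<in>Gm r. \<phi> s $ a $ c = (\<Sum>\<xi>\<in>X. M \<xi> * \<xi> s)" for a c
    unfolding multiplicative_combination_def by blast
  then obtain M where M: "\<And>a c s. s \<in> Gm r \<Longrightarrow> \<phi> s $ a $ c = (\<Sum>\<xi>\<in>X. M a c \<xi> * \<xi> s)"
    by metis
  \<comment> \<open>Compare the coefficients of the characters of \<open>s\<close> in \<open>\<phi> (s' s) = \<phi> s' ** \<phi> s\<close>.\<close>
  have eigen: "(\<Sum>b\<in>UNIV. \<phi> s' $ a $ b * M b c \<xi>) = \<xi> s' * M a c \<xi>"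
    if s': "s' \<in> Gm r" and \<xi>: "\<xi> \<in> X" for s' :: "nat \<Rightarrow> 'k" and \<xi> a c
  proof -
    have "(\<Sum>b\<in>UNIV. \<phi> s' $ a $ b * M b c \<xi>) - \<xi> s' * M a c \<xi> = 0"
    proof (rule multiplicative_independent[OF X Gm_mult_closed,
          where c = "\<lambda>\<xi>. (\<Sum>b\<in>UNIV. \<phi> s' $ a $ b * M b c \<xi>) - \<xi> s' * M a c \<xi>"])
      fix s :: "nat \<Rightarrow> 'k" assume s: "s \<in> Gm r"
      have "(\<Sum>\<xi>\<in>X. (\<Sum>b\<in>UNIV. \<phi> s' $ a $ b * M b c \<xi>) * \<xi> s) =
          (\<Sum>b\<in>UNIV. \<phi> s' $ a $ b * \<phi> s $ b $ c)"
        by (simp add: M[OF s] sum_distrib_left sum_distrib_right mult.assoc) (rule sum.swap)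
      also have "\<dots> = \<phi> (Gm_mult s' s) $ a $ c"
        by (simp add: hom[OF s' s] matrix_entry_mult)
      also have "\<dots> = (\<Sum>\<xi>\<in>X. M a c \<xi> * (\<xi> s' * \<xi> s))"
        unfolding M[OF Gm_mult_closed[OF s' s]] using X(2) s s'
        by (auto intro!: sum.cong simp: multiplicative_on_def)
      finally show "(\<Sum>\<xi>\<in>X. ((\<Sum>b\<in>UNIV. \<phi> s' $ a $ b * M b c \<xi>) - \<xi> s' * M a c \<xi>) * \<xi> s) = 0"
        by (simp add: algebra_simps sum_subtractf)
    qed (use \<xi> in auto)
    then show ?thesis by simp
  qed
  define v where "v \<xi> c = (\<chi> a. M a c \<xi>)" for \<xi> c
  define E where "E = (\<lambda>(\<xi>, c). v \<xi> c) ` (X \<times> UNIV)"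
  let ?e = "\<lambda>_::nat. 1::'k"
  have one: "\<phi> ?e = mat 1"
  proof -
    have "\<phi> ?e \<in> SL" using bij SL Gm_one by (auto simp: bij_betw_def)
    then have "invertible (\<phi> ?e)" by (simp add: invertible_det_nz SL_def)
    then obtain A where "A ** \<phi> ?e = mat 1" by (auto simp: invertible_def)
    moreover have "\<phi> ?e ** \<phi> ?e = \<phi> ?e" using hom[OF Gm_one Gm_one] by simp
    ultimately show ?thesis by (metis matrix_mul_assoc matrix_mul_lid)
  qed
  have "axis c 1 \<in> vec.span E" for c
  proof -
    have "axis c 1 = (\<Sum>\<xi>\<in>X. \<xi> ?e *s v \<xi> c)"
      using M[OF Gm_one, of _ c]
      by (simp add: vec_eq_iff one v_def axis_def mat_def mult.commute)
    moreover have "v \<xi> c \<in> vec.span E" if "\<xi> \<in> X" for \<xi>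
      using that by (intro vec.span_base) (auto simp: E_def)
    ultimately show ?thesis
      by (simp add: vec.span_sum vec.span_scale)
  qed
  then have "cart_basis \<subseteq> vec.span E" by (auto simp: cart_basis_def)
  then have spanE: "vec.span E = UNIV"
    by (metis span_cart_basis top.extremum_uniqueI vec.span_minimal vec.subspace_span)
  obtain B where B: "B \<subseteq> E" "vec.independent B" "E \<subseteq> vec.span B"
    by (rule vec.maximal_independent_subset[of E])
  have spanB: "vec.span B = UNIV"
    using B(3) spanE by (metis top.extremum_uniqueI vec.span_minimal vec.subspace_span)
  have "card B = CARD('n)"
    using vec.dim_eq_card[of B UNIV] B(2) spanB vec_dim_card[where 'a = 'k and 'n = 'n] by simp
  moreover have "finite B" using B(2) by (rule vec.finiteI_independent)
  ultimately obtain b where b: "bij_betw b (UNIV :: 'n set) B"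
    using finite_same_card_bij[of "UNIV :: 'n set" B] by auto
  define H\<^sub>0 where "H\<^sub>0 = (\<chi> a j. b j $ a)"
  have "columns H\<^sub>0 = B"
    using b by (auto simp: columns_def column_def H\<^sub>0_def bij_betw_def)
  then obtain A where "H\<^sub>0 ** A = mat 1"
    using spanB matrix_right_invertible_span_columns[of H\<^sub>0] by auto
  then have d0: "det H\<^sub>0 \<noteq> 0"
    by (metis det_I det_mul mult_zero_left zero_neq_one)
  obtain k :: 'n where True by blast
  \<comment> \<open>Rescaling one eigenvector brings the determinant to 1.\<close>
  define c where "c j = (if j = k then inverse (det H\<^sub>0) else 1)" for j
  define H where "H = H\<^sub>0 ** diag_matrix c"
  have "det H = 1"
    using d0 by (simp add: H_def det_mul det_diag_matrix c_def)
  then obtain K where K: "H ** K = mat 1" "K ** H = mat 1"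
    using invertible_det_nz[of H] by (auto simp: invertible_def)
  have "det K = 1"
    using K(1) \<open>det H = 1\<close> by (metis det_I det_mul mult_1)
  have "(K ** g ** H) $ i $ j = 0" if g: "g \<in> R" and ij: "i \<noteq> j" for g i j
  proof -
    obtain s where s: "s \<in> Gm r" "g = \<phi> s" using bij g by (auto simp: bij_betw_def)
    have "b j \<in> E" using b B(1) by (auto simp: bij_betw_def)
    then obtain \<xi> e where \<xi>: "\<xi> \<in> X" "b j = v \<xi> e" by (auto simp: E_def)
    have "H $ a $ j = M a e \<xi> * c j" for a
      using \<xi>(2) by (simp add: H_def matrix_entry_mult monomial_matrix_def H\<^sub>0_def v_def
          if_distrib[of "\<lambda>x. _ * x"] cong: if_cong)
    then have "(g ** H) $ a $ j = \<xi> s * H $ a $ j" for a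
      using eigen[OF s(1) \<xi>(1), of a e]
      by (simp add: matrix_entry_mult s(2) mult.assoc[symmetric] sum_distrib_right[symmetric])
    then have "(K ** (g ** H)) $ i $ j = \<xi> s * (K ** H) $ i $ j"
      by (simp add: matrix_entry_mult[of K] sum_distrib_left mult.left_commute)
    then show ?thesis
      using ij by (simp add: K(2) matrix_mul_assoc mat_def)
  qed
  then show ?thesis
    using K \<open>det H = 1\<close> \<open>det K = 1\<close> by blast
qed

text \<open>The diagonal torus in the coordinates given by the columns of \<open>H\<close>, whose inverse is \<open>K\<close>.\<close>

definition diag_torus :: "'k::field ^ 'n ^ 'n \<Rightarrow> 'k ^ 'n ^ 'n \<Rightarrow> ('k ^ 'n ^ 'n) set" where
  "diag_torus H K = {g \<in> SL. \<forall>i j. i \<noteq> j \<longrightarrow> (K ** g ** H) $ i $ j = 0}"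

lemma diag_torus_eq:
  fixes H K :: "'k::field ^ 'n ^ 'n"
  assumes HK: "H ** K = mat 1" "K ** H = mat 1" "det H = 1" "det K = 1"
  shows "diag_torus H K = (\<lambda>c. H ** diag_matrix c ** K) ` {c. prod c UNIV = 1}"
proof (intro set_eqI iffI)
  fix g assume g: "g \<in> diag_torus H K"
  define c where "c i = (K ** g ** H) $ i $ i" for i
  have KgH: "K ** g ** H = diag_matrix c"
    using g by (auto simp: diag_torus_def c_def monomial_matrix_def vec_eq_iff)
  then have "g = H ** diag_matrix c ** K"
    using HK by (metis matrix_mul_assoc matrix_mul_lid matrix_mul_rid)
  moreover have "prod c UNIV = 1"
    using arg_cong[OF KgH, of det] g HK by (simp add: det_mul det_diag_matrix diag_torus_def SL_def)
  ultimately show "g \<in> (\<lambda>c. H ** diag_matrix c ** K) ` {c. prod c UNIV = 1}" by blast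
next
  fix g assume "g \<in> (\<lambda>c. H ** diag_matrix c ** K) ` {c. prod c UNIV = 1}"
  then obtain c where c: "g = H ** diag_matrix c ** K" "prod c UNIV = 1" by blast
  then have "K ** g ** H = diag_matrix c"
    using HK by (metis matrix_mul_assoc matrix_mul_lid matrix_mul_rid)
  then show "g \<in> diag_torus H K"
    using c HK by (auto simp: diag_torus_def SL_def det_mul det_diag_matrix) (simp add: monomial_matrix_def)
qed

text \<open>All diagonal entries but the last are free coordinates; the last one is the inverse of their
  product.\<close>

lemma torus_diag_torus:
  fixes H K :: "'k::field_char_0 ^ 'n ^ 'n"
  assumes HK: "H ** K = mat 1" "K ** H = mat 1" "det H = 1" "det K = 1"
  shows "torus (diag_torus H K)"
proof -
  define r where "r = CARD('n) - 1"
  have card: "CARD('n) = Suc r" by (simp add: r_def)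
  obtain \<beta> where \<beta>: "bij_betw \<beta> (UNIV :: 'n set) {..<Suc r}"
    using ex_bij_betw_finite_nat[of "UNIV :: 'n set"] by (auto simp: card atLeast0LessThan)
  define \<beta>' where "\<beta>' = inv_into UNIV \<beta>"
  have \<beta>_\<beta>': "\<beta> (\<beta>' j) = j" if "j < Suc r" for j
    using \<beta> that by (simp add: \<beta>'_def bij_betw_inv_into_right)
  have \<beta>'_\<beta>: "\<beta>' (\<beta> i) = i" for i
    using \<beta> by (simp add: \<beta>'_def bij_betw_inv_into_left)
  have \<beta>_less: "\<beta> i < Suc r" for i
    using \<beta> by (auto simp: bij_betw_def)
  define \<Lambda> where "\<Lambda> s i = (if \<beta> i < r then s (\<beta> i) else inverse (\<Prod>j<r. s j))"
    for s :: "nat \<Rightarrow> 'k" and i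
  have prod_\<beta>: "(\<Prod>i\<in>UNIV. f (\<beta> i)) = (\<Prod>j<r. f j) * f r" for f :: "nat \<Rightarrow> 'k"
    using prod.reindex_bij_betw[OF \<beta>, of f] by simp
  have nz: "(\<Prod>j<r. s j) \<noteq> 0" if "s \<in> Gm r" for s :: "nat \<Rightarrow> 'k"
    using that by (auto simp: Gm_def)
  have prod_\<Lambda>: "prod (\<Lambda> s) UNIV = 1" if "s \<in> Gm r" for s
    unfolding \<Lambda>_def using nz[OF that]
    by (subst prod_\<beta>[of "\<lambda>j. if j < r then s j else inverse (\<Prod>j<r. s j)"]) auto
  define \<phi> where "\<phi> s = H ** diag_matrix (\<Lambda> s) ** K" for s
  define \<psi> where "\<psi> g j = (if j < r then (K ** g ** H) $ \<beta>' j $ \<beta>' j else 1)" for g j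
  have K\<phi>H: "K ** \<phi> s ** H = diag_matrix (\<Lambda> s)" for s
    unfolding \<phi>_def using HK by (metis matrix_mul_assoc matrix_mul_lid matrix_mul_rid)
  have \<psi>\<phi>: "\<psi> (\<phi> s) = s" if "s \<in> Gm r" for s
    using that by (auto simp: \<psi>_def K\<phi>H monomial_matrix_def \<Lambda>_def \<beta>_\<beta>' Gm_def fun_eq_iff)
  have bij: "bij_betw \<phi> (Gm r) (diag_torus H K)"
  proof (rule bij_betw_byWitness[where f' = \<psi>])
    show "\<phi> ` Gm r \<subseteq> diag_torus H K"
      using prod_\<Lambda> by (auto simp: diag_torus_eq[OF HK] \<phi>_def)
    have *: "\<psi> g \<in> Gm r \<and> \<phi> (\<psi> g) = g" if "g \<in> diag_torus H K" for g
    proof -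
      obtain c where c: "g = H ** diag_matrix c ** K" "prod c UNIV = 1"
        using \<open>g \<in> diag_torus H K\<close> by (auto simp: diag_torus_eq[OF HK])
      have "K ** g ** H = diag_matrix c"
        unfolding c(1) using HK by (metis matrix_mul_assoc matrix_mul_lid matrix_mul_rid)
      then have \<psi>g: "\<psi> g j = (if j < r then c (\<beta>' j) else 1)" for j
        by (simp add: \<psi>_def monomial_matrix_def)
      have "c i \<noteq> 0" for i
        using c(2) by (metis UNIV_I finite prod_zero_iff zero_neq_one)
      then have "\<psi> g \<in> Gm r" by (simp add: \<psi>g Gm_def)
      moreover have "\<Lambda> (\<psi> g) i = c i" for i
      proof (cases "\<beta> i < r")
        case True
        then show ?thesis by (simp add: \<Lambda>_def \<psi>g \<beta>'_\<beta>)
      next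
        case False
        then have "\<beta>' r = i" using \<beta>_less[of i] \<beta>'_\<beta>[of i] by (simp add: less_Suc_eq)
        then have "(\<Prod>j<r. c (\<beta>' j)) * c i = 1"
          using prod_\<beta>[of "\<lambda>j. c (\<beta>' j)"] c(2) by (simp add: \<beta>'_\<beta>)
        then have "inverse (\<Prod>j<r. c (\<beta>' j)) = c i"
          by (rule inverse_unique)
        then show ?thesis using False by (simp add: \<Lambda>_def \<psi>g)
      qed
      then have "\<Lambda> (\<psi> g) = c" by (rule ext)
      ultimately show ?thesis by (simp add: \<phi>_def c(1))
    qed
    show "\<forall>g\<in>diag_torus H K. \<phi> (\<psi> g) = g" "\<psi> ` diag_torus H K \<subseteq> Gm r"
      using * by auto
  qed (use \<psi>\<phi> in auto)
  have hom: "\<phi> (Gm_mult s s') = \<phi> s ** \<phi> s'" for s s'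
  proof -
    have "diag_matrix (\<Lambda> (Gm_mult s s')) = diag_matrix (\<Lambda> s) ** diag_matrix (\<Lambda> s')"
      by (auto simp: vec_eq_iff matrix_entry_mult monomial_matrix_def \<Lambda>_def prod.distrib
          if_distrib[of "\<lambda>x. _ * x"] if_distrib[of "\<lambda>x. x * _"] cong: if_cong)
    then have "\<phi> (Gm_mult s s') = H ** diag_matrix (\<Lambda> s) ** mat 1 ** diag_matrix (\<Lambda> s') ** K"
      by (simp add: \<phi>_def matrix_mul_assoc)
    also have "\<dots> = \<phi> s ** \<phi> s'"
      unfolding \<phi>_def HK(2)[symmetric] by (simp only: matrix_mul_assoc)
    finally show ?thesis .
  qed
  have entry: "polynomial_in coords (\<lambda>g. (K ** g ** H) $ i $ j)" for i j
    by (intro polynomial_in_matrix_mult polynomial_in_const polynomial_in_entry)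
  have reg: "Gm_regular r (\<lambda>s. \<phi> s $ a $ c)" for a c
  proof -
    define F where "F s = (\<Sum>i\<in>UNIV. H $ a $ i *
        (if \<beta> i < r then s (\<beta> i) * (\<Prod>j<r. s j) else 1) * K $ i $ c)" for s
    have "polynomial_in (\<lambda>s. s) (\<lambda>s. if \<beta> i < r then s (\<beta> i) * (\<Prod>j<r. s j) else (1::'k))" for i
      by (cases "\<beta> i < r") (auto intro!: polynomial_in_mult polynomial_in_prod polynomial_in_const
          polynomial_in_coordinate)
    then have "polynomial_in (\<lambda>s. s) F"
      unfolding F_def by (intro polynomial_in_sum polynomial_in_mult polynomial_in_const)
    then obtain p where p: "\<And>s. F s = eval s p" by (auto simp: polynomial_in_def)
    have "\<phi> s $ a $ c = eval s p / (\<Prod>j<r. s j) ^ 1" if s: "s \<in> Gm r" for s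
    proof -
      have "\<phi> s $ a $ c = (\<Sum>i\<in>UNIV. H $ a $ i * \<Lambda> s i * K $ i $ c)"
        unfolding \<phi>_def by (simp add: matrix_entry_mult monomial_matrix_def
            if_distrib[of "\<lambda>x. _ * x"] cong: if_cong)
      also have "\<dots> = F s / (\<Prod>j<r. s j)"
        unfolding F_def sum_divide_distrib using nz[OF s]
        by (intro sum.cong) (auto simp: \<Lambda>_def field_simps)
      finally show ?thesis by (simp add: p)
    qed
    then show ?thesis unfolding Gm_regular_def by blast
  qed
  have coord: "\<exists>q. \<forall>s\<in>Gm r. s i = eval (coords (\<phi> s)) q" if "i < r" for i
  proof -
    obtain q where q: "\<And>g. (K ** g ** H) $ \<beta>' i $ \<beta>' i = eval (coords g) q"
      using entry[of "\<beta>' i" "\<beta>' i"] unfolding polynomial_in_def by blast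
    have "(K ** \<phi> s ** H) $ \<beta>' i $ \<beta>' i = s i" for s
      using that by (simp add: K\<phi>H monomial_matrix_def \<Lambda>_def \<beta>_\<beta>')
    then have "s i = eval (coords (\<phi> s)) q" for s
      unfolding q by (rule sym)
    then show ?thesis by blast
  qed
  have "SL_closed (diag_torus H K)"
  proof -
    have "\<forall>i j. \<exists>q. \<forall>g. (K ** g ** H) $ i $ j = eval (coords g) q"
      using entry unfolding polynomial_in_def by blast
    then obtain q where q: "\<And>i j g. (K ** g ** H) $ i $ j = eval (coords g) (q i j)"
      by metis
    show ?thesis
      unfolding SL_closed_def diag_torus_def
      by (rule exI[of _ "{q i j | i j. i \<noteq> j}"]) (auto simp: q)
  qed
  then show ?thesis
    unfolding torus_def using bij hom reg coord by blast
qed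

text \<open>A torus lies in the full diagonal torus of an eigenbasis, which is a torus itself; so a maximal one
  equals it.\<close>

lemma maximal_torus_eq_diag_torus:
  fixes R :: "('k::field_char_0 ^ 'n ^ 'n) set"
  assumes "maximal_torus R"
  obtains H K where "H ** K = mat 1" "K ** H = mat 1" "det H = 1" "det K = 1" "R = diag_torus H K"
proof -
  have "torus R" using assms by (simp add: maximal_torus_def)
  then obtain H K where HK: "H ** K = mat 1" "K ** H = mat 1" "det H = 1" "det K = 1"
    and diag: "\<forall>g\<in>R. \<forall>i j. i \<noteq> j \<longrightarrow> (K ** g ** H) $ i $ j = 0"
    using torus_diagonalisable[OF \<open>torus R\<close>] by (elim exE conjE) (rule that)
  have "R \<subseteq> SL" using \<open>torus R\<close> by (auto simp: torus_def SL_closed_def)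
  then have "R \<subseteq> diag_torus H K" using diag by (auto simp: diag_torus_def)
  then have "R = diag_torus H K"
    using assms torus_diag_torus[OF HK] by (auto simp: maximal_torus_def)
  then show thesis using that HK by blast
qed

section \<open>Weights of the exterior power\<close>

lemma polynomial_in_compose:
  assumes "\<And>i. polynomial_in C (\<lambda>x. C' (\<gamma> x) i)"
  shows "polynomial_in C (\<lambda>x. eval (C' (\<gamma> x)) p)"
  unfolding insertion_def
  by (intro polynomial_in_sum polynomial_in_mult polynomial_in_const polynomial_in_prod
      polynomial_in_power assms)

definition restrict_words :: "('n mon list \<Rightarrow> bool) \<Rightarrow> ('n, 'k::comm_ring_1) tens \<Rightarrow> ('n, 'k) tens" where
  "restrict_words P u = (\<Sum>w\<in>{w \<in> keys u. P w}. single w (lookup u w))"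

lemma lookup_restrict_words: "lookup (restrict_words P u) w = (if P w then lookup u w else 0)"
proof -
  have "lookup (restrict_words P u) w =
      (\<Sum>v\<in>{w \<in> keys u. P w}. if v = w then lookup u w else 0)"
    unfolding restrict_words_def lookup_sum by (intro sum.cong) (auto simp: lookup_single when_def)
  then show ?thesis by (auto simp: in_keys_iff)
qed

lemma sum_list_permute_list:
  fixes w :: "'a::comm_monoid_add list"
  assumes "\<sigma> permutes {..<length w}"
  shows "sum_list (permute_list \<sigma> w) = sum_list w"
  using mset_permute_list[OF assms] by (metis sum_mset_sum_list)

lemma alternating_restrict_words:
  assumes "alternating u"
  shows "alternating (restrict_words (\<lambda>w. P (sum_list w)) u)"
  using assms unfolding alternating_def by (simp add: lookup_restrict_words sum_list_permute_list)

lemma lookup_tens_act_diag_matrix: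
  fixes u :: "('n::finite, 'k::field) tens"
  shows "lookup (tens_act (diag_matrix c) u) w = monomial_value c (sum_list w) * lookup u w"
proof -
  have "map (Poly_Mapping.map_key (\<lambda>i. i)) w = w"
    by (rule map_idI) (auto intro!: poly_mapping_eqI simp: map_key.rep_eq)
  then show ?thesis
    using lookup_tens_act_monomial_matrix[of "\<lambda>i. i" c u w] by simp
qed

text \<open>A basis of determinant 1, formed by the columns of \<open>H\<close>, and its inverse \<open>K\<close>. Weights with respect
  to the torus of this frame are read off after applying \<open>K\<close>, which makes the torus diagonal.\<close>

locale torus_frame =
  fixes H K :: "'k::field_char_0 ^ 'n ^ 'n"
  assumes HK: "H ** K = mat 1" and KH: "K ** H = mat 1"
    and det_H: "det H = 1" and det_K: "det K = 1"
begin

abbreviation "T \<equiv> diag_torus H K"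

definition torus_elem :: "('n \<Rightarrow> 'k) \<Rightarrow> 'k ^ 'n ^ 'n" where
  "torus_elem c = H ** diag_matrix c ** K"

definition weight_char :: "'n mon \<Rightarrow> 'k ^ 'n ^ 'n \<Rightarrow> 'k" where
  "weight_char a g = (if g \<in> T then monomial_value (\<lambda>i. (K ** g ** H) $ i $ i) a else 0)"

lemma T_eq: "T = torus_elem ` {c. prod c UNIV = 1}"
  unfolding torus_elem_def by (rule diag_torus_eq[OF HK KH det_H det_K])

lemma torus_elem_conj: "K ** torus_elem c ** H = diag_matrix c"
  unfolding torus_elem_def using HK KH by (metis matrix_mul_assoc matrix_mul_lid matrix_mul_rid)

lemma torus_elem_mult: "torus_elem c ** torus_elem d = torus_elem (\<lambda>i. c i * d i)"
proof -
  have d: "diag_matrix c ** diag_matrix d = diag_matrix (\<lambda>i. c i * d i)"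
    by (auto simp: vec_eq_iff matrix_entry_mult monomial_matrix_def
        if_distrib[of "\<lambda>x. _ * x"] if_distrib[of "\<lambda>x. x * _"] cong: if_cong)
  have "torus_elem c ** torus_elem d = H ** diag_matrix c ** (K ** H) ** diag_matrix d ** K"
    by (simp add: torus_elem_def matrix_mul_assoc)
  also have "\<dots> = H ** (diag_matrix c ** diag_matrix d) ** K"
    by (simp add: KH matrix_mul_assoc)
  finally show ?thesis by (simp add: d torus_elem_def)
qed

lemma torus_elem_one: "torus_elem (\<lambda>_. 1) = mat 1"
proof -
  have "diag_matrix (\<lambda>_. 1) = (mat 1 :: 'k ^ 'n ^ 'n)"
    by (auto simp: vec_eq_iff monomial_matrix_def mat_def)
  then show ?thesis by (simp add: torus_elem_def HK)
qed

lemma T_mult: "g \<in> T \<Longrightarrow> h \<in> T \<Longrightarrow> g ** h \<in> T"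
  by (force simp: T_eq torus_elem_mult prod.distrib)

lemma mat_1_in_T: "mat 1 \<in> T"
  unfolding T_eq torus_elem_one[symmetric] by (rule imageI) simp

lemma weight_char_torus_elem: "prod c UNIV = 1 \<Longrightarrow> weight_char a (torus_elem c) = monomial_value c a"
  by (auto simp: weight_char_def torus_elem_conj monomial_matrix_def T_eq)

lemma weight_char_add: "weight_char (a + b) = (\<lambda>g. weight_char a g * weight_char b g)"
  by (auto simp: weight_char_def monomial_value_add)

lemma weight_char_mult:
  "g \<in> T \<Longrightarrow> h \<in> T \<Longrightarrow> weight_char a (g ** h) = weight_char a g * weight_char a h"
  by (auto simp: T_eq torus_elem_mult weight_char_torus_elem prod.distrib monomial_value_times)

lemma weight_char_nonzero: 
  assumes "g \<in> T" shows "weight_char a g \<noteq> 0"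
proof -
  obtain c where c: "prod c UNIV = 1" "g = torus_elem c" using assms by (auto simp: T_eq)
  then have "c i \<noteq> 0" for i by (metis UNIV_I finite prod_zero_iff zero_neq_one)
  then show ?thesis using c by (simp add: weight_char_torus_elem monomial_value_nonzero)
qed

lemma weight_char_in_characters: "weight_char a \<in> characters T"
proof -
  have "polynomial_in coords (\<lambda>g. monomial_value (\<lambda>i. (K ** g ** H) $ i $ i) a)"
    by (intro polynomial_in_monomial_value polynomial_in_matrix_mult polynomial_in_const polynomial_in_entry)
  then have "\<exists>p. \<forall>g\<in>T. weight_char a g = eval (coords g) p"
    by (simp add: polynomial_in_def weight_char_def) metis
  then show ?thesis
    by (simp add: characters_def weight_char_nonzero weight_char_mult) (simp add: weight_char_def)
qed

lemma characters_multiplicative: "\<xi> \<in> characters T \<Longrightarrow> multiplicative_on T (**) \<xi>"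
  unfolding characters_def multiplicative_on_def using mat_1_in_T by blast

text \<open>A character is a polynomial in the diagonal entries, that is, a linear combination of the
  characters \<open>weight_char a\<close>; by independence of characters it is one of them.\<close>

lemma characters_eq: "characters T = range weight_char"
proof (intro set_eqI iffI)
  fix \<xi> assume \<xi>: "\<xi> \<in> characters T"
  then obtain p where p: "\<And>g. g \<in> T \<Longrightarrow> \<xi> g = eval (coords g) p"
    by (auto simp: characters_def)
  have "polynomial_in (\<lambda>c. c) (\<lambda>c. torus_elem c $ i $ j)" for i j
  proof -
    have eq: "torus_elem c $ i $ j = (\<Sum>l\<in>UNIV. H $ i $ l * c l * K $ l $ j)" for c
      by (simp add: torus_elem_def matrix_entry_mult monomial_matrix_def
          if_distrib[of "\<lambda>x. _ * x"] cong: if_cong)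
    show ?thesis
      unfolding eq
      by (intro polynomial_in_sum polynomial_in_mult polynomial_in_const polynomial_in_coordinate)
  qed
  then have "polynomial_in (\<lambda>c. c) (\<lambda>c. coords (torus_elem c) ij)" for ij
    by (cases ij) simp
  then have "polynomial_in (\<lambda>c. c) (\<lambda>c. eval (coords (torus_elem c)) p)"
    by (rule polynomial_in_compose)
  then obtain q where q: "\<And>c. eval (coords (torus_elem c)) p = eval c q"
    by (auto simp: polynomial_in_def)
  have "\<xi> g = (\<Sum>a\<in>keys q. lookup q a * weight_char a g)" if g: "g \<in> T" for g
  proof -
    obtain c where c: "prod c UNIV = 1" "g = torus_elem c" using g by (auto simp: T_eq)
    have "\<xi> g = (\<Sum>a\<in>keys q. lookup q a * monomial_value c a)"
      unfolding p[OF g] unfolding c(2) q by (simp add: insertion_def monomial_value_def)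
    then show ?thesis by (simp add: c weight_char_torus_elem)
  qed
  moreover have "multiplicative_combination T (**) (weight_char ` keys q)
      (\<lambda>g. \<Sum>a\<in>keys q. lookup q a * weight_char a g)"
    by (rule multiplicative_combination_sum)
       (auto intro: characters_multiplicative weight_char_in_characters)
  ultimately obtain c where c: "\<And>g. g \<in> T \<Longrightarrow> \<xi> g = (\<Sum>\<psi>\<in>weight_char ` keys q. c \<psi> * \<psi> g)"
    unfolding multiplicative_combination_def by auto
  show "\<xi> \<in> range weight_char"
  proof (rule ccontr)
    let ?X = "weight_char ` keys q"
    assume "\<xi> \<notin> range weight_char"
    then have notin: "\<xi> \<notin> ?X" by auto
    have "(if \<xi> = \<xi> then - 1 else c \<xi>) = 0"
    proof (rule multiplicative_independent[of "insert \<xi> ?X" T "(**)" "\<lambda>\<psi>. if \<psi> = \<xi> then - 1 else c \<psi>" \<xi>])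
      fix g assume g: "g \<in> T"
      have "(\<Sum>\<psi>\<in>?X. (if \<psi> = \<xi> then - 1 else c \<psi>) * \<psi> g) = (\<Sum>\<psi>\<in>?X. c \<psi> * \<psi> g)"
        using notin by (intro sum.cong) auto
      then show "(\<Sum>\<psi>\<in>insert \<xi> ?X. (if \<psi> = \<xi> then - 1 else c \<psi>) * \<psi> g) = 0"
        using notin c[OF g] by simp
    qed (use \<xi> in \<open>auto intro: characters_multiplicative weight_char_in_characters T_mult\<close>)
    then show False by simp
  qed
qed (auto intro: weight_char_in_characters)

lemma tens_act_H_K: "tens_act H (tens_act K u) = u" for u :: "('n, 'k) tens"
  by (simp add: tens_act_compose HK)

lemma tens_act_K_H: "tens_act K (tens_act H u) = u" for u :: "('n, 'k) tens"
  by (simp add: tens_act_compose KH)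

lemma tens_act_K_inject: "tens_act K u = tens_act K v \<longleftrightarrow> u = v" for u v :: "('n, 'k) tens"
  by (metis tens_act_H_K)

lemma tens_act_torus_elem:
  "tens_act K (tens_act (torus_elem c) u) = tens_act (diag_matrix c) (tens_act K u)"
  for u :: "('n, 'k) tens"
proof -
  have "K ** torus_elem c = diag_matrix c ** K"
    by (simp add: torus_elem_def matrix_mul_assoc KH)
  then show ?thesis by (simp add: tens_act_compose)
qed

text \<open>After applying \<open>K\<close> the torus multiplies each word by its weight, so an eigenvector consists of words
  of one weight.\<close>

lemma weight_vector_iff:
  fixes u :: "('n, 'k) tens"
  assumes \<xi>: "\<xi> \<in> characters T"
  shows "(\<forall>g\<in>T. tens_act g u = pm_scale (\<xi> g) u) \<longleftrightarrow>
    (\<forall>w\<in>keys (tens_act K u). weight_char (sum_list w) = \<xi>)"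
proof -
  interpret K: Vector_Spaces.linear pm_scale pm_scale "tens_act K :: ('n, 'k) tens \<Rightarrow> _"
    by (rule linear_tens_act)
  have "(\<forall>g\<in>T. tens_act g u = pm_scale (\<xi> g) u) \<longleftrightarrow>
      (\<forall>c. prod c UNIV = 1 \<longrightarrow>
        tens_act (diag_matrix c) (tens_act K u) = pm_scale (\<xi> (torus_elem c)) (tens_act K u))"
    unfolding T_eq tens_act_torus_elem[symmetric] K.scale[symmetric]
    by (auto simp: tens_act_K_inject)
  also have "\<dots> \<longleftrightarrow> (\<forall>c w. prod c UNIV = 1 \<longrightarrow> w \<in> keys (tens_act K u) \<longrightarrow>
      weight_char (sum_list w) (torus_elem c) = \<xi> (torus_elem c))"
    by (auto simp: poly_mapping_eq_iff fun_eq_iff lookup_tens_act_diag_matrix weight_char_torus_elem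
        in_keys_iff)
  also have "\<dots> \<longleftrightarrow> (\<forall>w\<in>keys (tens_act K u). \<forall>g\<in>T. weight_char (sum_list w) g = \<xi> g)"
    by (auto simp: T_eq)
  also have "\<dots> \<longleftrightarrow> (\<forall>w\<in>keys (tens_act K u). weight_char (sum_list w) = \<xi>)"
  proof -
    have "\<xi> g = 0" "weight_char a g = 0" if "g \<notin> T" for a g
      using \<xi> that by (auto simp: characters_def weight_char_def)
    then show ?thesis by (metis ext)
  qed
  finally show ?thesis .
qed

lemma weight_decomposition_unique:
  fixes u :: "('n, 'k) tens"
  assumes "weight_decomposition T l m u c"
  shows "c \<xi> = tens_act H (restrict_words (\<lambda>w. weight_char (sum_list w) = \<xi>) (tens_act K u))"
proof -
  interpret K: Vector_Spaces.linear pm_scale pm_scale "tens_act K :: ('n, 'k) tens \<Rightarrow> _"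
    by (rule linear_tens_act)
  have fin: "finite {\<xi>. c \<xi> \<noteq> 0}" and u: "u = (\<Sum>\<xi> | c \<xi> \<noteq> 0. c \<xi>)"
    and zero: "\<And>\<xi>. \<xi> \<notin> characters T \<Longrightarrow> c \<xi> = 0"
    and ws: "\<And>\<xi>. \<xi> \<in> characters T \<Longrightarrow> c \<xi> \<in> weight_space T l m \<xi>"
    using assms by (auto simp: weight_decomposition_def)
  have supp: "lookup (tens_act K (c \<psi>)) w = 0" if "weight_char (sum_list w) \<noteq> \<psi>" for \<psi> w
  proof (cases "\<psi> \<in> characters T")
    case True
    then have "\<forall>w\<in>keys (tens_act K (c \<psi>)). weight_char (sum_list w) = \<psi>"
      using ws[OF True] by (subst weight_vector_iff[symmetric]) (auto simp: weight_space_def)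
    then show ?thesis using that by (auto simp: in_keys_iff)
  qed (simp add: zero K.zero)
  have "lookup (tens_act K u) w = lookup (tens_act K (c (weight_char (sum_list w)))) w" for w
  proof -
    let ?\<psi> = "weight_char (sum_list w)"
    have "lookup (tens_act K u) w = (\<Sum>\<psi> | c \<psi> \<noteq> 0. lookup (tens_act K (c \<psi>)) w)"
      by (subst u) (simp add: K.sum lookup_sum)
    also have "\<dots> = (\<Sum>\<psi> | c \<psi> \<noteq> 0. if \<psi> = ?\<psi> then lookup (tens_act K (c ?\<psi>)) w else 0)"
      by (intro sum.cong) (auto simp: supp)
    also have "\<dots> = lookup (tens_act K (c ?\<psi>)) w"
      using fin by (auto simp: K.zero)
    finally show ?thesis .
  qed
  then have "tens_act K (c \<xi>) = restrict_words (\<lambda>w. weight_char (sum_list w) = \<xi>) (tens_act K u)"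
    by (intro poly_mapping_eqI) (auto simp: lookup_restrict_words supp)
  then show ?thesis by (metis tens_act_H_K)
qed

text \<open>The part of an alternating tensor carried by the words of one weight is again alternating, as the
  weight does not depend on the order of the letters. So the parts lie in the exterior power and form
  the weight decomposition.\<close>

lemma state_wedge:
  fixes fs :: "('n, 'k) pol list"
  assumes fs: "set fs \<subseteq> homog (int m)" "length fs = l"
  shows "state T l m (wedge fs) = (\<lambda>w. weight_char (sum_list w)) ` keys (tens_act K (wedge fs))"
proof -
  define u where "u = wedge fs"
  interpret H: Vector_Spaces.linear pm_scale pm_scale "tens_act H :: ('n, 'k) tens \<Rightarrow> _"
    by (rule linear_tens_act)
  let ?W = "(\<lambda>w. weight_char (sum_list w)) ` keys (tens_act K u)"
  define r where "r \<xi> = restrict_words (\<lambda>w. weight_char (sum_list w) = \<xi>) (tens_act K u)" for \<xi>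
  define D where "D \<xi> = tens_act H (r \<xi>)" for \<xi>
  have KD: "tens_act K (D \<xi>) = r \<xi>" for \<xi>
    by (simp add: D_def tens_act_K_H)
  have D_nz: "D \<xi> \<noteq> 0 \<longleftrightarrow> \<xi> \<in> ?W" for \<xi>
  proof -
    have "D \<xi> \<noteq> 0 \<longleftrightarrow> r \<xi> \<noteq> 0"
      using KD[of \<xi>] tens_act_K_H[of 0] by (auto simp: D_def H.zero)
    also have "\<dots> \<longleftrightarrow> (\<exists>w. lookup (r \<xi>) w \<noteq> 0)"
      by (auto simp: poly_mapping_eq_iff fun_eq_iff)
    also have "\<dots> \<longleftrightarrow> \<xi> \<in> ?W"
      by (auto simp: r_def lookup_restrict_words in_keys_iff)
    finally show ?thesis .
  qed
  have Ku: "tens_act K u = wedge (map (subst_act K) fs)"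
    by (simp add: u_def tens_act_wedge)
  have Kfs: "set (map (subst_act K) fs) \<subseteq> homog (int m)"
    using fs(1) by (auto intro!: homog_subst_act)
  have "D \<xi> \<in> ext_power l (piece UNIV m)" for \<xi>
    unfolding D_def
  proof (intro tens_act_ext_power alternating_imp_ext_power conjI ballI)
    show "alternating (r \<xi>)"
      unfolding r_def Ku by (rule alternating_restrict_words[OF alternating_wedge])
    fix w assume "w \<in> keys (r \<xi>)"
    then have "w \<in> keys (wedge (map (subst_act K) fs))"
      by (auto simp: r_def Ku in_keys_iff lookup_restrict_words split: if_splits)
    from wedge_words[OF Kfs this] show "length w = l" "\<And>t. t \<in> set w \<Longrightarrow> mdeg t = m"
      using fs(2) by auto
  qed
  moreover have "\<forall>g\<in>T. tens_act g (D \<xi>) = pm_scale (\<xi> g) (D \<xi>)" if "\<xi> \<in> characters T" for \<xi>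
    by (subst weight_vector_iff[OF that])
       (auto simp: KD r_def in_keys_iff lookup_restrict_words split: if_splits)
  moreover have "D \<xi> = 0" if "\<xi> \<notin> characters T" for \<xi>
    using D_nz[of \<xi>] that weight_char_in_characters by auto
  moreover have supp: "{\<xi>. D \<xi> \<noteq> 0} = ?W"
    using D_nz by auto
  moreover have "u = (\<Sum>\<xi>\<in>?W. D \<xi>)"
  proof -
    have "tens_act K u = (\<Sum>\<xi>\<in>?W. r \<xi>)"
    proof (rule poly_mapping_eqI)
      fix w
      have "lookup (\<Sum>\<xi>\<in>?W. r \<xi>) w =
          (\<Sum>\<xi>\<in>?W. if \<xi> = weight_char (sum_list w) then lookup (tens_act K u) w else 0)"
        unfolding lookup_sum r_def lookup_restrict_words by (intro sum.cong) auto
      then show "lookup (tens_act K u) w = lookup (\<Sum>\<xi>\<in>?W. r \<xi>) w"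
        by (auto simp: in_keys_iff)
    qed
    then have "tens_act H (tens_act K u) = (\<Sum>\<xi>\<in>?W. D \<xi>)"
      unfolding D_def H.sum[symmetric] by (rule arg_cong)
    then show ?thesis by (simp add: tens_act_H_K)
  qed
  ultimately have dec: "weight_decomposition T l m u D"
    unfolding weight_decomposition_def weight_space_def by auto
  have "(THE c. weight_decomposition T l m u c) = D"
  proof (rule the_equality)
    show "weight_decomposition T l m u D" by (rule dec)
    fix c assume "weight_decomposition T l m u c"
    from weight_decomposition_unique[OF this] show "c = D"
      by (intro ext) (simp add: D_def r_def)
  qed
  then have "state T l m u = {\<xi> \<in> characters T. \<xi> \<in> ?W}"
    unfolding state_def using D_nz by simp
  also have "\<dots> = ?W"
    using weight_char_in_characters by auto
  finally show ?thesis by (simp add: u_def)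
qed

end

section \<open>The generic state\<close>

text \<open>The words that occur in at least one translate of \<open>v\<close>. By irreducibility of the group these are the
  words that occur in a generic translate, and the definition avoids choosing one.\<close>

definition generic_words :: "('n::finite, 'k::field) tens \<Rightarrow> 'n mon list set" where
  "generic_words v = (\<Union>g\<in>SL. keys (tens_act g v))"

lemma SL_mult: "g \<in> SL \<Longrightarrow> h \<in> SL \<Longrightarrow> g ** h \<in> SL"
  by (simp add: SL_def det_mul)

lemma generic_words_wedge:
  fixes fs :: "('n::finite, 'k::field) pol list"
  assumes "set fs \<subseteq> homog (int m)" "w \<in> generic_words (wedge fs)"
  shows "length w = length fs" "\<And>t. t \<in> set w \<Longrightarrow> mdeg t = m"
proof -
  obtain g where w: "w \<in> keys (wedge (map (subst_act g) fs))"
    using assms(2) by (auto simp: generic_words_def tens_act_wedge)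
  have "set (map (subst_act g) fs) \<subseteq> homog (int m)"
    using assms(1) by (auto intro!: homog_subst_act)
  from wedge_words[OF this w] show "length w = length fs" "\<And>t. t \<in> set w \<Longrightarrow> mdeg t = m"
    by auto
qed

lemma finite_generic_words:
  fixes fs :: "('n::finite, 'k::field) pol list"
  assumes "set fs \<subseteq> homog (int m)"
  shows "finite (generic_words (wedge fs))"
proof (rule finite_subset)
  show "generic_words (wedge fs) \<subseteq> {w. set w \<subseteq> {t. mdeg t = m} \<and> length w = length fs}"
    using generic_words_wedge[OF assms] by auto
qed (intro finite_lists_length_eq finite_monomials_of_degree)

lemma SL_open_meet:
  fixes U V :: "('k::field_char_0 ^ 'n ^ 'n) set"
  assumes "SL_open U" "U \<noteq> {}" "SL_open V" "V \<noteq> {}"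
  shows "U \<inter> V \<noteq> {}"
proof -
  have eq: "\<exists>P. U = {g \<in> SL. \<exists>p\<in>P. eval (coords g) p \<noteq> 0}" if U: "SL_open U"
    for U :: "('k ^ 'n ^ 'n) set"
  proof -
    obtain P where "SL - U = {g \<in> SL. \<forall>p\<in>P. eval (coords g) p = 0}" "U \<subseteq> SL"
      using U by (auto simp: SL_open_def SL_closed_def)
    then have "U = {g \<in> SL. \<exists>p\<in>P. eval (coords g) p \<noteq> 0}" by blast
    then show ?thesis by blast
  qed
  obtain P where P: "U = {g \<in> SL. \<exists>p\<in>P. eval (coords g) p \<noteq> 0}"
    using eq[OF assms(1)] by blast
  obtain Q where Q: "V = {g \<in> SL. \<exists>p\<in>Q. eval (coords g) p \<noteq> 0}"
    using eq[OF assms(3)] by blast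
  obtain g\<^sub>1 p where p: "g\<^sub>1 \<in> SL" "p \<in> P" "eval (coords g\<^sub>1) p \<noteq> 0" using assms(2) P by auto
  obtain g\<^sub>2 q where q: "g\<^sub>2 \<in> SL" "q \<in> Q" "eval (coords g\<^sub>2) q \<noteq> 0" using assms(4) Q by auto
  have poly: "polynomial_in coords (\<lambda>g. eval (coords g) p)" for p :: "('n \<times> 'n, 'k) pol"
    unfolding polynomial_in_def by blast
  obtain g where "g \<in> SL" "eval (coords g) p \<noteq> 0" "eval (coords g) q \<noteq> 0"
    using SL_irreducible[where p = "\<lambda>g. eval (coords g) p" and q = "\<lambda>g. eval (coords g) q",
        OF poly poly p(1,3) q(1,3)] by blast
  then show ?thesis using P Q p(2) q(2) by blast
qed

context torus_frame
begin

text \<open>Each of the finitely many generic words occurs in \<open>K ** g\<close> applied to \<open>v\<close> for all \<open>g\<close> in a nonempty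
  open set. These open sets have a common point by irreducibility, and two open sets on which the
  state is constant meet, so the constant is unique.\<close>

lemma generic_state_wedge:
  fixes fs :: "('n, 'k) pol list"
  assumes fs: "set fs \<subseteq> homog (int m)" "length fs = l"
  shows "generic_state T l m (wedge fs) =
    (\<lambda>w. weight_char (sum_list w)) ` generic_words (wedge fs)"
proof -
  define v where "v = wedge fs"
  let ?G = "generic_words v"
  have fin: "finite ?G" using finite_generic_words[OF fs(1)] by (simp add: v_def)
  have HK_SL: "H \<in> SL" "K \<in> SL" by (auto simp: SL_def det_H det_K)
  define p where "p w g = lookup (tens_act (K ** g) v) w" for w g
  have poly: "polynomial_in coords (p w)" for w
    unfolding p_def
    by (intro polynomial_in_tens_act polynomial_in_matrix_mult polynomial_in_const polynomial_in_entry)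
  define U where "U = {g \<in> SL. \<forall>w\<in>?G. p w g \<noteq> 0}"
  have "\<exists>g\<in>SL. \<forall>w\<in>?G. p w g \<noteq> 0"
  proof (rule SL_irreducible_prod[OF fin poly])
    fix w assume "w \<in> ?G"
    then obtain g where g: "g \<in> SL" "lookup (tens_act g v) w \<noteq> 0"
      by (auto simp: generic_words_def in_keys_iff)
    have "K ** (H ** g) = g" by (simp add: matrix_mul_assoc KH)
    then show "\<exists>g\<in>SL. p w g \<noteq> 0"
      using g HK_SL SL_mult by (metis p_def)
  qed
  then have U: "U \<noteq> {}" by (auto simp: U_def)
  have "SL_open U"
  proof -
    obtain q where q: "\<And>g. (\<Prod>w\<in>?G. p w g) = eval (coords g) q"
      using polynomial_in_prod[of ?G coords p, OF poly] unfolding polynomial_in_def by blast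
    have "SL - U = {g \<in> SL. \<forall>q\<in>{q}. eval (coords g) q = 0}"
      using fin by (auto simp: U_def q[symmetric])
    then show ?thesis
      unfolding SL_open_def SL_closed_def by (auto simp: U_def)
  qed
  moreover have state_U: "state T l m (tens_act g v) = (\<lambda>w. weight_char (sum_list w)) ` ?G"
    if "g \<in> U" for g
  proof -
    have g: "g \<in> SL" using that by (simp add: U_def)
    have "state T l m (tens_act g v) =
        (\<lambda>w. weight_char (sum_list w)) ` keys (tens_act K (tens_act g v))"
      unfolding v_def tens_act_wedge[of g] using fs
      by (intro state_wedge) (auto intro!: homog_subst_act)
    also have "keys (tens_act K (tens_act g v)) = ?G"
      using that SL_mult[OF HK_SL(2) g]
      by (auto simp: tens_act_compose generic_words_def U_def p_def in_keys_iff)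
    finally show ?thesis .
  qed
  ultimately have "generic_state T l m v = (\<lambda>w. weight_char (sum_list w)) ` ?G"
    unfolding generic_state_def
  proof (intro the_equality)
    fix \<Xi> assume "\<exists>V. SL_open V \<and> V \<noteq> {} \<and> (\<forall>g\<in>V. state T l m (tens_act g v) = \<Xi>)"
    then obtain V where V: "SL_open V" "V \<noteq> {}" "\<forall>g\<in>V. state T l m (tens_act g v) = \<Xi>"
      by blast
    obtain g where "g \<in> U" "g \<in> V"
      using SL_open_meet[OF \<open>SL_open U\<close> U V(1,2)] by blast
    then show "\<Xi> = (\<lambda>w. weight_char (sum_list w)) ` ?G"
      using V(3) state_U by metis
  qed (use U in blast)
  then show ?thesis by (simp add: v_def)
qed

text \<open>The images of the diagonal entries, which span the character space; as the determinant is 1, they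
  add up to zero.\<close>

definition coordinate_char :: "(('k ^ 'n ^ 'n \<Rightarrow> 'k) \<Rightarrow> 'v::euclidean_space) \<Rightarrow> 'n \<Rightarrow> 'v" where
  "coordinate_char \<iota> i = \<iota> (weight_char (single i 1))"

lemma real_characters_weight_char:
  fixes \<iota> :: "('k ^ 'n ^ 'n \<Rightarrow> 'k) \<Rightarrow> 'v::euclidean_space"
  assumes "real_characters T \<iota>"
  shows "\<iota> (weight_char a) = (\<Sum>i\<in>UNIV. real (lookup a i) *\<^sub>R coordinate_char \<iota> i)"
proof -
  have add: "\<iota> (weight_char (a + b)) = \<iota> (weight_char a) + \<iota> (weight_char b)" for a b
    using assms weight_char_in_characters unfolding real_characters_def weight_char_add by blast
  have zero: "\<iota> (weight_char 0) = 0" using add[of 0 0] by simp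
  have single: "\<iota> (weight_char (single i n)) = real n *\<^sub>R coordinate_char \<iota> i" for i n
  proof (induction n)
    case (Suc n)
    have "single i (Suc n) = single i 1 + single i n" by (simp add: single_add[symmetric])
    then show ?case
      using Suc by (simp add: add coordinate_char_def scaleR_left_distrib)
  qed (simp add: zero)
  have sum: "\<iota> (weight_char (\<Sum>i\<in>A. f i)) = (\<Sum>i\<in>A. \<iota> (weight_char (f i)))" for f and A :: "'n set"
    by (induction A rule: infinite_finite_induct) (auto simp: zero add)
  have "\<iota> (weight_char a) = \<iota> (weight_char (\<Sum>i\<in>UNIV. single i (lookup a i)))"
    by (simp add: poly_mapping_sum_single)
  then show ?thesis by (simp only: sum single)
qed

lemma sum_coordinate_char:
  fixes \<iota> :: "('k ^ 'n ^ 'n \<Rightarrow> 'k) \<Rightarrow> 'v::euclidean_space"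
  assumes "real_characters T \<iota>"
  shows "(\<Sum>i\<in>UNIV. coordinate_char \<iota> i) = 0"
proof -
  define a :: "'n mon" where "a = (\<Sum>i\<in>UNIV. single i 1)"
  have a: "lookup a i = 1" for i
    by (simp add: a_def lookup_sum lookup_single when_def)
  have "weight_char a g = weight_char 0 g" for g
  proof (cases "g \<in> T")
    case True
    then show ?thesis
      by (auto simp: T_eq weight_char_torus_elem monomial_value_UNIV a)
  qed (simp add: weight_char_def)
  then have "weight_char a = weight_char 0" by (rule ext)
  then have "\<iota> (weight_char a) = 0"
    using real_characters_weight_char[OF assms, of 0] by simp
  then show ?thesis
    using real_characters_weight_char[OF assms, of a] by (simp add: a)
qed

lemma span_characters:
  fixes \<iota> :: "('k ^ 'n ^ 'n \<Rightarrow> 'k) \<Rightarrow> 'v::euclidean_space"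
  assumes "real_characters T \<iota>"
  shows "span (\<iota> ` characters T) = span (range (coordinate_char \<iota>))"
proof (rule subset_antisym)
  have "\<iota> (weight_char a) \<in> span (range (coordinate_char \<iota>))" for a
    unfolding real_characters_weight_char[OF assms]
    by (intro span_sum span_scale span_base rangeI)
  then show "span (\<iota> ` characters T) \<subseteq> span (range (coordinate_char \<iota>))"
    by (intro span_minimal) (auto simp: characters_eq)
  show "span (range (coordinate_char \<iota>)) \<subseteq> span (\<iota> ` characters T)"
    by (rule span_mono) (auto simp: coordinate_char_def characters_eq)
qed

end

section \<open>Symmetry of the generic weights\<close>

lemma det_signed_swap:
  fixes i j :: "'n::finite"
  assumes "i \<noteq> j"
  shows "det (monomial_matrix (Transposition.transpose i j) (\<lambda>b. if b = i then - 1 else 1)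
    :: 'k::comm_ring_1 ^ 'n ^ 'n) = 1"
proof -
  let ?\<pi> = "Transposition.transpose i j" and ?c = "\<lambda>b. if b = i then - 1 else (1 :: 'k)"
  have perm: "?\<pi> permutes UNIV" by (rule permutes_swap_id) auto
  have "monomial_matrix ?\<pi> ?c = (\<chi> a. diag_matrix ?c $ ?\<pi> a)"
    by (auto simp: vec_eq_iff monomial_matrix_def Transposition.transpose_def)
  then have "det (monomial_matrix ?\<pi> ?c) = of_int (sign ?\<pi>) * det (diag_matrix ?c)"
    by (simp only: det_permute_rows[OF perm])
  also have "det (diag_matrix ?c) = - 1"
    by (subst det_diagonal) (auto simp: monomial_matrix_def)
  finally show ?thesis using assms by (simp add: sign_swap_id)
qed

definition swap_exponents :: "'n \<Rightarrow> 'n \<Rightarrow> 'n mon \<Rightarrow> 'n mon" where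
  "swap_exponents i j = Poly_Mapping.map_key (Transposition.transpose i j)"

lemma lookup_swap_exponents:
  "lookup (swap_exponents i j t) b = lookup t (Transposition.transpose i j b)"
  by (simp add: swap_exponents_def map_key.rep_eq)

lemma swap_exponents_sum_list:
  "sum_list (map (swap_exponents i j) w) = swap_exponents i j (sum_list w)"
  by (induction w)
     (auto intro!: poly_mapping_eqI simp: lookup_swap_exponents lookup_add)

text \<open>The generic words are permuted by the Weyl group, because the group element may be replaced by
  its product with a signed permutation matrix.\<close>

lemma generic_words_swap:
  fixes v :: "('n::finite, 'k::field) tens"
  assumes "i \<noteq> j" "w \<in> generic_words v"
  shows "map (swap_exponents i j) w \<in> generic_words v"
proof -
  let ?c = "\<lambda>b. if b = i then - 1 else (1 :: 'k)"
  let ?s = "monomial_matrix (Transposition.transpose i j) ?c"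
  obtain g where g: "g \<in> SL" "lookup (tens_act g v) w \<noteq> 0"
    using assms(2) by (auto simp: generic_words_def in_keys_iff)
  have "?s \<in> SL" using det_signed_swap[OF assms(1)] by (simp add: SL_def)
  then have "?s ** g \<in> SL" using g(1) by (rule SL_mult)
  moreover have "monomial_value ?c (sum_list w) \<noteq> 0" by (rule monomial_value_nonzero) auto
  then have "lookup (tens_act (?s ** g) v) (map (swap_exponents i j) w) \<noteq> 0"
    using g(2) by (simp add: tens_act_compose[symmetric] swap_exponents_def
        lookup_tens_act_monomial_matrix)
  ultimately show ?thesis by (auto simp: generic_words_def in_keys_iff)
qed


section \<open>Convex hulls of symmetric sets of weights\<close>

text \<open>The barycentre of the symmetric set \<open>A\<close> is the origin, since all coordinates of \<open>sum A\<close> agree.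
  Hence a linear functional that is nonnegative on the hull vanishes on it, so that the origin lies
  in the relative interior. A nonconstant exponent vector and its transposes differ by multiples of
  differences \<open>E i - E j\<close>, which yield all such differences; summing over \<open>j\<close> yields multiples of
  the \<open>E i\<close>, so that the hull spans the same space as the \<open>E i\<close>.\<close>

lemma zero_in_interior_symmetric_hull:
  fixes E :: "'n::finite \<Rightarrow> 'v::euclidean_space" and A :: "'n mon set"
  defines "pt \<equiv> \<lambda>a. \<Sum>i\<in>UNIV. real (lookup a i) *\<^sub>R E i"
  assumes A: "finite A" "A \<noteq> {}"
    and swap: "\<And>a i j. a \<in> A \<Longrightarrow> i \<noteq> j \<Longrightarrow> swap_exponents i j a \<in> A"
    and E: "(\<Sum>i\<in>UNIV. E i) = 0"
    and nonconst: "CARD('n) > 1 \<Longrightarrow> \<exists>a\<in>A. \<exists>i j. lookup a i \<noteq> lookup a j"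
  shows "0 \<in> top_of_set (span (range E)) interior_of (convex hull (pt ` A))"
proof -
  define C where "C = convex hull (pt ` A)"
  have swap2: "swap_exponents i j (swap_exponents i j a) = a" for i j and a :: "'n mon"
    by (intro poly_mapping_eqI) (simp add: lookup_swap_exponents)
  have sum0: "(\<Sum>a\<in>A. pt a) = 0"
  proof -
    define s where "s i = (\<Sum>a\<in>A. real (lookup a i))" for i
    have s: "s i = s j" for i j
    proof (cases "i = j")
      case False
      show ?thesis unfolding s_def
        by (rule sum.reindex_bij_witness[where i = "swap_exponents i j" and j = "swap_exponents i j"])
           (auto simp: swap2 swap False lookup_swap_exponents)
    qed simp
    obtain k :: 'n where True by blast
    have "(\<Sum>a\<in>A. pt a) = (\<Sum>i\<in>UNIV. s i *\<^sub>R E i)"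
      unfolding pt_def s_def by (subst sum.swap) (simp add: scaleR_sum_left)
    also have "\<dots> = s k *\<^sub>R (\<Sum>i\<in>UNIV. E i)"
      unfolding scaleR_sum_right by (intro sum.cong refl arg_cong2[where f = scaleR] s)
    finally show ?thesis by (simp add: E)
  qed
  have ptC: "pt a \<in> C" if "a \<in> A" for a
    unfolding C_def using that by (intro hull_inc) auto
  have zeroC: "0 \<in> C"
  proof -
    have "(\<Sum>a\<in>A. (1 / real (card A)) *\<^sub>R pt a) \<in> C"
      by (rule convex_sum) (use A ptC in \<open>auto simp: C_def convex_convex_hull\<close>)
    then show ?thesis by (simp add: scaleR_sum_right[symmetric] sum0)
  qed
  have convC: "convex C" by (simp add: C_def convex_convex_hull)
  have ri: "0 \<in> rel_interior C"
  proof (rule ccontr)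
    assume "0 \<notin> rel_interior C"
    then obtain f where f: "\<And>y. y \<in> C \<Longrightarrow> f \<bullet> 0 \<le> f \<bullet> y"
      "\<And>y. y \<in> rel_interior C \<Longrightarrow> f \<bullet> 0 < f \<bullet> y"
      using supporting_hyperplane_rel_boundary[OF convC zeroC] by metis
    have "(\<Sum>a\<in>A. f \<bullet> pt a) = 0"
      by (simp add: inner_sum_right[symmetric] sum0)
    then have "\<forall>a\<in>A. f \<bullet> pt a = 0"
      using f(1) ptC A(1) by (subst (asm) sum_nonneg_eq_0_iff) auto
    then have "C \<subseteq> {y. f \<bullet> y = 0}"
      unfolding C_def by (intro hull_minimal convex_hyperplane) auto
    moreover have "rel_interior C \<noteq> {}"
      using rel_interior_eq_empty[OF convC] zeroC by auto
    ultimately show False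
      using f(2) rel_interior_subset[of C] by fastforce
  qed
  have aff: "affine hull C = span (pt ` A)"
  proof -
    have "affine hull C = affine hull (pt ` A)"
      by (simp add: C_def)
    moreover have "0 \<in> affine hull C" using zeroC by (rule hull_inc)
    ultimately show ?thesis using affine_hull_span_0[of "pt ` A"] by simp
  qed
  have E_in: "E k \<in> span (pt ` A)" for k
  proof (cases "CARD('n) > 1")
    case False
    have "CARD('n) > 0" by (rule zero_less_card_finite)
    then have "CARD('n) = 1" using False by linarith
    then obtain x where "(UNIV :: 'n set) = {x}" by (auto simp: card_1_singleton_iff)
    then have "E k = 0" using E by (metis (full_types) UNIV_I singletonD sum.neutral_const sum.insert
          finite.emptyI empty_iff sum.empty add.right_neutral)
    then show ?thesis by (simp add: span_zero)
  next
    case True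
    then obtain a i j where a: "a \<in> A" "lookup a i \<noteq> lookup a j" using nonconst by blast
    have diff: "E p - E q \<in> span (pt ` A)" if pq: "lookup a p \<noteq> lookup a q" for p q
    proof -
      have ne: "p \<noteq> q" using pq by auto
      have "pt a - pt (swap_exponents p q a) =
          (\<Sum>i\<in>UNIV. (real (lookup a i) - real (lookup a (Transposition.transpose p q i))) *\<^sub>R E i)"
        by (simp add: pt_def lookup_swap_exponents sum_subtractf scaleR_left_diff_distrib)
      also have "\<dots> = (\<Sum>i\<in>{p, q}. (real (lookup a i) - real (lookup a (Transposition.transpose p q i))) *\<^sub>R E i)"
        by (rule sum.mono_neutral_right) (auto simp: Transposition.transpose_def)
      also have "\<dots> = (real (lookup a p) - real (lookup a q)) *\<^sub>R (E p - E q)"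
        using ne by (simp add: algebra_simps)
      finally have "(real (lookup a p) - real (lookup a q)) *\<^sub>R (E p - E q) \<in> span (pt ` A)"
        using a(1) swap[OF a(1) ne] by (metis span_base span_diff imageI)
      then have "inverse (real (lookup a p) - real (lookup a q)) *\<^sub>R
          (real (lookup a p) - real (lookup a q)) *\<^sub>R (E p - E q) \<in> span (pt ` A)"
        by (rule span_scale)
      then show ?thesis using pq by simp
    qed
    have "E k - E b \<in> span (pt ` A)" for b
    proof (cases "lookup a k = lookup a b")
      case False
      then show ?thesis by (rule diff)
    next
      case same: True
      \<comment> \<open>Equal exponents at \<open>k\<close> and \<open>b\<close> are compared through a third index.\<close>
      obtain c where c: "lookup a c \<noteq> lookup a k"
        using a(2) by metis
      then have "(E k - E c) - (E b - E c) \<in> span (pt ` A)"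
        using same by (intro span_diff diff) auto
      then show ?thesis by simp
    qed
    then have "(\<Sum>b\<in>UNIV. E k - E b) \<in> span (pt ` A)"
      by (intro span_sum)
    also have "(\<Sum>b\<in>UNIV. E k - E b) = real (CARD('n)) *\<^sub>R E k"
      by (simp add: sum_subtractf E sum_constant_scaleR)
    finally have "inverse (real CARD('n)) *\<^sub>R real (CARD('n)) *\<^sub>R E k \<in> span (pt ` A)"
      by (rule span_scale)
    then show ?thesis by simp
  qed
  have "span (pt ` A) = span (range E)"
  proof (rule subset_antisym)
    have "pt a \<in> span (range E)" for a
      unfolding pt_def by (intro span_sum span_scale span_base rangeI)
    then show "span (pt ` A) \<subseteq> span (range E)"
      by (intro span_minimal) auto
    show "span (range E) \<subseteq> span (pt ` A)"
      using E_in by (intro span_minimal) auto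
  qed
  then show ?thesis
    using ri aff unfolding interior_of_def rel_interior_def C_def by auto
qed


section \<open>Spaces of forms with a single generic weight\<close>

lemma ex_in_keys: "p \<noteq> 0 \<Longrightarrow> \<exists>t. t \<in> keys p"
  by (metis in_keys_iff lookup_zero poly_mapping_eqI)

text \<open>An independent set in a span that is as large as the generating set spans the same space.\<close>

lemma span_eq_if_card_le:
  assumes "pm.independent S" "S \<subseteq> pm.span V" "finite V" "card V \<le> card S"
  shows "pm.span V \<subseteq> pm.span S"
proof
  fix x assume x: "x \<in> pm.span V"
  show "x \<in> pm.span S"
  proof (rule ccontr)
    assume "x \<notin> pm.span S"
    then have "pm.independent (insert x S)" "x \<notin> S"
      using assms(1) by (rule pm.independent_insertI, use \<open>x \<notin> pm.span S\<close> pm.span_base in blast)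
    moreover have "insert x S \<subseteq> pm.span V" using assms(2) x by auto
    ultimately have "finite (insert x S)" "card (insert x S) \<le> card V"
      using pm.independent_span_bound[OF assms(3), of "insert x S"] by auto
    then show False using assms(4) \<open>x \<notin> S\<close> by (simp add: card_insert_if)
  qed
qed

lemma independent_monomials:
  assumes "finite T"
  shows "pm.independent ((\<lambda>t. single t (1 :: 'k::field)) ` T)"
proof
  have inj: "inj_on (\<lambda>t. single t (1 :: 'k)) T"
    by (auto simp: inj_on_def dest: arg_cong[of _ _ keys])
  assume "pm.dependent ((\<lambda>t. single t (1 :: 'k)) ` T)"
  then obtain u t where t: "t \<in> T" "u (single t 1) \<noteq> 0"
    and "(\<Sum>v\<in>(\<lambda>t. single t (1 :: 'k)) ` T. pm_scale (u v) v) = 0"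
    using assms by (auto simp: pm.dependent_finite)
  then have "(\<Sum>s\<in>T. single s (u (single s 1))) = 0"
    by (simp add: sum.reindex[OF inj])
  then have "lookup (\<Sum>s\<in>T. single s (u (single s 1))) t = 0" by simp
  moreover have "lookup (\<Sum>s\<in>T. single s (u (single s 1))) t =
      (\<Sum>s\<in>T. if s = t then u (single t 1) else 0)"
    unfolding lookup_sum by (intro sum.cong) (auto simp: lookup_single when_def)
  ultimately show False using t assms by simp
qed

lemma sum_list_update_inj:
  fixes w :: "'n mon list"
  assumes "i < length w" "sum_list (w[i := t]) = sum_list w"
  shows "t = w ! i"
proof -
  have "sum_list (w[i := t]) = t + (sum_list (take i w) + sum_list (drop (Suc i) w))"
    using assms(1) by (simp add: upd_conv_take_nth_drop add_ac)
  moreover have "sum_list w = w ! i + (sum_list (take i w) + sum_list (drop (Suc i) w))"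
    by (subst id_take_nth_drop[OF assms(1)]) (simp add: add_ac)
  ultimately show ?thesis using assms(2) by simp
qed

text \<open>If all words in a wedge have the same weight, then changing one letter of such a word leaves the
  support. By the cofactor expansion the letters of the word lie in the span, and there are as many
  of them as its dimension.\<close>

lemma monomial_span_if_single_weight:
  fixes fs :: "('n::finite, 'k::field_char_0) pol list"
  assumes fs: "distinct fs" "pm.independent (set fs)"
    and weight: "\<And>w w'. w \<in> keys (wedge fs) \<Longrightarrow> w' \<in> keys (wedge fs) \<Longrightarrow> sum_list w = sum_list w'"
    and p: "p \<in> pm.span (set fs)" "t \<in> keys p"
  shows "single t 1 \<in> pm.span (set fs)"
proof -
  obtain w where w: "w \<in> keys (wedge fs)"
    using ex_in_keys[OF wedge_nonzero[OF fs]] ..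
  have len: "length w = length fs"
    using w by (auto simp: in_keys_iff lookup_wedge split: if_splits)
  have dist: "distinct w"
    using alternating_distinct[OF alternating_wedge w] .
  have letter: "single (w ! i) 1 \<in> pm.span (set fs)" if i: "i < length w" for i
  proof -
    obtain F where F: "F \<in> pm.span (set fs)" "\<And>t. lookup F t = lookup (wedge fs) (w[i := t])"
      using wedge_contraction[OF len, of i] i len by auto
    have "lookup F t = 0" if "t \<noteq> w ! i" for t
    proof (rule ccontr)
      assume "lookup F t \<noteq> 0"
      then have "w[i := t] \<in> keys (wedge fs)" by (simp add: F in_keys_iff)
      then have "sum_list (w[i := t]) = sum_list w" using weight w by blast
      then show False using sum_list_update_inj[OF i] that by blast
    qed
    then have "F = single (w ! i) (lookup (wedge fs) w)"
      by (intro poly_mapping_eqI) (auto simp: lookup_single when_def F(2))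
    then have "pm_scale (inverse (lookup (wedge fs) w)) F = single (w ! i) 1"
      using w by (simp add: in_keys_iff)
    then show ?thesis using pm.span_scale[OF F(1)] by metis
  qed
  let ?S = "(\<lambda>t. single t (1 :: 'k)) ` set w"
  have "?S \<subseteq> pm.span (set fs)"
    using letter by (auto simp: in_set_conv_nth)
  moreover have "card (set fs) \<le> card ?S"
  proof -
    have "inj_on (\<lambda>t. single t (1 :: 'k)) (set w)"
      by (auto simp: inj_on_def dest: arg_cong[of _ _ keys])
    then show ?thesis
      using dist fs(1) len by (simp add: card_image distinct_card)
  qed
  ultimately have "pm.span (set fs) \<subseteq> pm.span ?S"
    by (intro span_eq_if_card_le independent_monomials) auto
  also have "\<dots> \<subseteq> {q. keys q \<subseteq> set w}"
  proof (rule pm.span_minimal)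
    show "pm.subspace {q :: ('n, 'k) pol. keys q \<subseteq> set w}"
    proof (rule pm.subspaceI)
      fix x y :: "('n, 'k) pol" assume "x \<in> {q. keys q \<subseteq> set w}" "y \<in> {q. keys q \<subseteq> set w}"
      then show "x + y \<in> {q. keys q \<subseteq> set w}"
        using Poly_Mapping.keys_add[of x y] by blast
    qed (auto simp: in_keys_iff)
  qed auto
  finally have "t \<in> set w" using p by blast
  then show ?thesis using letter by (auto simp: in_set_conv_nth)
qed

text \<open>The substitution of \<open>x\<^sub>i + x\<^sub>j\<close> for \<open>x\<^sub>i\<close>.\<close>

definition shear :: "'n \<Rightarrow> 'n \<Rightarrow> 'k::comm_ring_1 ^ 'n ^ 'n" where
  "shear i j = (\<chi> a b. if a = b \<or> a = j \<and> b = i then 1 else 0)"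

lemma shear_in_SL:
  fixes i j :: "'n::finite"
  assumes "i \<noteq> j"
  shows "shear i j \<in> (SL :: ('k::comm_ring_1 ^ 'n ^ 'n) set)"
proof -
  have "shear i j = (\<chi> k. if k = j then row j (mat 1) + 1 *s row i (mat 1) else row k (mat 1 :: 'k ^ 'n ^ 'n))"
    using assms by (auto simp: shear_def vec_eq_iff row_def mat_def)
  then show ?thesis
    using det_row_operation[where A = "mat 1 :: 'k ^ 'n ^ 'n" and i = j and j = i and c = 1] assms by (simp add: SL_def)
qed

text \<open>The binomial theorem for \<open>(x\<^sub>i + x\<^sub>j) ^ n\<close>. The terms needed are \<open>r = n\<close>, the monomial
  itself, and \<open>r = n - 1\<close>, where one factor \<open>x\<^sub>i\<close> has been replaced by \<open>x\<^sub>j\<close>.\<close>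

lemma lookup_subst_act_shear:
  fixes i j :: "'n::finite"
  assumes ij: "i \<noteq> j" and s: "lookup s i = 0" and r: "r \<le> n"
  shows "lookup (subst_act (shear i j) (single (s + single i n) (1 :: 'k::comm_ring_1)))
    (s + single i r + single j (n - r)) = of_nat (n choose r)"
proof -
  let ?y = "\<lambda>b. \<Sum>a\<in>UNIV. const (shear i j $ a $ b) * var a :: ('n, 'k) pol"
  have other: "?y b = var b" if "b \<noteq> i" for b
  proof -
    have "?y b = (\<Sum>a\<in>UNIV. if a = b then var b else 0)"
      using that by (intro sum.cong) (auto simp: shear_def)
    then show ?thesis by simp
  qed
  have yi: "?y i = var i + var j"
  proof -
    have "?y i = (\<Sum>a\<in>UNIV. (if a = i then var i else 0) + (if a = j then var j else 0))"
      using ij by (intro sum.cong) (auto simp: shear_def)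
    then show ?thesis by (simp add: sum.distrib)
  qed
  have "monomial_value ?y s = monomial_value var s"
    unfolding monomial_value_def
  proof (rule prod.cong[OF refl])
    fix b assume "b \<in> keys s"
    then have "b \<noteq> i" using s by (auto simp: in_keys_iff)
    from other[OF this] show "?y b ^ lookup s b = var b ^ lookup s b" by (rule arg_cong)
  qed
  then have "subst_act (shear i j) (single (s + single i n) (1 :: 'k)) = single s 1 * (var i + var j) ^ n"
    by (simp add: subst_act_single monomial_value_add monomial_value_var yi)
  also have "(var i + var j :: ('n, 'k) pol) ^ n =
      (\<Sum>k\<le>n. single (single i k + single j (n - k)) (of_nat (n choose k)))"
  proof -
    have pow: "var b ^ k = single (single b k) (1 :: 'k)" for b :: 'n and k
      using monomial_value_var[of "single b k", where 'k = 'k] by simp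
    have "of_nat c * single t (1 :: 'k) = single t (of_nat c)" for c and t :: "'n mon"
      using mult_single[of 0 "of_nat c" t "1 :: 'k"] by simp
    then show ?thesis
      by (simp add: binomial_ring pow mult_single mult.assoc)
  qed
  finally have eq: "subst_act (shear i j) (single (s + single i n) (1 :: 'k)) =
      (\<Sum>k\<le>n. single (s + single i k + single j (n - k)) (of_nat (n choose k) :: 'k))"
    by (simp add: sum_distrib_left mult_single add.assoc)
  have "s + single i k + single j (n - k) = s + single i r + single j (n - r) \<longleftrightarrow> k = r" for k
  proof
    assume "s + single i k + single j (n - k) = s + single i r + single j (n - r)"
    from arg_cong[OF this, of "\<lambda>t. lookup t i"] show "k = r"
      using ij by (simp add: lookup_add lookup_single)
  qed simp
  then have "lookup (subst_act (shear i j) (single (s + single i n) (1 :: 'k)))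
      (s + single i r + single j (n - r)) = (\<Sum>k\<le>n. if k = r then of_nat (n choose r) else 0)"
    unfolding eq lookup_sum by (intro sum.cong) (auto simp: lookup_single when_def)
  then show ?thesis using r by simp
qed

text \<open>Moving a unit of the exponent of \<open>t\<close> from an index where it exceeds that of \<open>s\<close> to one where it
  falls short diminishes the total excess, so that \<open>t\<close> can be transformed into \<open>s\<close>.\<close>

lemma exchange_closed_monomials:
  fixes M :: "'n::finite mon set"
  assumes closed: "\<And>u i j. u + single i 1 \<in> M \<Longrightarrow> i \<noteq> j \<Longrightarrow> u + single j 1 \<in> M"
    and "t \<in> M" "mdeg t = mdeg s"
  shows "s \<in> M"
  using assms(2,3)
proof (induction "\<Sum>b\<in>UNIV. lookup t b - lookup s b" arbitrary: t rule: less_induct)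
  case less
  have deg: "(\<Sum>b\<in>UNIV. lookup t b) = (\<Sum>b\<in>UNIV. lookup s b)"
    using less.prems(2) by (simp add: mdeg_UNIV)
  show ?case
  proof (cases "t = s")
    case False
    have "\<exists>i. lookup t i > lookup s i"
    proof (rule ccontr)
      assume "\<nexists>i. lookup t i > lookup s i"
      then have le: "lookup t b \<le> lookup s b" for b by (simp add: not_less)
      then have "lookup t b = lookup s b" for b
        using deg by (metis UNIV_I finite le_neq_implies_less nat_less_le sum_strict_mono_ex1)
      then show False using False by (auto intro: poly_mapping_eqI)
    qed
    then obtain i where i: "lookup t i > lookup s i" ..
    have "\<exists>j. lookup t j < lookup s j"
    proof (rule ccontr)
      assume "\<nexists>j. lookup t j < lookup s j"
      then have "(\<Sum>b\<in>UNIV. lookup s b) < (\<Sum>b\<in>UNIV. lookup t b)"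
        using i by (intro sum_strict_mono_ex1) (auto simp: not_less)
      then show False using deg by simp
    qed
    then obtain j where j: "lookup t j < lookup s j" ..
    have ij: "i \<noteq> j" using i j by auto
    define u where "u = t - single i 1"
    have t: "t = u + single i 1"
      using i by (intro poly_mapping_eqI) (auto simp: u_def lookup_add lookup_minus lookup_single when_def)
    let ?t' = "u + single j 1"
    have t': "lookup ?t' b = (if b = i then lookup t i - 1 else if b = j then lookup t j + 1 else lookup t b)"
      for b using ij by (auto simp: u_def lookup_add lookup_minus lookup_single when_def)
    show ?thesis
    proof (rule less.hyps)
      show "?t' \<in> M" using closed ij less.prems(1) t by metis
      show "mdeg ?t' = mdeg s" using less.prems(2) t by (simp add: mdeg_add)
      show "(\<Sum>b\<in>UNIV. lookup ?t' b - lookup s b) < (\<Sum>b\<in>UNIV. lookup t b - lookup s b)"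
        unfolding t'
      proof (rule sum_strict_mono_ex1)
        show "\<exists>b\<in>UNIV. (if b = i then lookup t i - 1 else if b = j then lookup t j + 1 else lookup t b) -
            lookup s b < lookup t b - lookup s b"
          using i by (intro bexI[of _ i]) auto
      qed (use j in auto)
    qed
  qed (use less.prems in simp)
qed

lemma subst_act_SL_injective:
  assumes "g \<in> (SL :: ('k::field ^ 'n ^ 'n) set)"
  shows "inj (subst_act g)"
proof -
  obtain h where "h ** g = mat 1"
    using assms invertible_det_nz[of g] by (auto simp: SL_def invertible_def)
  then have "subst_act h (subst_act g p) = p" for p
    by (simp add: subst_act_compose)
  then show ?thesis by (metis injI)
qed

lemma subst_act_SL_basis:
  fixes fs :: "('n::finite, 'k::field) pol list"
  assumes "distinct fs" "pm.independent (set fs)" "g \<in> SL"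
  shows "distinct (map (subst_act g) fs)" "pm.independent (set (map (subst_act g) fs))"
proof -
  interpret Vector_Spaces.linear pm_scale pm_scale "subst_act g :: ('n, 'k) pol \<Rightarrow> _"
    by (rule linear_subst_act)
  have inj: "inj_on (subst_act g) X" for X :: "('n, 'k) pol set"
    using inj_on_subset[OF subst_act_SL_injective[OF assms(3)] subset_UNIV] .
  show "distinct (map (subst_act g) fs)"
    using assms(1) inj by (simp add: distinct_map)
  show "pm.independent (set (map (subst_act g) fs))"
    using independent_injective_image[OF assms(2) inj] by simp
qed

text \<open>A space of forms all of whose translates have a single weight is spanned by monomials, and so are
  its translates. Comparing with the translate by a shear, whose image of a monomial contains the
  neighbouring monomials with binomial coefficients that do not vanish in characteristic zero, shows
  that with each monomial it contains all monomials of the same degree.\<close>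

lemma all_forms_if_single_weight:
  fixes fs :: "('n::finite, 'k::field_char_0) pol list"
  assumes fs: "distinct fs" "pm.independent (set fs)" "set fs \<subseteq> homog (int m)" "fs \<noteq> []"
    and weight: "\<And>w w'. w \<in> generic_words (wedge fs) \<Longrightarrow> w' \<in> generic_words (wedge fs) \<Longrightarrow>
      sum_list w = sum_list w'"
  shows "homog (int m) \<subseteq> pm.span (set fs)"
proof -
  let ?W = "pm.span (set fs)"
  let ?V = "\<lambda>g. pm.span (set (map (subst_act g) fs))"
  have monomial: "single t 1 \<in> ?V g" if "g \<in> SL" "p \<in> ?V g" "t \<in> keys p" for g p t
  proof (rule monomial_span_if_single_weight[OF subst_act_SL_basis[OF fs(1,2) that(1)] _ that(2,3)])
    fix w w' assume "w \<in> keys (wedge (map (subst_act g) fs))" "w' \<in> keys (wedge (map (subst_act g) fs))"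
    then show "sum_list w = sum_list w'"
      using weight that(1) by (auto simp: generic_words_def tens_act_wedge[symmetric])
  qed
  have "map (subst_act (mat 1)) fs = fs" by (rule map_idI) simp
  moreover have "mat 1 \<in> (SL :: ('k ^ 'n ^ 'n) set)" by (simp add: SL_def)
  ultimately have monomial_W: "single t 1 \<in> ?W" if "p \<in> ?W" "t \<in> keys p" for p t
    using monomial[of "mat 1" p t] that by simp
  have image: "subst_act g p \<in> ?V g" if "p \<in> ?W" for g p
  proof -
    interpret Vector_Spaces.linear pm_scale pm_scale "subst_act g :: ('n, 'k) pol \<Rightarrow> _"
      by (rule linear_subst_act)
    show ?thesis using that by (simp add: span_image)
  qed
  have step: "single t 1 \<in> ?V (shear i j) \<and> single (u + single j 1) 1 \<in> ?V (shear i j)"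
    if W: "single t 1 \<in> ?W" and t: "t = u + single i 1" and ij: "i \<noteq> j" for t u i j
  proof -
    \<comment> \<open>Split off the full power of \<open>x\<^sub>i\<close> dividing the monomial.\<close>
    define n where "n = Suc (lookup u i)"
    define s where "s = u - single i (lookup u i)"
    have si: "lookup s i = 0"
      by (simp add: s_def lookup_minus)
    have u: "u = s + single i (lookup u i)"
      by (intro poly_mapping_eqI) (auto simp: s_def lookup_add lookup_minus lookup_single when_def)
    have ts: "t = s + single i n"
      by (subst t, subst u) (simp add: n_def add.assoc single_add[symmetric])
    let ?q = "subst_act (shear i j) (single (s + single i n) (1 :: 'k))"
    have q: "?q \<in> ?V (shear i j)" using image[OF W] by (simp add: ts)
    have "lookup ?q (s + single i n + single j (n - n)) \<noteq> 0"
      by (subst lookup_subst_act_shear[OF ij si]) auto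
    moreover have "lookup ?q (s + single i (n - 1) + single j (n - (n - 1))) \<noteq> 0"
      by (subst lookup_subst_act_shear[OF ij si]) (auto simp: n_def simp del: of_nat_Suc)
    ultimately have "t \<in> keys ?q" "u + single j 1 \<in> keys ?q"
      using u by (simp_all add: ts in_keys_iff n_def)
    then show ?thesis
      using monomial[OF shear_in_SL[OF ij] q] by blast
  qed
  have exchange: "single (u + single j 1) 1 \<in> ?W"
    if W: "single (u + single i 1) 1 \<in> ?W" and ij: "i \<noteq> j" for u i j
  proof -
    \<comment> \<open>The monomials of \<open>?W\<close> lie in the translate, which has the same dimension.\<close>
    have "?W \<subseteq> ?V (shear i j)"
    proof
      fix p assume p: "p \<in> ?W"
      have mon: "single t 1 \<in> ?V (shear i j)" if "t \<in> keys p" for t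
      proof (cases "lookup t i = 0")
        case False
        then have "t = (t - single i 1) + single i 1"
          by (intro poly_mapping_eqI) (auto simp: lookup_add lookup_minus lookup_single when_def)
        then show ?thesis using step[OF monomial_W[OF p that] _ ij] by blast
      next
        case True
        have "lookup (subst_act (shear i j) (single (t + single i 0) (1 :: 'k)))
            (t + single i 0 + single j (0 - 0)) \<noteq> 0"
          by (subst lookup_subst_act_shear[OF ij True]) auto
        then have "t \<in> keys (subst_act (shear i j) (single t (1 :: 'k)))"
          by (simp add: in_keys_iff)
        then show ?thesis
          using monomial[OF shear_in_SL[OF ij] image[OF monomial_W[OF p that]]] by blast
      qed
      have "(\<Sum>t\<in>keys p. pm_scale (lookup p t) (single t 1)) \<in> ?V (shear i j)"
        by (intro pm.span_sum pm.span_scale mon)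
      then show "p \<in> ?V (shear i j)" by (simp only: pm_sum_basis)
    qed
    then have "?V (shear i j) \<subseteq> ?W"
    proof (intro span_eq_if_card_le[OF fs(2)])
      show "set fs \<subseteq> ?V (shear i j)"
        using \<open>?W \<subseteq> ?V (shear i j)\<close> pm.span_superset by blast
      show "card (set (map (subst_act (shear i j)) fs)) \<le> card (set fs)"
        unfolding set_map by (rule card_image_le) simp
    qed simp
    then show ?thesis using step[OF W refl ij] by blast
  qed
  obtain f where f: "f \<in> set fs" using fs(4) by (cases fs) auto
  have "f \<noteq> 0" using f fs(2) pm.dependent_zero by metis
  then obtain t where t: "t \<in> keys f" using ex_in_keys by blast
  have tW: "single t 1 \<in> ?W" using monomial_W[OF pm.span_base[OF f] t] .
  have tm: "mdeg t = m" using f t fs(3) by (auto simp: homog_def)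
  show ?thesis
  proof
    fix p :: "('n, 'k) pol" assume p: "p \<in> homog (int m)"
    have "s \<in> {t. single t 1 \<in> ?W}" if "s \<in> keys p" for s
      by (rule exchange_closed_monomials[of _ t]) (use exchange tW tm p that in \<open>auto simp: homog_def\<close>)
    then have "(\<Sum>s\<in>keys p. pm_scale (lookup p s) (single s 1)) \<in> ?W"
      by (intro pm.span_sum pm.span_scale) auto
    then show "p \<in> ?W" by (simp only: pm_sum_basis)
  qed
qed


section \<open>Generators in low degree\<close>

text \<open>The generators in the first step of a minimal resolution of an \<open>r\<close>-regular ideal have degree at
  most \<open>r\<close>. The regularity is an infimum of integers, so a bound by \<open>m\<close> provides such an \<open>r\<close> that is at
  most \<open>m\<close>.\<close>

lemma homogeneous_element_of_low_degree:
  fixes I :: "('n::finite, 'k::comm_ring_1) pol set"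
  assumes "I \<noteq> {0}" "cm_regularity I \<le> ereal (real m)"
  obtains p d where "p \<in> I" "p \<noteq> 0" "p \<in> homog d" "d \<le> int m"
proof -
  have "cm_regularity I < ereal (real m + 1)"
    using assms(2) by (rule le_less_trans) simp
  then obtain r where r: "regular_in I r" "real_of_int r < real m + 1"
    unfolding cm_regularity_def Inf_less_iff by auto
  \<comment> \<open>The strict bound \<open>m + 1\<close> is what the infimum yields; integrality improves it.\<close>
  then have rm: "r \<le> int m" by linarith
  obtain b d f A where res: "min_free_resolution I b d f A" and d: "\<forall>i. \<forall>j<b i. d i j \<le> r + int i"
    using r(1) unfolding regular_in_def by blast
  have f: "f j \<in> homog (d 0 j)" if "j < b 0" for j
    using res that unfolding min_free_resolution_def by blast
  have I: "(\<lambda>c. \<Sum>j<b 0. c j * f j) ` free_mod (b 0) = I"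
    using res unfolding min_free_resolution_def by blast
  have "\<exists>j<b 0. f j \<noteq> 0"
  proof (rule ccontr)
    assume "\<not> (\<exists>j<b 0. f j \<noteq> 0)"
    then have "(\<Sum>j<b 0. c j * f j) = 0" for c by simp
    moreover have "(\<lambda>_. 0) \<in> free_mod (b 0)" by (simp add: free_mod_def)
    ultimately have "I = {0}" unfolding I[symmetric] by auto
    then show False using assms(1) by simp
  qed
  then obtain j where j: "j < b 0" "f j \<noteq> 0" by blast
  have "f j \<in> I"
  proof -
    have "(\<Sum>l<b 0. (if l = j then 1 else 0) * f l) = (\<Sum>l<b 0. if l = j then f j else 0)"
      by (intro sum.cong) auto
    then have "f j = (\<Sum>l<b 0. (if l = j then 1 else 0) * f l)"
      using j(1) by simp
    moreover have "(\<lambda>l. if l = j then 1 else 0) \<in> free_mod (b 0)"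
      using j(1) by (auto simp: free_mod_def)
    ultimately show ?thesis unfolding I[symmetric] by (rule image_eqI)
  qed
  moreover have "d 0 j \<le> int m" using d j(1) rm by force
  ultimately show thesis using that j(2) f[OF j(1)] by blast
qed

lemma single_mult_nonzero:
  fixes p :: "('n, 'k::comm_ring_1) pol"
  assumes "p \<noteq> 0"
  shows "single s 1 * p \<noteq> 0"
proof -
  obtain t where t: "t \<in> keys p" using ex_in_keys[OF assms] ..
  have "single s 1 * p = (\<Sum>t\<in>keys p. single s 1 * single t (lookup p t))"
    by (simp add: sum_distrib_left[symmetric] poly_mapping_sum_single)
  then have "lookup (single s 1 * p) (s + t) = (\<Sum>t'\<in>keys p. lookup (single (s + t') (lookup p t')) (s + t))"
    by (simp add: mult_single lookup_sum)
  also have "\<dots> = (\<Sum>t'\<in>keys p. if t' = t then lookup p t else 0)"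
    by (intro sum.cong) (auto simp: lookup_single when_def)
  also have "\<dots> = lookup p t"
    using t by simp
  finally have "lookup (single s 1 * p) (s + t) = lookup p t" .
  then show ?thesis using t by (auto simp: in_keys_iff)
qed

lemma piece_nonzero:
  fixes I :: "('n::finite, 'k::comm_ring_1) pol set"
  assumes "is_ideal I" "I \<noteq> {0}" "cm_regularity I \<le> ereal (real m)"
  shows "\<exists>p\<in>piece I m. p \<noteq> 0"
proof -
  obtain p d where p: "p \<in> I" "p \<noteq> 0" "p \<in> homog d" "d \<le> int m"
    using homogeneous_element_of_low_degree[OF assms(2,3)] .
  obtain t where "t \<in> keys p" using ex_in_keys[OF p(2)] ..
  then have "d \<ge> 0" using p(3) by (auto simp: homog_def)
  obtain i :: 'n where True by blast
  let ?q = "single (single i (m - nat d)) 1 * p"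
  have "?q \<in> I" using assms(1) p(1) by (simp add: is_ideal_def)
  moreover have "?q \<in> homog (int (m - nat d) + d)"
    by (rule homog_mult[OF _ p(3)]) simp
  then have "?q \<in> homog (int m)" using \<open>d \<ge> 0\<close> p(4) by (simp add: of_nat_diff)
  ultimately have "?q \<in> piece I m" by (simp add: piece_def)
  then show ?thesis using single_mult_nonzero[OF p(2)] by blast
qed


section \<open>Generic stability\<close>

theorem proposition7p2:
  fixes I :: "('n::finite, 'k::{alg_closed_field, field_char_0}) pol set"
    and m :: nat
    and R :: "('k ^ 'n ^ 'n) set"
    and \<iota> :: "('k ^ 'n ^ 'n \<Rightarrow> 'k) \<Rightarrow> 'v::euclidean_space"
  assumes "homogeneous_ideal I"
    and "CARD('n) > 1 \<Longrightarrow> I \<noteq> {0} \<and> piece I m \<noteq> piece UNIV m"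
    and "cm_regularity I \<le> ereal (real m)"
    and "maximal_torus R"
    and "real_characters R \<iota>"
  shows "hilbert_point_generically_stable R \<iota> I m"
proof -
  obtain H K where HK: "H ** K = mat 1" "K ** H = mat 1" "det H = 1" "det K = 1"
    and R: "R = diag_torus H K"
    using maximal_torus_eq_diag_torus[OF assms(4)] .
  interpret torus_frame H K
    by unfold_locales (fact HK)+
  have \<iota>: "real_characters T \<iota>" using assms(5) by (simp add: R)
  show ?thesis
    unfolding hilbert_point_generically_stable_def
  proof (intro allI impI)
    fix v assume "represents_hilbert_point I m v"
    then obtain fs where fs: "distinct fs" "pm.independent (set fs)"
      "pm.span (set fs) = piece I m" and v: "v = wedge fs"
      unfolding represents_hilbert_point_def by blast
    have homog: "set fs \<subseteq> homog (int m)"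
      using fs(3) pm.span_superset[of "set fs"] by (auto simp: piece_def)
    have dim: "length fs = pm.dim (piece I m)"
      using pm.dim_span_eq_card_independent[OF fs(2)] fs(1,3) by (simp add: distinct_card)
    define A where "A = sum_list ` generic_words v"
    have finA: "finite A"
      using finite_generic_words[OF homog] by (simp add: A_def v)
    have neA: "A \<noteq> {}"
    proof -
      have "keys v \<noteq> {}" using ex_in_keys[OF wedge_nonzero[OF fs(1,2)]] by (auto simp: v)
      moreover have "mat 1 \<in> (SL :: ('k ^ 'n ^ 'n) set)" by (simp add: SL_def)
      ultimately have "generic_words v \<noteq> {}"
        unfolding generic_words_def using tens_act_mat_1[of v] by force
      then show ?thesis by (simp add: A_def)
    qed
    have swapA: "swap_exponents i j a \<in> A" if "a \<in> A" "i \<noteq> j" for a i j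
      using that generic_words_swap[OF that(2)] by (force simp: A_def swap_exponents_sum_list[symmetric])
    have nonconst: "\<exists>a\<in>A. \<exists>i j. lookup a i \<noteq> lookup a j" if card: "CARD('n) > 1"
    proof (rule ccontr)
      assume "\<not> (\<exists>a\<in>A. \<exists>i j. lookup a i \<noteq> lookup a j)"
      then have const: "lookup a i = lookup a j" if "a \<in> A" for a i j
        using that by blast
      have deg: "mdeg a = length fs * m" if "a \<in> A" for a
      proof -
        obtain w where w: "w \<in> generic_words (wedge fs)" "a = sum_list w"
          using \<open>a \<in> A\<close> by (auto simp: A_def v)
        have "map mdeg w = replicate (length fs) m"
          using generic_words_wedge[OF homog w(1)] by (intro replicate_eqI) auto
        then show ?thesis by (simp add: w(2) mdeg_sum_list sum_list_replicate)
      qed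
      have eq: "a = a'" if "a \<in> A" "a' \<in> A" for a a'
      proof (rule poly_mapping_eqI)
        fix i
        have "CARD('n) * lookup a i = mdeg a" if "a \<in> A" for a
        proof -
          have "(\<Sum>b\<in>UNIV. lookup a b) = (\<Sum>b\<in>(UNIV :: 'n set). lookup a i)"
            by (intro sum.cong refl const[OF that])
          then show ?thesis by (simp add: mdeg_UNIV)
        qed
        then have "CARD('n) * lookup a i = CARD('n) * lookup a' i"
          using deg \<open>a \<in> A\<close> \<open>a' \<in> A\<close> by metis
        then show "lookup a i = lookup a' i" by simp
      qed
      have "I \<noteq> {0}" "piece I m \<noteq> piece UNIV m" using assms(2)[OF card] by auto
      moreover have "is_ideal I" using assms(1) by (simp add: homogeneous_ideal_def)
      ultimately obtain p where p: "p \<in> piece I m" "p \<noteq> 0"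
        using piece_nonzero[OF _ _ assms(3)] by blast
      have "fs \<noteq> []" using p fs(3) by auto
      have "homog (int m) \<subseteq> pm.span (set fs)"
        by (rule all_forms_if_single_weight[OF fs(1,2) homog \<open>fs \<noteq> []\<close>])
           (rule eq, auto simp: A_def v)
      then have "piece I m = piece UNIV m" unfolding fs(3) by (auto simp: piece_def)
      then show False using \<open>piece I m \<noteq> piece UNIV m\<close> by simp
    qed
    have "generic_state_polytope R \<iota> (pm.dim (piece I m)) m v =
        convex hull ((\<lambda>a. \<Sum>i\<in>UNIV. real (lookup a i) *\<^sub>R coordinate_char \<iota> i) ` A)"
      unfolding generic_state_polytope_def R v generic_state_wedge[OF homog dim] A_def
      by (simp add: image_image real_characters_weight_char[OF \<iota>])
    moreover have "span (\<iota> ` characters R) = span (range (coordinate_char \<iota>))"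
      using span_characters[OF \<iota>] by (simp add: R)
    ultimately show "0 \<in> top_of_set (span (\<iota> ` characters R)) interior_of
        generic_state_polytope R \<iota> (pm.dim (piece I m)) m v"
      using zero_in_interior_symmetric_hull[OF finA neA swapA sum_coordinate_char[OF \<iota>] nonconst]
      by simp
  qed
qed

end
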